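(* Let $n \geq 3$ and let $\Omega \subseteq \mathbb{R}^n$ be a convex $1$-admissible domain with a smooth boundary. Assume $\psi(x,u,Du)$, with $\psi \in C^{2}(\overline{\Omega} \times \mathbb{R} \times \mathbb{R}^n)$, is positive and $\varphi \in C^2(\overline{\Omega})$ is spacelike. Suppose $u \in C^{4}(\Omega) \cap C^2(\overline{\Omega})$ is a $2$-admissible solution to \[\sigma_2[u]=\psi(x,u, Du)\ \text{ in } \Omega,\qquad u=\varphi\ \text{ on } \partial\Omega.\] Then the maximum principal curvature $\kappa_{\max}(x):=\max_{1 \leq i \leq n} \kappa_{i}(x)$ of its graph satisfies \[\max_{\Omega} \kappa_{\max}(x) \leq C\left(1+\max_{\partial \Omega} \kappa_{\max}(x)\right)\] for some $C>0$ depending on $n,\|u\|_{C^1(\overline{\Omega})}, \|\psi\|_{C^2(\mathcal{D})}$ and $\|\varphi\|_{C^1(\overline{\Omega})}$, where \[\mathcal{D}:=\overline{\Omega} \times [\inf_{\Omega} u, \sup_{\Omega} u] \times \mathbb{R}^n.\]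
   Context: The Minkowski space $\mathbb{R}^{n,1}$ is $\mathbb{R}^{n+1}$ with the metric $dx_1^2+\cdots+dx_n^2-dx_{n+1}^2$. $D$ and $D^2$ denote the ordinary gradient and Hessian in $\mathbb{R}^n$. A function $u$ on $\overline{\Omega}$ is spacelike if $\sup_{\overline{\Omega}}|Du|<1$ (equivalently, its graph $\Sigma=\{(x,u(x)) : x\in\overline\Omega\}$ is a spacelike hypersurface of $\mathbb{R}^{n,1}$). For spacelike $u$, the principal curvatures $\kappa(x)=(\kappa_1(x),\ldots,\kappa_n(x))$ of its graph at $(x,u(x))$ are the eigenvalues of the matrix \[\frac{1}{w}\left(I+\frac{Du\otimes Du}{w^2}\right)D^2u,\qquad w=\sqrt{1-|Du|^2}.\] $\sigma_k(\kappa)=\sum_{1\le i_1<\cdots<i_k\le n}\kappa_{i_1}\cdots\kappa_{i_k}$ is the $k$-th elementary symmetric polynomial, and $\sigma_k[u](x):=\sigma_k(\kappa(x))$. A function $u$ (with the regularity stated in the claim) is $k$-admissible if its graph over $\overline\Omega$ is a $k$-convex spacelike hypersurface, i.e. $\sup_{\overline\Omega}|Du|<1$ and $\sigma_j[u]>0$ for all $x\in\overline\Omega$ and all $1\le j\le k$. A smooth bounded domain $\Omega\subseteq\mathbb{R}^n$ is $(k-1)$-admissible if at every point of $\partial\Omega$ at least $k-1$ principal curvatures of $\partial\Omega$ (relative to the interior normal) are positive. It is convex if all principal curvatures of $\partial\Omega$ are non-negative at every boundary point.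
   Formalization: The constant C may also depend on the domain Ω, and it depends on sup|u| and sup|Du| separately rather than on the single number ‖u‖_{C^1}, since the estimate fails otherwise; ‖ψ‖_{C^2(D)} is assumed finite. *)

theory Defs
  imports "HOL-Analysis.Analysis" "HOL-Computational_Algebra.Computational_Algebra"
begin

section \<open>Differentiability classes, closures and norms\<close>

definition partial :: "'a::euclidean_space \<Rightarrow> ('a \<Rightarrow> real) \<Rightarrow> 'a \<Rightarrow> real"
  where "partial b f x = frechet_derivative f (at x) b"

fun partials :: "'a::euclidean_space list \<Rightarrow> ('a \<Rightarrow> real) \<Rightarrow> 'a \<Rightarrow> real"
  where
    "partials [] f = f"
  | "partials (b # bs) f = partial b (partials bs f)"

definition multi_indices :: "nat \<Rightarrow> 'a::euclidean_space list set"
  where "multi_indices k = {bs. set bs \<subseteq> Basis \<and> length bs \<le> k}"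

text \<open>The class C^k(S); meant for open S.\<close>

definition Ck_on :: "nat \<Rightarrow> 'a::euclidean_space set \<Rightarrow> ('a \<Rightarrow> real) \<Rightarrow> bool"
  where "Ck_on k S f \<longleftrightarrow>
    (\<forall>bs\<in>multi_indices k. continuous_on S (partials bs f) \<and>
      (length bs < k \<longrightarrow> (\<forall>x\<in>S. partials bs f differentiable (at x))))"

text \<open>The class C^k of the closure of an open S: the function is C^k in S, is continuous up
  to the boundary, and all its derivatives of order at most k extend continuously to the
  closure of S.\<close>

definition Ck_on_closure :: "nat \<Rightarrow> 'a::euclidean_space set \<Rightarrow> ('a \<Rightarrow> real) \<Rightarrow> bool"
  where "Ck_on_closure k S f \<longleftrightarrow>
    Ck_on k S f \<and> continuous_on (closure S) f \<and>
    (\<forall>bs\<in>multi_indices k. \<exists>g. continuous_on (closure S) g \<and> (\<forall>x\<in>S. g x = partials bs f x))"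

text \<open>The value at a point of the closure of S of the continuous extension of a function
  given on S. This is how derivatives are evaluated at boundary points; for continuous f and
  x in an open S it is f x.\<close>

definition cont_ext :: "'a::euclidean_space set \<Rightarrow> ('a \<Rightarrow> real) \<Rightarrow> 'a \<Rightarrow> real"
  where "cont_ext S f x = Lim (at x within S) f"

text \<open>The C^k norm over a subset A of the closure of the open set S, as an extended number
  (it may be infinite if A is not compact).\<close>

definition Ck_norm :: "nat \<Rightarrow> 'a::euclidean_space set \<Rightarrow> 'a set \<Rightarrow> ('a \<Rightarrow> real) \<Rightarrow> ennreal"
  where "Ck_norm k S A f =
    (\<Sum>bs\<in>multi_indices k. SUP x\<in>A. ennreal \<bar>cont_ext S (partials bs f) x\<bar>)"

definition Grad :: "(real^'n) set \<Rightarrow> (real^'n \<Rightarrow> real) \<Rightarrow> real^'n \<Rightarrow> real^'n"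
  where "Grad S f x = (\<chi> i. cont_ext S (partials [axis i 1] f) x)"

definition Hess :: "(real^'n) set \<Rightarrow> (real^'n \<Rightarrow> real) \<Rightarrow> real^'n \<Rightarrow> real^'n^'n"
  where "Hess S f x = (\<chi> i j. cont_ext S (partials [axis i 1, axis j 1] f) x)"

text \<open>The C^1 size of a spacelike function, recorded as the pair (sup of |u|, sup of |Du|).
  The two entries are kept apart because the position of the second one relative to 1 matters
  for a spacelike function, and it cannot be read off from the sum or the maximum of the two.\<close>

definition C1_size :: "(real^'n) set \<Rightarrow> (real^'n \<Rightarrow> real) \<Rightarrow> ennreal \<times> ennreal"
  where "C1_size S u =
    (SUP x\<in>closure S. ennreal \<bar>u x\<bar>, SUP x\<in>closure S. ennreal (norm (Grad S u x)))"


section \<open>Eigenvalues and elementary symmetric polynomials\<close>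

definition charpoly :: "real^'n^'n \<Rightarrow> real poly"
  where "charpoly A = det (\<chi> i j. (if i = j then [:0, 1:] else 0) - [:A $ i $ j:])"

text \<open>The eigenvalues of A listed with algebraic multiplicity, in an unspecified order; only
  used for matrices whose eigenvalues are all real, and only through expressions that do not
  depend on the order.\<close>

definition eigvals :: "real^'n^'n \<Rightarrow> real^'n"
  where "eigvals A = (SOME \<kappa>. image_mset (\<lambda>i. \<kappa> $ i) (mset_set UNIV) = proots (charpoly A))"

definition sigma :: "nat \<Rightarrow> real^'n \<Rightarrow> real"
  where "sigma k \<kappa> = (\<Sum>I\<in>{I. card I = k}. \<Prod>i\<in>I. \<kappa> $ i)"

definition outer :: "real^'n \<Rightarrow> real^'n \<Rightarrow> real^'n^'n"
  where "outer v w = (\<chi> i j. v $ i * w $ j)"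


section \<open>Spacelike graphs\<close>

definition spacelike :: "(real^'n) set \<Rightarrow> (real^'n \<Rightarrow> real) \<Rightarrow> bool"
  where "spacelike S u \<longleftrightarrow> (SUP x\<in>closure S. ennreal (norm (Grad S u x))) < 1"

definition curvature_matrix :: "(real^'n) set \<Rightarrow> (real^'n \<Rightarrow> real) \<Rightarrow> real^'n \<Rightarrow> real^'n^'n"
  where "curvature_matrix S u x =
    (let p = Grad S u x; w = sqrt (1 - (norm p)\<^sup>2)
     in (1 / w) *\<^sub>R ((mat 1 + (1 / w\<^sup>2) *\<^sub>R outer p p) ** Hess S u x))"

definition curvatures :: "(real^'n) set \<Rightarrow> (real^'n \<Rightarrow> real) \<Rightarrow> real^'n \<Rightarrow> real^'n"
  where "curvatures S u x = eigvals (curvature_matrix S u x)"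

definition curvature_max :: "(real^'n) set \<Rightarrow> (real^'n \<Rightarrow> real) \<Rightarrow> real^'n \<Rightarrow> real"
  where "curvature_max S u x = Max (range (\<lambda>i. curvatures S u x $ i))"

definition sigma_op :: "nat \<Rightarrow> (real^'n) set \<Rightarrow> (real^'n \<Rightarrow> real) \<Rightarrow> real^'n \<Rightarrow> real"
  where "sigma_op k S u x = sigma k (curvatures S u x)"

definition admissible :: "nat \<Rightarrow> (real^'n) set \<Rightarrow> (real^'n \<Rightarrow> real) \<Rightarrow> bool"
  where "admissible k S u \<longleftrightarrow>
    spacelike S u \<and> (\<forall>x\<in>closure S. \<forall>j\<in>{1..k}. sigma_op j S u x > 0)"


section \<open>Smooth bounded domains and the curvatures of their boundary\<close>

definition local_defining_function ::
  "(real^'n) set \<Rightarrow> real^'n \<Rightarrow> (real^'n) set \<Rightarrow> (real^'n \<Rightarrow> real) \<Rightarrow> bool"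
  where "local_defining_function \<Omega> p U \<rho> \<longleftrightarrow>
    open U \<and> p \<in> U \<and> (\<forall>k. Ck_on k U \<rho>) \<and>
    \<Omega> \<inter> U = {x\<in>U. \<rho> x < 0} \<and> frontier \<Omega> \<inter> U = {x\<in>U. \<rho> x = 0} \<and>
    (\<forall>x\<in>U. Grad U \<rho> x \<noteq> 0)"

definition smooth_bounded_domain :: "(real^'n) set \<Rightarrow> bool"
  where "smooth_bounded_domain \<Omega> \<longleftrightarrow>
    open \<Omega> \<and> connected \<Omega> \<and> \<Omega> \<noteq> {} \<and> bounded \<Omega> \<and>
    (\<forall>p\<in>frontier \<Omega>. \<exists>U \<rho>. local_defining_function \<Omega> p U \<rho>)"

text \<open>The interior unit normal is N = - D rho / |D rho|, so the shape operator - dN on the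
  tangent space at p is the compression of D^2 rho / |D rho| to the orthogonal complement of
  D rho. The n x n matrix below is this operator extended by 0 in the normal direction. For the
  ball of radius R it has the eigenvalue 1/R with multiplicity n - 1.\<close>

definition shape_matrix :: "(real^'n) set \<Rightarrow> (real^'n \<Rightarrow> real) \<Rightarrow> real^'n \<Rightarrow> real^'n^'n"
  where "shape_matrix U \<rho> p =
    (let g = Grad U \<rho> p; \<nu> = (1 / norm g) *\<^sub>R g; P = mat 1 - outer \<nu> \<nu>
     in (1 / norm g) *\<^sub>R (P ** Hess U \<rho> p ** P))"

text \<open>The n - 1 principal curvatures relative to the interior normal: the eigenvalues of the
  shape matrix, with one copy of 0 (the normal direction) removed. They do not depend on the
  chosen local defining function.\<close>

definition boundary_curvatures :: "(real^'n) set \<Rightarrow> real^'n \<Rightarrow> real multiset"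
  where "boundary_curvatures \<Omega> p =
    (let (U, \<rho>) = (SOME (U, \<rho>). local_defining_function \<Omega> p U \<rho>)
     in proots (charpoly (shape_matrix U \<rho> p)) - {#0#})"

definition admissible_domain :: "nat \<Rightarrow> (real^'n) set \<Rightarrow> bool"
  where "admissible_domain m \<Omega> \<longleftrightarrow>
    (\<forall>p\<in>frontier \<Omega>. m \<le> size (filter_mset (\<lambda>\<kappa>. 0 < \<kappa>) (boundary_curvatures \<Omega> p)))"

definition convex_domain :: "(real^'n) set \<Rightarrow> bool"
  where "convex_domain \<Omega> \<longleftrightarrow>
    (\<forall>p\<in>frontier \<Omega>. \<forall>\<kappa>\<in>#boundary_curvatures \<Omega> p. 0 \<le> \<kappa>)"

end

theory Submission
  imports Defs
begin

text \<open>
  Writing \<nu> = Du/w, the mixed second fundamental form of the graph is the Jacobian matrix of \<nu>,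
  and its trace H satisfies H/n \<le> \<kappa>_max \<le> H, because \<sigma>_2 > 0 forces |A| < H. It therefore
  suffices to bound H, which is done by the maximum principle for log H + N |x|^2 / 2.

  Let \<kappa>_1 be the largest curvature at an interior maximum point. Because of the sign of the Gauss
  equation in Minkowski space, differentiating the equation twice produces the positive term
  F^{ij} h_{ik} h_{kj} = \<Sum> (H - \<kappa>_i) \<kappa>_i^2. It dominates all other terms unless H - \<kappa>_1 and the
  remaining curvatures are small compared with H; in that case the third order terms can be
  controlled, because the critical point equation gives |DH| \<le> C N H. The function N |x|^2 / 2 finally
  contributes N (n - 1) H, which absorbs every remaining term of order H, in particular the second
  derivatives of \<psi>. No lower bound for \<psi> enters.
\<close>

text \<open>The obstacle is the order of choices. The critical point equation bounds |DH| by m H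
  with m proportional to the weight N (called \<open>c\<close> in the code), so a third order error
  of size m^2 H^2 in the equation for H would always beat the gain N H^2. Such errors have to be
  paid for by H times the positive curvature term; what is left contains m only at order H. Hence N
  can be fixed from n, the gradient bound and the bounds on \<psi>, and the threshold for H
  afterwards. H, unlike \<kappa>_max, stays differentiable where eigenvalues coincide. Covariant
  derivatives are avoided: the frame that diagonalizes the shape operator at the maximum point is
  kept constant on the whole domain, so that derivatives along it commute. In exchange the inverse
  metric I + \<nu>\<nu>^T varies; its first derivatives play the role of the Christoffel symbols and
  its second derivatives produce the Gauss equation. Two derivatives of \<psi>(x, u, Du) contain
  third derivatives of u. Only their trace with respect to the inverse metric occurs, and that trace
  is controlled by DH.\<close>

no_notation fps_nth (infixl \<open>$\<close> 75)


section \<open>Repeated differentiation\<close>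

lemma partial_eqI: "(f has_derivative f') (at x) \<Longrightarrow> partial v f x = f' v"
  unfolding partial_def using frechet_derivative_at by fastforce

lemma partial_has_derivative:
  "f differentiable (at x) \<Longrightarrow> (f has_derivative (\<lambda>v. partial v f x)) (at x)"
  unfolding partial_def using frechet_derivative_works by blast

lemma linear_partial: "f differentiable (at x) \<Longrightarrow> linear (\<lambda>v. partial v f x)"
  using partial_has_derivative has_derivative_linear by blast

lemma partial_along_line:
  assumes "f differentiable (at (a + s *\<^sub>R v))"
  shows "((\<lambda>s. f (a + s *\<^sub>R v)) has_real_derivative partial v f (a + s *\<^sub>R v)) (at s)"
proof -
  have "((\<lambda>s. a + s *\<^sub>R v) has_derivative (\<lambda>r. r *\<^sub>R v)) (at s)"
    by (auto intro!: derivative_eq_intros)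
  from has_derivative_compose[OF this partial_has_derivative[OF assms]]
  have "((\<lambda>s. f (a + s *\<^sub>R v)) has_derivative (\<lambda>r. partial (r *\<^sub>R v) f (a + s *\<^sub>R v))) (at s)" .
  moreover have "(\<lambda>r. partial (r *\<^sub>R v) f (a + s *\<^sub>R v)) = (*) (partial v f (a + s *\<^sub>R v))"
    using linear_cmul[OF linear_partial[OF assms]] by (auto simp: mult.commute)
  ultimately show ?thesis by (simp add: has_field_derivative_def)
qed

lemma partial_cong_open:
  assumes "open S" "x \<in> S" "\<And>y. y \<in> S \<Longrightarrow> f y = g y"
  shows "partial v f x = partial v g x"
proof -
  have "(f has_derivative f') (at x) \<longleftrightarrow> (g has_derivative f') (at x)" for f'
    using has_derivative_transform_within_open[of f f' x UNIV S g]
      has_derivative_transform_within_open[of g f' x UNIV S f] assms by auto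
  \<comment> \<open>\<open>frechet_derivative\<close> is a choice from the predicate
    \<open>has_derivative\<close>; equal predicates give equal choices, also at points where no
    derivative exists.\<close>
  then show ?thesis unfolding partial_def frechet_derivative_def by presburger
qed

lemma differentiable_cong_open:
  assumes "open S" "x \<in> S" "\<And>y. y \<in> S \<Longrightarrow> f y = g y" "f differentiable (at x)"
  shows "g differentiable (at x)"
  using assms has_derivative_transform_within_open[of f _ x UNIV S g]
  unfolding differentiable_def by auto

text \<open>Unlike for the class C^k, the derivatives of order k need not be continuous.\<close>

fun diff_upto :: "nat \<Rightarrow> 'a::euclidean_space set \<Rightarrow> ('a \<Rightarrow> real) \<Rightarrow> bool"
  where
    "diff_upto 0 S f \<longleftrightarrow> True"
  | "diff_upto (Suc k) S f \<longleftrightarrow>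
      (\<forall>x\<in>S. f differentiable (at x)) \<and> (\<forall>v. diff_upto k S (partial v f))"

lemma diff_upto_mono: "diff_upto k S f \<Longrightarrow> j \<le> k \<Longrightarrow> diff_upto j S f"
proof (induction k arbitrary: f j)
  case (Suc k)
  then show ?case by (cases j) auto
qed simp

lemma diff_upto_cong:
  assumes "open S"
  shows "(\<And>y. y \<in> S \<Longrightarrow> f y = g y) \<Longrightarrow> diff_upto k S f \<Longrightarrow> diff_upto k S g"
proof (induction k arbitrary: f g)
  case (Suc k)
  have "diff_upto k S (partial v g)" for v
    using Suc.IH[of "partial v f" "partial v g"] Suc.prems partial_cong_open[OF assms, of _ f g v] by auto
  then show ?case using Suc.prems differentiable_cong_open[OF assms, of _ f g] by auto
qed simp

lemma diff_upto_partial: "diff_upto (Suc k) S f \<Longrightarrow> diff_upto k S (partial v f)"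
  by simp

lemma diff_uptoD: "diff_upto k S f \<Longrightarrow> 0 < k \<Longrightarrow> x \<in> S \<Longrightarrow> f differentiable (at x)"
  by (cases k) auto

section \<open>Stability of repeated differentiability under algebraic operations\<close>

lemma partial_const [simp]: "partial v (\<lambda>x. c) x = 0"
  by (rule partial_eqI) (rule has_derivative_const)

lemma diff_upto_const [simp]: "diff_upto k S (\<lambda>x. c)"
proof (induction k arbitrary: c)
  case (Suc k)
  have "partial v (\<lambda>x::'a. c) = (\<lambda>x. 0)" for v by (rule ext) simp
  then show ?case using Suc[of 0] by simp
qed simp

lemma partial_add:
  "f differentiable (at x) \<Longrightarrow> g differentiable (at x) \<Longrightarrow>
    partial v (\<lambda>x. f x + g x) x = partial v f x + partial v g x"
  by (intro partial_eqI has_derivative_add partial_has_derivative)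

lemma partial_diff:
  "f differentiable (at x) \<Longrightarrow> g differentiable (at x) \<Longrightarrow>
    partial v (\<lambda>x. f x - g x) x = partial v f x - partial v g x"
  by (intro partial_eqI has_derivative_diff partial_has_derivative)

lemma partial_mult:
  "f differentiable (at x) \<Longrightarrow> g differentiable (at x) \<Longrightarrow>
    partial v (\<lambda>x. f x * g x) x = f x * partial v g x + partial v f x * g x"
  by (intro partial_eqI has_derivative_mult partial_has_derivative)

lemma partial_sum:
  "(\<And>i. i \<in> I \<Longrightarrow> f i differentiable (at x)) \<Longrightarrow>
    partial v (\<lambda>x. \<Sum>i\<in>I. f i x) x = (\<Sum>i\<in>I. partial v (f i) x)"
  by (intro partial_eqI has_derivative_sum partial_has_derivative)

lemma diff_upto_add:
  assumes "open S"
  shows "diff_upto k S f \<Longrightarrow> diff_upto k S g \<Longrightarrow>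
    diff_upto k S (\<lambda>x. f x + g x)"
proof (induction k arbitrary: f g)
  case (Suc k)
  have "diff_upto k S (partial v (\<lambda>x. f x + g x))" for v
    by (rule diff_upto_cong[OF assms _ Suc.IH[of "partial v f" "partial v g"]])
      (use Suc.prems in \<open>auto simp: partial_add\<close>)
  then show ?case using Suc.prems by auto
qed simp

lemma diff_upto_mult:
  assumes "open S"
  shows "diff_upto k S f \<Longrightarrow> diff_upto k S g \<Longrightarrow>
    diff_upto k S (\<lambda>x. f x * g x)"
proof (induction k arbitrary: f g)
  case (Suc k)
  have "diff_upto k S (partial v (\<lambda>x. f x * g x))" for v
  proof (rule diff_upto_cong[OF assms])
    show "diff_upto k S (\<lambda>x. f x * partial v g x + partial v f x * g x)"
      using Suc.prems diff_upto_mono[of "Suc k" S _ k]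
      by (intro diff_upto_add[OF assms] Suc.IH) auto
  qed (use Suc.prems in \<open>auto simp: partial_mult\<close>)
  then show ?case using Suc.prems by auto
qed simp

lemma diff_upto_sum:
  assumes "open S" "finite I"
  shows "(\<And>i. i \<in> I \<Longrightarrow> diff_upto k S (f i)) \<Longrightarrow>
    diff_upto k S (\<lambda>x. \<Sum>i\<in>I. f i x)"
  using assms(2) by (induction I) (auto intro!: diff_upto_add[OF assms(1)])

lemma diff_upto_diff:
  assumes "open S" "diff_upto k S f" "diff_upto k S g"
  shows "diff_upto k S (\<lambda>x. f x - g x)"
  using diff_upto_add[OF assms(1,2)
      diff_upto_mult[OF assms(1) diff_upto_const[of k S "-1"] assms(3)]]
  by simp

lemma partial_inner: "partial v (\<lambda>x. x \<bullet> c) x = v \<bullet> c"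
  by (rule partial_eqI) (auto intro!: derivative_eq_intros)

lemma diff_upto_inner: "diff_upto k S (\<lambda>x. x \<bullet> c)"
proof (cases k)
  case (Suc j)
  have "partial v (\<lambda>x. x \<bullet> c) = (\<lambda>x. v \<bullet> c)" for v :: 'a
    by (rule ext) (rule partial_inner)
  then show ?thesis using Suc by (auto intro!: derivative_intros)
qed simp

lemma partial_inverse_sqrt:
  assumes "f differentiable (at x)" "0 < f x"
  shows "(\<lambda>x. inverse (sqrt (f x))) differentiable (at x)"
    and "partial v (\<lambda>x. inverse (sqrt (f x))) x
      = - (1/2) * (inverse (sqrt (f x)))^3 * partial v f x"
proof -
  have *: "((\<lambda>x. inverse (sqrt (f x))) has_derivative
     (\<lambda>v. - (inverse (sqrt (f x)) * (partial v f x * (inverse (sqrt (f x)) / 2)) * inverse (sqrt (f x))))) (at x)"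
    using assms by (auto intro!: derivative_eq_intros partial_has_derivative)
  then show "(\<lambda>x. inverse (sqrt (f x))) differentiable (at x)"
    unfolding differentiable_def by blast
  show "partial v (\<lambda>x. inverse (sqrt (f x))) x
      = - (1/2) * (inverse (sqrt (f x)))^3 * partial v f x"
    by (subst partial_eqI[OF *]) (simp add: power3_eq_cube)
qed

text \<open>The derivative of g = f^(-1/2) is -(1/2) g^3 Df, a product of g and Df. Induction with
  the product rule therefore suffices.\<close>

lemma diff_upto_inverse_sqrt:
  assumes "open S" "\<And>x. x \<in> S \<Longrightarrow> 0 < f x"
  shows "diff_upto k S f \<Longrightarrow> diff_upto k S (\<lambda>x. inverse (sqrt (f x)))"
proof (induction k)
  case (Suc k)
  let ?g = "\<lambda>x. inverse (sqrt (f x))"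
  have g: "diff_upto k S ?g"
    using Suc.IH Suc.prems diff_upto_mono[of "Suc k" S _ k] by auto
  have "diff_upto k S (partial v ?g)" for v
  proof (rule diff_upto_cong[OF assms(1)])
    show "diff_upto k S (\<lambda>x. - (1/2) * (?g x * (?g x * ?g x)) * partial v f x)"
      using g Suc.prems
      by (intro diff_upto_mult[OF assms(1)] diff_upto_const) auto
  qed (use Suc.prems assms(2) partial_inverse_sqrt(2)[of f] in \<open>auto simp: power3_eq_cube\<close>)
  then show ?case using Suc.prems assms(2) partial_inverse_sqrt(1)[of f] by auto
qed simp

lemma partial_exp:
  assumes "f differentiable (at x)"
  shows "(\<lambda>x. exp (f x)) differentiable (at x)"
    and "partial v (\<lambda>x. exp (f x)) x = exp (f x) * partial v f x"
proof -
  have *: "((\<lambda>x. exp (f x)) has_derivative (\<lambda>v. exp (f x) * partial v f x)) (at x)"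
    using assms by (auto intro!: derivative_eq_intros partial_has_derivative)
  then show "(\<lambda>x. exp (f x)) differentiable (at x)"
    unfolding differentiable_def by blast
  show "partial v (\<lambda>x. exp (f x)) x = exp (f x) * partial v f x"
    by (rule partial_eqI[OF *])
qed

lemma diff_upto_exp:
  assumes "open S"
  shows "diff_upto k S f \<Longrightarrow> diff_upto k S (\<lambda>x. exp (f x))"
proof (induction k)
  case (Suc k)
  have g: "diff_upto k S (\<lambda>x. exp (f x))"
    using Suc.IH Suc.prems diff_upto_mono[of "Suc k" S _ k] by auto
  have "diff_upto k S (partial v (\<lambda>x. exp (f x)))" for v
  proof (rule diff_upto_cong[OF assms(1)])
    show "diff_upto k S (\<lambda>x. exp (f x) * partial v f x)"
      using g Suc.prems by (intro diff_upto_mult[OF assms(1)]) auto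
  qed (use Suc.prems in \<open>auto simp: partial_exp\<close>)
  then show ?case using Suc.prems partial_exp(1) by auto
qed simp

lemma partial_Basis:
  assumes "f differentiable (at x)"
  shows "partial v f x = (\<Sum>b\<in>Basis. (v \<bullet> b) * partial b f x)"
proof -
  have "partial v f x = partial (\<Sum>b\<in>Basis. (v \<bullet> b) *\<^sub>R b) f x"
    by (simp add: euclidean_representation)
  also have "\<dots> = (\<Sum>b\<in>Basis. (v \<bullet> b) * partial b f x)"
    unfolding linear_sum[OF linear_partial[OF assms]] linear_cmul[OF linear_partial[OF assms]] by simp
  finally show ?thesis .
qed

text \<open>\<open>Ck_on\<close> speaks of derivatives along the coordinate basis, while the later
  frames need arbitrary directions. A directional derivative is a fixed linear combination of
  coordinate ones; the induction runs over the number j of derivatives still to be taken, for every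
  list \<open>bs\<close> of those already taken.\<close>

lemma Ck_on_imp_diff_upto:
  assumes "open S" "Ck_on k S f"
  shows "diff_upto k S f"
proof -
  have "set bs \<subseteq> Basis \<Longrightarrow> length bs + j \<le> k \<Longrightarrow> diff_upto j S (partials bs f)" for j bs
  proof (induction j arbitrary: bs)
    case (Suc j)
    then have d: "\<forall>x\<in>S. partials bs f differentiable (at x)"
      using assms(2) unfolding Ck_on_def multi_indices_def by auto
    have "diff_upto j S (partial v (partials bs f))" for v
    proof (rule diff_upto_cong[OF assms(1)])
      show "diff_upto j S (\<lambda>x. \<Sum>b\<in>Basis. (v \<bullet> b) * partials (b # bs) f x)"
        using Suc by (intro diff_upto_sum[OF assms(1)] diff_upto_mult[OF assms(1)]
          diff_upto_const Suc.IH) auto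
    qed (simp add: partial_Basis[OF d[rule_format]])
    then show ?case using d by auto
  qed simp
  from this[of "[]" k] show ?thesis by simp
qed

text \<open>The mean value theorem in direction v turns the second difference into t times a
  difference of h = D_v f at two points near x. Differentiability of h at x itself then identifies
  the limit.\<close>

lemma second_difference_limit:
  fixes f :: "'a::euclidean_space \<Rightarrow> real"
  assumes "open S" "x \<in> S" "diff_upto 2 S f"
  shows "((\<lambda>t. (f (x + t *\<^sub>R v + t *\<^sub>R w) - f (x + t *\<^sub>R v) - f (x + t *\<^sub>R w) + f x) / t\<^sup>2)
    \<longlongrightarrow> partial w (partial v f) x) (at_right 0)"
proof (rule tendstoI)
  fix e :: real assume e: "e > 0"
  define h where "h = partial v f"
  \<comment> \<open>The two remainders \<open>E1\<close> and \<open>E2\<close> are evaluated at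
    distances at most t (|v| + |w|) and t |v|, which add up to at most t M; the summand 1 keeps M
    positive.\<close>
  define M where "M = 2 * norm v + norm w + 1"
  have M: "M > 0" by (simp add: M_def add_nonneg_pos)
  have f: "f differentiable (at y)" if "y \<in> S" for y
    using assms(3) that by (auto simp: eval_nat_numeral)
  have h: "h differentiable (at x)" using assms(2,3) by (auto simp: eval_nat_numeral h_def)
  have eM: "e / (2 * M) > 0" using e M by simp
  obtain d1 where d1: "d1 > 0" and hd: "\<And>y. norm (y - x) < d1 \<Longrightarrow>
      norm (h y - h x - partial (y - x) h x) \<le> e / (2 * M) * norm (y - x)"
    using partial_has_derivative[OF h, unfolded has_derivative_at_alt] eM by blast
  obtain d2 where d2: "d2 > 0" and ball: "ball x d2 \<subseteq> S"
    using assms(1,2) openE by blast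
  define d where "d = min d1 d2 / M"
  have d: "d > 0" using d1 d2 M by (simp add: d_def)
  have lin: "linear (\<lambda>v. partial v h x)" using linear_partial[OF h] .
  have "dist ((f (x + t *\<^sub>R v + t *\<^sub>R w) - f (x + t *\<^sub>R v) - f (x + t *\<^sub>R w) + f x) / t\<^sup>2)
      (partial w (partial v f) x) < e" if t: "0 < t" "t < d" for t
  proof -
    have tM: "t * M < min d1 d2" using t M by (simp add: d_def pos_less_divide_eq)
    have small: "norm (s *\<^sub>R v + r *\<^sub>R w) < min d1 d2 \<and> norm (s *\<^sub>R v + r *\<^sub>R w) \<le> t * (norm v + norm w)"
      if "0 \<le> s" "s \<le> t" "0 \<le> r" "r \<le> t" for s r
    proof -
      have "norm (s *\<^sub>R v + r *\<^sub>R w) \<le> s * norm v + r * norm w"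
        using norm_triangle_ineq[of "s *\<^sub>R v" "r *\<^sub>R w"] that by simp
      also have "\<dots> \<le> t * norm v + t * norm w" using that by (intro add_mono mult_right_mono) auto
      also have "\<dots> \<le> t * M" using t by (simp add: M_def distrib_left)
      finally show ?thesis using tM \<open>norm (s *\<^sub>R v + r *\<^sub>R w) \<le> s * norm v + r * norm w\<close>
          \<open>s * norm v + r * norm w \<le> t * norm v + t * norm w\<close> by (simp add: distrib_left)
    qed
    have inS: "x + s *\<^sub>R v + r *\<^sub>R w \<in> S" if "0 \<le> s" "s \<le> t" "0 \<le> r" "r \<le> t" for s r
      using small[OF that] by (intro subsetD[OF ball]) (simp add: dist_norm norm_minus_commute add.assoc, simp add: add.commute)
    have der: "((\<lambda>s. f (x + s *\<^sub>R v + r *\<^sub>R w)) has_real_derivative h (x + s *\<^sub>R v + r *\<^sub>R w)) (at s)"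
      if "0 \<le> s" "s \<le> t" "0 \<le> r" "r \<le> t" for s r
      using partial_along_line[of f "x + r *\<^sub>R w" s v] f[OF inS[OF that]]
      by (simp add: h_def algebra_simps)
    define \<phi> where "\<phi> s = f (x + s *\<^sub>R v + t *\<^sub>R w) - f (x + s *\<^sub>R v + 0 *\<^sub>R w)" for s
    have "(\<phi> has_real_derivative h (x + s *\<^sub>R v + t *\<^sub>R w) - h (x + s *\<^sub>R v + 0 *\<^sub>R w)) (at s)"
      if "0 \<le> s" "s \<le> t" for s
      unfolding \<phi>_def using that t by (intro DERIV_diff der) auto
    from MVT2[OF t(1) this]
    obtain z where z: "0 < z" "z < t"
      and eq: "\<phi> t - \<phi> 0 = t * (h (x + z *\<^sub>R v + t *\<^sub>R w) - h (x + z *\<^sub>R v + 0 *\<^sub>R w))" by auto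
    define E1 where "E1 = h (x + z *\<^sub>R v + t *\<^sub>R w) - h x - partial (z *\<^sub>R v + t *\<^sub>R w) h x"
    define E2 where "E2 = h (x + z *\<^sub>R v + 0 *\<^sub>R w) - h x - partial (z *\<^sub>R v + 0 *\<^sub>R w) h x"
    have s1: "norm (z *\<^sub>R v + t *\<^sub>R w) < d1" "norm (z *\<^sub>R v + t *\<^sub>R w) \<le> t * (norm v + norm w)"
      using small[of z t] z by auto
    have s2: "norm (z *\<^sub>R v + 0 *\<^sub>R w) < d1" "norm (z *\<^sub>R v + 0 *\<^sub>R w) \<le> t * norm v"
      using small[of z 0] z by (auto intro: mult_right_mono)
    have "\<bar>E1\<bar> \<le> e / (2 * M) * norm (z *\<^sub>R v + t *\<^sub>R w)"
      using hd[of "x + z *\<^sub>R v + t *\<^sub>R w"] s1(1) by (simp add: E1_def algebra_simps)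
    also have "\<dots> \<le> e / (2 * M) * (t * (norm v + norm w))" using s1 eM by (intro mult_left_mono) auto
    finally have E1: "\<bar>E1\<bar> \<le> e / (2 * M) * (t * (norm v + norm w))" .
    have "\<bar>E2\<bar> \<le> e / (2 * M) * norm (z *\<^sub>R v + 0 *\<^sub>R w)"
      using hd[of "x + z *\<^sub>R v + 0 *\<^sub>R w"] s2(1) by (simp add: E2_def)
    also have "\<dots> \<le> e / (2 * M) * (t * norm v)" using s2 eM by (intro mult_left_mono) auto
    finally have E2: "\<bar>E2\<bar> \<le> e / (2 * M) * (t * norm v)" .
    have hdiff: "h (x + z *\<^sub>R v + t *\<^sub>R w) - h (x + z *\<^sub>R v + 0 *\<^sub>R w) = t * partial w h x + E1 - E2"
      using linear_add[OF lin, of "z *\<^sub>R v" "t *\<^sub>R w"] linear_cmul[OF lin, of t w]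
      by (simp add: E1_def E2_def)
    have "\<phi> t - \<phi> 0 = t\<^sup>2 * partial w h x + t * (E1 - E2)"
      unfolding eq hdiff by (simp add: power2_eq_square algebra_simps)
    moreover have "\<phi> t - \<phi> 0 = f (x + t *\<^sub>R v + t *\<^sub>R w) - f (x + t *\<^sub>R v) - f (x + t *\<^sub>R w) + f x"
      by (simp add: \<phi>_def)
    ultimately have "(f (x + t *\<^sub>R v + t *\<^sub>R w) - f (x + t *\<^sub>R v) - f (x + t *\<^sub>R w) + f x) / t\<^sup>2
        - partial w h x = (E1 - E2) / t"
      using t by (simp add: divide_simps) (simp add: power2_eq_square ring_distribs)
    moreover have "\<bar>(E1 - E2) / t\<bar> < e"
    proof -
      have "\<bar>E1 - E2\<bar> \<le> e / (2 * M) * (t * (norm v + norm w)) + e / (2 * M) * (t * norm v)"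
        using E1 E2 abs_triangle_ineq4[of E1 E2] by linarith
      also have "\<dots> = e / (2 * M) * (t * (2 * norm v + norm w))"
        by (simp only: distrib_left[symmetric]) simp
      also have "\<dots> \<le> e / (2 * M) * (t * M)" using eM t by (intro mult_left_mono) (auto simp: M_def)
      also have "\<dots> = e * t / 2" using M by simp
      also have "\<dots> < e * t" using e t by simp
      finally show ?thesis using t by (simp add: abs_div pos_divide_less_eq)
    qed
    ultimately show ?thesis by (simp add: dist_real_def h_def)
  qed
  then show "\<forall>\<^sub>F t in at_right 0. dist ((f (x + t *\<^sub>R v + t *\<^sub>R w) - f (x + t *\<^sub>R v) - f (x + t *\<^sub>R w) + f x) / t\<^sup>2)
      (partial w (partial v f) x) < e"
    unfolding eventually_at_right_field using d by blast
qed

text \<open>The second difference quotient is symmetric in v and w, so both mixed derivatives are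
  its limit.\<close>

lemma partial_commute:
  assumes "open S" "x \<in> S" "diff_upto 2 S f"
  shows "partial v (partial w f) x = partial w (partial v f) x"
proof (rule tendsto_unique)
  let ?F = "\<lambda>t. (f (x + t *\<^sub>R v + t *\<^sub>R w) - f (x + t *\<^sub>R v) - f (x + t *\<^sub>R w) + f x) / t\<^sup>2"
  show "(?F \<longlongrightarrow> partial w (partial v f) x) (at_right 0)"
    by (rule second_difference_limit[OF assms])
  show "(?F \<longlongrightarrow> partial v (partial w f) x) (at_right 0)"
    using second_difference_limit[OF assms, of w v] by (simp add: algebra_simps)
qed simp

lemma interior_max_partial:
  assumes "open S" "x \<in> S" "f differentiable (at x)" "\<And>y. y \<in> S \<Longrightarrow> f y \<le> f x"
  shows "partial v f x = 0"
proof -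
  have "(\<lambda>v. partial v f x) = (\<lambda>v. 0)"
    by (rule differential_zero_maxmin[OF assms(2,1) partial_has_derivative]) (use assms in auto)
  then show ?thesis by meson
qed

text \<open>The first derivative vanishes at x. If the second were positive, the first would be
  positive just after x along v, and f would exceed its maximum there.\<close>

lemma interior_max_second_partial:
  assumes "open S" "x \<in> S" "diff_upto 2 S f" "\<And>y. y \<in> S \<Longrightarrow> f y \<le> f x"
  shows "partial v (partial v f) x \<le> 0"
proof (rule ccontr)
  assume "\<not> ?thesis"
  then have pos: "partial v (partial v f) x > 0" by simp
  have f: "f differentiable (at y)" if "y \<in> S" for y
    using assms(3) that by (auto simp: eval_nat_numeral)
  have h: "partial v f differentiable (at x)"
    using assms(2,3) by (auto simp: eval_nat_numeral)
  have "((\<lambda>s. partial v f (x + s *\<^sub>R v)) has_real_derivative partial v (partial v f) x) (at 0)"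
    using partial_along_line[of "partial v f" x 0 v] h by simp
  from DERIV_pos_inc_right[OF this pos] obtain d where d: "d > 0"
    "\<And>s. 0 < s \<Longrightarrow> s < d \<Longrightarrow> 0 < partial v f (x + s *\<^sub>R v)"
    using interior_max_partial[OF assms(1,2) f[OF assms(2)] assms(4)] by auto
  have "open ((\<lambda>s. x + s *\<^sub>R v) -` S)"
    by (intro open_vimage assms(1) continuous_intros)
  moreover have "0 \<in> (\<lambda>s. x + s *\<^sub>R v) -` S" using assms(2) by simp
  ultimately obtain d' where d': "d' > 0" "\<And>s. \<bar>s\<bar> < d' \<Longrightarrow> x + s *\<^sub>R v \<in> S"
    unfolding open_dist dist_real_def
    by (metis (mono_tags, lifting) diff_zero vimage_eq)
  define t where "t = min d d' / 2"
  have t: "0 < t" "t < d" "t < d'" using d d' by (auto simp: t_def)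
  have "((\<lambda>s. f (x + s *\<^sub>R v)) has_real_derivative partial v f (x + s *\<^sub>R v)) (at s)"
    if "0 \<le> s" "s \<le> t" for s
    using d'(2)[of s] that t by (intro partial_along_line f) auto
  from MVT2[OF t(1) this] obtain z where z: "0 < z" "z < t"
    "f (x + t *\<^sub>R v) - f x = t * partial v f (x + z *\<^sub>R v)" by auto
  have "t * partial v f (x + z *\<^sub>R v) > 0" using d(2)[of z] z t by simp
  moreover have "f (x + t *\<^sub>R v) \<le> f x" using assms(4) d'(2)[of t] t by simp
  ultimately show False using z by simp
qed


section \<open>Eigenvalues and frames of a spacelike graph\<close>

text \<open>A maximizer v of the quadratic form x . f x on the unit sphere of S is an eigenvector:
  the first variation in directions of S orthogonal to v vanishes.\<close>

lemma selfadjoint_eigenvector: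
  fixes f :: "'a::euclidean_space \<Rightarrow> 'a"
  assumes lin: "linear f" and sym: "\<And>x y. f x \<bullet> y = x \<bullet> f y"
    and S: "subspace S" "f ` S \<subseteq> S" "S \<noteq> {0}"
  obtains v c where "v \<in> S" "norm v = 1" "f v = c *\<^sub>R v"
proof -
  let ?K = "sphere 0 1 \<inter> S"
  obtain w where w: "w \<in> S" "w \<noteq> 0" using S(1,3) subspace_0 by blast
  then have "(1 / norm w) *\<^sub>R w \<in> ?K" using S(1) by (simp add: subspace_scale)
  then have ne: "?K \<noteq> {}" by blast
  have "compact ?K" by (intro compact_Int_closed compact_sphere closed_subspace S)
  moreover have "continuous_on ?K (\<lambda>x. x \<bullet> f x)"
    by (intro continuous_intros linear_continuous_on lin[unfolded linear_conv_bounded_linear])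
  ultimately obtain v where v: "v \<in> ?K" and max: "\<And>y. y \<in> ?K \<Longrightarrow> y \<bullet> f y \<le> v \<bullet> f v"
    using continuous_attains_sup[OF _ ne] by blast
  define c where "c = v \<bullet> f v"
  have nv: "v \<bullet> v = 1" using v by (simp add: norm_eq_1)
  have quad: "y \<bullet> f y \<le> c * (y \<bullet> y)" if "y \<in> S" for y
  proof (cases "y = 0")
    case False
    then have "(1 / norm y) *\<^sub>R y \<in> ?K" using that S(1) by (simp add: subspace_scale)
    from max[OF this] have "(y \<bullet> f y) / (norm y)\<^sup>2 \<le> c"
      using linear_cmul[OF lin] by (simp add: c_def power2_eq_square)
    then show ?thesis using False by (simp add: divide_le_eq power2_norm_eq_inner)
  qed (simp add: linear_0[OF lin])
  have orth: "v \<bullet> f w = 0" if w: "w \<in> S" "v \<bullet> w = 0" for w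
  proof (rule ccontr)
    assume a: "v \<bullet> f w \<noteq> 0"
    \<comment> \<open>b exceeds the coefficient of t^2 in the variation. With t = (v . f w) / b the
      linear term is twice the bound for the quadratic one, which is impossible at a maximum unless
      v . f w = 0.\<close>
    define b where "b = \<bar>c * (w \<bullet> w) - w \<bullet> f w\<bar> + 1"
    define t where "t = (v \<bullet> f w) / b"
    have b: "b > 0" by (simp add: b_def)
    have "v + t *\<^sub>R w \<in> S" using v w S(1) by (simp add: subspace_add subspace_scale)
    from quad[OF this] have "c + 2 * t * (v \<bullet> f w) + t\<^sup>2 * (w \<bullet> f w) \<le> c * (1 + t\<^sup>2 * (w \<bullet> w))"
      using w(2) nv sym[of w v]
      by (simp add: linear_add[OF lin] linear_cmul[OF lin] inner_add inner_commute[of w v]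
          inner_commute[of "f w" v] c_def[symmetric] power2_eq_square algebra_simps)
    then have "2 * t * (v \<bullet> f w) \<le> t\<^sup>2 * (c * (w \<bullet> w) - w \<bullet> f w)" by (simp add: algebra_simps)
    also have "\<dots> \<le> t\<^sup>2 * b" by (intro mult_left_mono) (auto simp: b_def)
    also have "\<dots> = t * (v \<bullet> f w)" using b by (simp add: t_def power2_eq_square)
    finally have "(v \<bullet> f w)\<^sup>2 / b \<le> 0" by (simp add: t_def power2_eq_square)
    then show False using a b by (simp add: divide_le_0_iff)
  qed
  \<comment> \<open>z is the component of f v orthogonal to v, and |z|^2 = f v . z = v . f z =
    0.\<close>
  define z where "z = f v - c *\<^sub>R v"
  have z: "z \<in> S" using v S unfolding z_def by (auto intro!: subspace_diff subspace_scale)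
  have vz: "v \<bullet> z = 0" by (simp add: z_def inner_diff c_def nv)
  have "z \<bullet> z = (f v - c *\<^sub>R v) \<bullet> z" by (simp add: z_def)
  also have "\<dots> = f v \<bullet> z - c * (v \<bullet> z)" by (simp add: inner_diff_left)
  also have "\<dots> = 0" using orth[OF z vz] vz sym[of v z] by simp
  finally have "f v = c *\<^sub>R v" by (simp add: z_def)
  then show ?thesis using that v by auto
qed

text \<open>Induction on the dimension: the orthogonal complement in S of an eigenvector is again
  invariant, by self-adjointness.\<close>

lemma selfadjoint_orthonormal_eigenbasis:
  fixes f :: "'a::euclidean_space \<Rightarrow> 'a"
  assumes lin: "linear f" and sym: "\<And>x y. f x \<bullet> y = x \<bullet> f y"
  shows "subspace S \<Longrightarrow> f ` S \<subseteq> S \<Longrightarrow>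
    \<exists>B. pairwise orthogonal B \<and> (\<forall>v\<in>B. norm v = 1 \<and> (\<exists>c. f v = c *\<^sub>R v)) \<and> B \<subseteq> S \<and> S \<subseteq> span B"
proof (induction "dim S" arbitrary: S rule: less_induct)
  case less
  show ?case
  proof (cases "S = {0}")
    case True
    then show ?thesis by (intro exI[of _ "{}"]) auto
  next
    case False
    from selfadjoint_eigenvector[OF lin sym less.prems False]
    obtain v c where v: "v \<in> S" "norm v = 1" "f v = c *\<^sub>R v" by metis
    define T where "T = {x \<in> S. v \<bullet> x = 0}"
    have T: "subspace T" using less.prems(1) unfolding T_def subspace_def
      by (auto simp: inner_add inner_scaleR)
    have fT: "f ` T \<subseteq> T"
    proof
      fix y assume "y \<in> f ` T"
      then obtain x where x: "x \<in> S" "v \<bullet> x = 0" "y = f x" by (auto simp: T_def)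
      have "v \<bullet> f x = 0" using sym[of v x] v(3) x(2) by simp
      then show "y \<in> T" using x less.prems(2) by (auto simp: T_def)
    qed
    have "v \<notin> T" using v by (auto simp: T_def norm_eq_1)
    then have "T \<subset> S" using v(1) unfolding T_def by blast
    then have "dim T < dim S"
      using T less.prems(1) by (intro dim_psubset) (simp add: span_eq_iff[THEN iffD2])
    from less.hyps[OF this T fT] obtain B where B: "pairwise orthogonal B"
      "\<forall>v\<in>B. norm v = 1 \<and> (\<exists>c. f v = c *\<^sub>R v)" "B \<subseteq> T" "T \<subseteq> span B" by blast
    have "x \<in> span (insert v B)" if x: "x \<in> S" for x
    proof -
      have "x - (v \<bullet> x) *\<^sub>R v \<in> T"
        using x v less.prems(1) by (auto simp: T_def inner_diff norm_eq_1 intro!: subspace_diff subspace_scale)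
      then show ?thesis using B(4) by (auto simp: span_insert)
    qed
    moreover have "pairwise orthogonal (insert v B)"
      using B(1,3) by (auto simp: pairwise_insert orthogonal_def T_def inner_commute)
    ultimately show ?thesis using B v T_def by (intro exI[of _ "insert v B"]) auto
  qed
qed

lemma selfadjoint_eigenframe:
  fixes f :: "real^'n \<Rightarrow> real^'n"
  assumes lin: "linear f" and sym: "\<And>x y. f x \<bullet> y = x \<bullet> f y"
  obtains q :: "'n \<Rightarrow> real^'n" and \<kappa> where "\<And>i j. q i \<bullet> q j = (if i = j then 1 else 0)"
    "\<And>i. f (q i) = \<kappa> i *\<^sub>R q i" "\<And>x y. x \<bullet> y = (\<Sum>i\<in>UNIV. (q i \<bullet> x) * (q i \<bullet> y))"
proof -
  obtain B where B: "pairwise orthogonal B" "\<And>v. v \<in> B \<Longrightarrow> norm v = 1"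
    "\<forall>v\<in>B. \<exists>c. f v = c *\<^sub>R v" "UNIV \<subseteq> span B"
    using selfadjoint_orthonormal_eigenbasis[OF lin sym, of UNIV] by auto
  have "0 \<notin> B" using B(2) by force
  then have ind: "independent B" using pairwise_orthogonal_independent[OF B(1)] by simp
  then have fin: "finite B" using independent_imp_finite by blast
  have "card B = CARD('n)"
    using dim_eq_card[of B UNIV] B(4) ind by (simp add: top.extremum_unique)
  then obtain q where q: "bij_betw q (UNIV :: 'n set) B"
    using finite_same_card_bij[OF _ fin, of "UNIV :: 'n set"] by auto
  have qB: "q i \<in> B" for i using q by (auto simp: bij_betw_def)
  have inj: "q i = q j \<longleftrightarrow> i = j" for i j using q by (auto simp: bij_betw_def inj_eq)
  have on: "q i \<bullet> q j = (if i = j then 1 else 0)" for i j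
    using B(1) B(2)[OF qB] qB inj by (auto simp: pairwise_def orthogonal_def norm_eq_1)
  have "\<forall>i. \<exists>c. f (q i) = c *\<^sub>R q i" using B(3) qB by blast
  from choice[OF this] obtain \<kappa> where \<kappa>: "\<And>i. f (q i) = \<kappa> i *\<^sub>R q i" by blast
  have rep: "x = (\<Sum>i\<in>UNIV. (q i \<bullet> x) *\<^sub>R q i)" for x
  proof -
    define z where "z = x - (\<Sum>i\<in>UNIV. (q i \<bullet> x) *\<^sub>R q i)"
    have "b \<bullet> z = 0" if bB: "b \<in> B" for b
    proof -
      obtain j where j: "b = q j" using bB bij_betw_imp_surj_on[OF q] by auto
      show ?thesis
        by (simp add: z_def j inner_diff inner_sum_right on if_distrib cong: if_cong)
    qed
    \<comment> \<open>z is orthogonal to B, whose span is the whole space, hence to itself.\<close>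
    then have "orthogonal z z" using B(4)
      by (intro orthogonal_to_span[of z B]) (auto simp: orthogonal_def inner_commute)
    then show ?thesis by (simp add: z_def orthogonal_def)
  qed
  have "x \<bullet> y = (\<Sum>i\<in>UNIV. (q i \<bullet> x) * (q i \<bullet> y))" for x y
    by (subst rep[of x]) (simp add: inner_sum_left)
  then show ?thesis using that on \<kappa> by blast
qed

section \<open>Eigenvalues read off from a frame that need not be orthonormal\<close>

lemma poly_charpoly: "poly (charpoly A) x = det (x *\<^sub>R mat 1 - A)"
  unfolding charpoly_def det_def
  by (auto simp: poly_sum poly_prod mat_def intro!: sum.cong prod.cong)

text \<open>With the eigenvectors as columns of E one has E D = (x I - A) E for the diagonal matrix
  D of the x - \<kappa>_k. Taking determinants gives the characteristic polynomial, since the dual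
  vectors d make E invertible. Only the multiset of eigenvalues is asserted because
  \<open>eigvals\<close> fixes no order.\<close>

lemma eigvals_eq_of_frame:
  fixes A :: "real^'n^'n" and e :: "'n \<Rightarrow> real^'n"
  assumes "\<And>k. A *v e k = \<kappa> k *\<^sub>R e k" and dual: "\<And>i j. d i \<bullet> e j = (if i = j then 1 else 0)"
  shows "image_mset (\<lambda>i. eigvals A $ i) (mset_set UNIV) = image_mset \<kappa> (mset_set UNIV)"
proof -
  define E :: "real^'n^'n" where "E = (\<chi> i k. e k $ i)"
  have "poly (charpoly A) x = poly (\<Prod>k\<in>UNIV. [:- \<kappa> k, 1:]) x" for x
  proof -
    define D :: "real^'n^'n" where "D = (\<chi> i j. if i = j then x - \<kappa> i else 0)"
    have "E ** D = (x *\<^sub>R mat 1 - A) ** E"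
    proof -
      have "(\<Sum>m\<in>UNIV. A $ i $ m * e j $ m) = \<kappa> j * e j $ i" for i j
        using arg_cong[OF assms(1)[of j], of "\<lambda>v. v $ i"] by (simp add: matrix_vector_mult_def)
      then show ?thesis
        by (simp add: vec_eq_iff matrix_matrix_mult_def E_def D_def mat_def left_diff_distrib
            sum_subtractf if_distrib[where f="\<lambda>x. _ * x"] if_distrib[where f="\<lambda>x. x * _"] algebra_simps
            cong: if_cong)
    qed
    from arg_cong[OF this, of det]
    have "det E * det D = det (x *\<^sub>R mat 1 - A) * det E" by (simp add: det_mul)
    moreover have "det E \<noteq> 0"
    proof
      assume "det E = 0"
      then obtain c where c: "c \<noteq> 0" "E *v c = 0"
        using invertible_det_nz[of E] invertible_left_inverse[of E] matrix_left_invertible_ker[of E] by auto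
      have z: "(\<Sum>k\<in>UNIV. c $ k *\<^sub>R e k) = 0"
        using c(2) by (simp add: vec_eq_iff matrix_vector_mult_def E_def mult.commute)
      have "c $ i = 0" for i
        using arg_cong[OF z, of "\<lambda>v. d i \<bullet> v"]
        by (simp add: inner_sum_right dual if_distrib[where f="\<lambda>u. _ * u"] cong: if_cong)
      then have "c = 0" by (simp add: vec_eq_iff)
      then show False using c by simp
    qed
    moreover have "det D = (\<Prod>k\<in>UNIV. x - \<kappa> k)"
      by (subst det_diagonal) (auto simp: D_def)
    ultimately show ?thesis by (simp add: poly_charpoly poly_prod)
  qed
  then have "charpoly A = (\<Prod>k\<in>UNIV. [:- \<kappa> k, 1:])" by (simp add: poly_eq_poly_eq_iff[symmetric] fun_eq_iff)
  then have "proots (charpoly A) = (\<Sum>k\<in>UNIV. {#\<kappa> k#})" by (simp add: proots_prod)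
  also have "\<dots> = image_mset \<kappa> (mset_set UNIV)"
    by (simp add: sum_unfold_sum_mset image_mset.compositionality comp_def)
  \<comment> \<open>The vector with entries \<kappa>_i witnesses that the choice in the definition
    of \<open>eigvals\<close> is not vacuous.\<close>
  finally have "image_mset (\<lambda>i. (\<chi> i. \<kappa> i) $ i) (mset_set UNIV) = proots (charpoly A)" by simp
  then have "image_mset (\<lambda>i. eigvals A $ i) (mset_set UNIV) = proots (charpoly A)"
    unfolding eigvals_def by (rule someI)
  then show ?thesis using \<open>proots (charpoly A) = _\<close> \<open>_ = image_mset \<kappa> (mset_set UNIV)\<close> by simp
qed

lemma sigma_1: "sigma 1 \<kappa> = (\<Sum>i\<in>UNIV. \<kappa> $ i)"
proof -
  have "{I :: 'a set. card I = 1} = (\<lambda>i. {i}) ` UNIV" by (auto simp: card_1_singleton_iff)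
  then show ?thesis unfolding sigma_def by (simp add: sum.reindex inj_on_def)
qed

text \<open>Newton's identity. It is proved for all finite index sets S, so that induction applies:
  the pairs in \<open>insert a S\<close> are the pairs in S and the pairs {a, b} with b in
  S.\<close>

lemma sigma_2: "2 * sigma 2 \<kappa> = (\<Sum>i\<in>UNIV. \<kappa> $ i)\<^sup>2 - (\<Sum>i\<in>UNIV. (\<kappa> $ i)\<^sup>2)"
proof -
  have "2 * (\<Sum>I | I \<subseteq> S \<and> card I = 2. \<Prod>i\<in>I. f i) = (\<Sum>i\<in>S. f i)\<^sup>2 - (\<Sum>i\<in>S. (f i)\<^sup>2)"
    if "finite S" for S :: "'a set" and f :: "'a \<Rightarrow> real"
    using that
  proof (induction S)
    case empty
    have "{I :: 'a set. I = {} \<and> card I = 2} = {}" by auto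
    then show ?case by simp
  next
    case (insert a S)
    have "{I. I \<subseteq> insert a S \<and> card I = 2} = {I. I \<subseteq> S \<and> card I = 2} \<union> (\<lambda>b. {a, b}) ` S"
    proof (intro set_eqI iffI)
      fix I assume I: "I \<in> {I. I \<subseteq> insert a S \<and> card I = 2}"
      show "I \<in> {I. I \<subseteq> S \<and> card I = 2} \<union> (\<lambda>b. {a, b}) ` S"
      proof (cases "a \<in> I")
        case True
        then have "card (I - {a}) = 1" using I by simp
        then obtain b where b: "I - {a} = {b}" by (auto simp: card_1_singleton_iff)
        then have "I = {a, b}" "b \<in> S" using I True by auto
        then show ?thesis by blast
      qed (use I in auto)
    next
      fix I assume "I \<in> {I. I \<subseteq> S \<and> card I = 2} \<union> (\<lambda>b. {a, b}) ` S"
      then show "I \<in> {I. I \<subseteq> insert a S \<and> card I = 2}"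
      proof
        assume "I \<in> (\<lambda>b. {a, b}) ` S"
        then obtain b where "I = {a, b}" "b \<in> S" by blast
        moreover from this have "a \<noteq> b" using insert.hyps by blast
        ultimately show ?thesis by simp
      qed blast
    qed
    moreover have "{I. I \<subseteq> S \<and> card I = 2} \<inter> (\<lambda>b. {a, b}) ` S = {}" using insert.hyps by auto
    moreover have "(\<Sum>I\<in>(\<lambda>b. {a, b}) ` S. \<Prod>i\<in>I. f i) = f a * (\<Sum>b\<in>S. f b)"
    proof -
      have "inj_on (\<lambda>b. {a, b}) S" by (auto simp: inj_on_def doubleton_eq_iff)
      moreover have "(\<Prod>i\<in>{a, b}. f i) = f a * f b" if "b \<in> S" for b
        using that insert.hyps by (subst prod.insert) auto
      ultimately show ?thesis by (simp add: sum.reindex sum_distrib_left)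
    qed
    ultimately have "(\<Sum>I | I \<subseteq> insert a S \<and> card I = 2. \<Prod>i\<in>I. f i)
        = (\<Sum>I | I \<subseteq> S \<and> card I = 2. \<Prod>i\<in>I. f i) + f a * (\<Sum>b\<in>S. f b)"
      using insert.hyps by (simp add: sum.union_disjoint)
    then show ?case using insert by (simp add: power2_eq_square algebra_simps)
  qed
  from this[of UNIV "\<lambda>i. \<kappa> $ i"] show ?thesis by (simp add: sigma_def)
qed

lemma sum_eq_of_image_mset_eq:
  fixes f :: "'b \<Rightarrow> 'c::comm_monoid_add"
  assumes "image_mset \<kappa> (mset_set A) = image_mset \<mu> (mset_set B)"
  shows "(\<Sum>i\<in>A. f (\<kappa> i)) = (\<Sum>i\<in>B. f (\<mu> i))"
  using arg_cong[OF assms, of "\<lambda>M. sum_mset (image_mset f M)"]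
  by (simp add: sum_unfold_sum_mset image_mset.compositionality comp_def)

text \<open>The curvature matrix as a function of the values p of the gradient and U of the Hessian
  alone, so that it serves both at interior points and for the continuous extensions at the
  boundary. In this form it is visibly the Jacobian v (I + \<nu>\<nu>^T) U of \<nu> = v p.\<close>

definition graph_shape :: "real^'n \<Rightarrow> real^'n^'n \<Rightarrow> real^'n^'n"
  where "graph_shape p U =
    (let v = inverse (sqrt (1 - (norm p)\<^sup>2)); \<nu> = v *\<^sub>R p in v *\<^sub>R ((mat 1 + outer \<nu> \<nu>) ** U))"

lemma matrix_outer_mult_vec: "outer a b *v x = (b \<bullet> x) *\<^sub>R a"
  by (simp add: vec_eq_iff matrix_vector_mult_def outer_def inner_vec_def sum_distrib_right sum_distrib_left mult_ac)

lemma graph_shape_mult_vec: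
  "graph_shape p U *v x = (let v = inverse (sqrt (1 - (norm p)\<^sup>2)); \<nu> = v *\<^sub>R p
    in v *\<^sub>R (U *v x + (\<nu> \<bullet> (U *v x)) *\<^sub>R \<nu>))"
  by (simp add: graph_shape_def Let_def scaleR_matrix_vector_assoc[symmetric] matrix_vector_mul_assoc[symmetric]
      matrix_vector_mult_add_rdistrib matrix_outer_mult_vec)

text \<open>The frame solves the generalized eigenvalue problem v U e = \<kappa> g e for the induced
  metric g = I - p p^T. In order, the conclusions say that the sum of the e_k e_k^T is the inverse
  metric I + \<nu>\<nu>^T, that the e_k are eigenvectors of the shape operator, that they are
  g-orthonormal, and the eigenvalue problem itself.\<close>

lemma graph_frame:
  fixes p :: "real^'n" and U :: "real^'n^'n"
  assumes p: "norm p < 1" and U: "transpose U = U"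
  defines "v \<equiv> inverse (sqrt (1 - (norm p)\<^sup>2))"
  defines "\<nu> \<equiv> v *\<^sub>R p"
  obtains e :: "'n \<Rightarrow> real^'n" and \<kappa> :: "'n \<Rightarrow> real" where
    "\<And>x y. (\<Sum>k\<in>UNIV. (e k \<bullet> x) * (e k \<bullet> y)) = x \<bullet> y + (\<nu> \<bullet> x) * (\<nu> \<bullet> y)"
    "\<And>k. graph_shape p U *v e k = \<kappa> k *\<^sub>R e k"
    "\<And>i j. e i \<bullet> e j - (p \<bullet> e i) * (p \<bullet> e j) = (if i = j then 1 else 0)"
    "\<And>k. U *v e k = (\<kappa> k / v) *\<^sub>R (e k - (p \<bullet> e k) *\<^sub>R p)"
proof -
  have np: "(norm p)\<^sup>2 < 1" using p by (simp add: abs_square_less_1)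
  have v0: "0 < v" using np by (simp add: v_def)
  have v2: "v\<^sup>2 * (1 - p \<bullet> p) = 1"
    using np by (simp add: v_def power_inverse power2_norm_eq_inner[symmetric])
  have nn: "\<nu> \<bullet> \<nu> = v\<^sup>2 - 1" using v2 by (simp add: \<nu>_def power2_eq_square algebra_simps)
  \<comment> \<open>E is the positive square root of the inverse metric I + \<nu> \<nu>^T. The frame is the image under E of an
    orthonormal eigenbasis of v E U E.\<close>
  define c where "c = 1 / (1 + v)"
  define E where "E x = x + (c * (\<nu> \<bullet> x)) *\<^sub>R \<nu>" for x
  have c2: "2 * c + c\<^sup>2 * (v\<^sup>2 - 1) = 1"
    using v0 by (simp add: c_def divide_simps) (simp add: power2_eq_square algebra_simps)
  have c3: "c * (v\<^sup>2 - 1) = v - 1" using v0 by (simp add: c_def divide_simps) (simp add: power2_eq_square algebra_simps)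
  have nE: "\<nu> \<bullet> E x = v * (\<nu> \<bullet> x)" for x
  proof -
    have "\<nu> \<bullet> E x = (\<nu> \<bullet> x) * (1 + c * (v\<^sup>2 - 1))" by (simp add: E_def inner_add_right nn algebra_simps)
    then show ?thesis by (simp add: c3)
  qed
  have EE: "E (E x) = x + (\<nu> \<bullet> x) *\<^sub>R \<nu>" for x
  proof -
    have "E (E x) = x + ((c + c * v) * (\<nu> \<bullet> x)) *\<^sub>R \<nu>"
      unfolding E_def[of "E x"] nE by (simp add: E_def algebra_simps)
    moreover have "c + c * v = 1" using v0 by (simp add: c_def divide_simps)
    ultimately show ?thesis by simp
  qed
  have linE: "linear E" unfolding E_def by (auto intro!: linearI simp: inner_add_right algebra_simps)
  have symE: "E x \<bullet> y = x \<bullet> E y" for x y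
    by (simp add: E_def inner_add_left inner_add_right inner_commute)
  have symU: "(U *v x) \<bullet> y = x \<bullet> (U *v y)" for x y
    using dot_lmul_matrix[of x U y] U by (metis inner_commute transpose_matrix_vector)
  define f where "f x = v *\<^sub>R E (U *v E x)" for x
  have linf: "linear f"
    by (intro linearI) (simp_all add: f_def linear_add[OF linE] linear_cmul[OF linE]
        matrix_vector_right_distrib matrix_vector_mult_scaleR scaleR_add_right)
  have symf: "f x \<bullet> y = x \<bullet> f y" for x y by (simp add: f_def symE symU)
  obtain q :: "'n \<Rightarrow> real^'n" and \<kappa> where q: "\<And>i j. q i \<bullet> q j = (if i = j then 1 else 0)"
    "\<And>i. f (q i) = \<kappa> i *\<^sub>R q i" "\<And>x y. x \<bullet> y = (\<Sum>i\<in>UNIV. (q i \<bullet> x) * (q i \<bullet> y))"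
    using selfadjoint_eigenframe[OF linf symf] by blast
  define e where "e k = E (q k)" for k
  \<comment> \<open>The map x - (p . x) p is the metric g, here expressed by \<nu>.
    \<open>GEE\<close> says that g inverts E^2; \<open>EGE\<close> says E g E = I, which makes the
    image of an orthonormal basis under E orthonormal for g.\<close>
  have G: "x - (p \<bullet> x) *\<^sub>R p = x - ((\<nu> \<bullet> x) / v\<^sup>2) *\<^sub>R \<nu>" for x
    using v0 by (simp add: \<nu>_def power2_eq_square)
  have GEE: "E (E x) - (p \<bullet> E (E x)) *\<^sub>R p = x" for x
  proof -
    have "\<nu> \<bullet> E (E x) = v\<^sup>2 * (\<nu> \<bullet> x)" by (simp add: nE power2_eq_square)
    then show ?thesis unfolding G using v0 by (simp add: EE)
  qed
  have Ev: "E \<nu> = v *\<^sub>R \<nu>"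
  proof -
    have "E \<nu> = (1 + c * (v\<^sup>2 - 1)) *\<^sub>R \<nu>" by (simp add: E_def nn scaleR_add_left)
    then show ?thesis by (simp add: c3)
  qed
  have EGE: "E (E x - (p \<bullet> E x) *\<^sub>R p) = x" for x
    unfolding G[of "E x"] nE linear_diff[OF linE] linear_cmul[OF linE] Ev EE
    using v0 by (simp add: power2_eq_square)
  have shape: "graph_shape p U *v x = v *\<^sub>R E (E (U *v x))" for x
    unfolding graph_shape_mult_vec Let_def v_def[symmetric] \<nu>_def[symmetric] EE ..
  show ?thesis
  proof (rule that[of e \<kappa>])
    show "(\<Sum>k\<in>UNIV. (e k \<bullet> x) * (e k \<bullet> y)) = x \<bullet> y + (\<nu> \<bullet> x) * (\<nu> \<bullet> y)" for x y
    proof -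
      have "(\<Sum>k\<in>UNIV. (e k \<bullet> x) * (e k \<bullet> y)) = E x \<bullet> E y" using q(3)[of "E x" "E y"] by (simp add: e_def symE)
      also have "\<dots> = x \<bullet> E (E y)" by (rule symE)
      finally show ?thesis by (simp add: EE inner_add_right inner_commute)
    qed
    show ek: "graph_shape p U *v e k = \<kappa> k *\<^sub>R e k" for k
    proof -
      have "graph_shape p U *v e k = E (f (q k))"
        by (simp add: shape f_def e_def linear_cmul[OF linE])
      then show ?thesis by (simp add: q(2) linear_cmul[OF linE] e_def)
    qed
    show "e i \<bullet> e j - (p \<bullet> e i) * (p \<bullet> e j) = (if i = j then 1 else 0)" for i j
    proof -
      have "e i \<bullet> e j - (p \<bullet> e i) * (p \<bullet> e j) = e i \<bullet> (e j - (p \<bullet> e j) *\<^sub>R p)"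
        by (simp add: inner_diff_right inner_commute)
      also have "\<dots> = q i \<bullet> E (E (q j) - (p \<bullet> E (q j)) *\<^sub>R p)"
        unfolding e_def symE ..
      finally show ?thesis by (simp add: EGE q(1))
    qed
    show "U *v e k = (\<kappa> k / v) *\<^sub>R (e k - (p \<bullet> e k) *\<^sub>R p)" for k
    proof -
      have "E (E (U *v e k)) = (\<kappa> k / v) *\<^sub>R e k" 
      proof -
        have "E (E (U *v e k)) = (1 / v) *\<^sub>R (graph_shape p U *v e k)" using v0 by (simp add: shape)
        then show ?thesis by (simp add: ek)
      qed
      then show ?thesis using GEE[of "U *v e k"] by (simp add: scaleR_diff_right)
    qed
  qed
qed

text \<open>The vectors d_k = g e_k form the dual basis: the sum of the e_k e_k^T is the inverse of
  g, and multiplying it by g gives the identity.\<close>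

lemma dual_frame:
  fixes p :: "real^'n"
  assumes p: "norm p < 1"
    and e: "\<And>x y. (\<Sum>k\<in>UNIV. (e k \<bullet> x) * (e k \<bullet> y)) = x \<bullet> y +
       (inverse (sqrt (1 - (norm p)\<^sup>2)) *\<^sub>R p \<bullet> x) * (inverse (sqrt (1 - (norm p)\<^sup>2)) *\<^sub>R p \<bullet> y)"
  shows "(\<Sum>k\<in>(UNIV::'k::finite set). (e k \<bullet> x) * ((e k - (p \<bullet> e k) *\<^sub>R p) \<bullet> y)) = x \<bullet> y"
proof -
  define v where "v = inverse (sqrt (1 - (norm p)\<^sup>2))"
  have np: "(norm p)\<^sup>2 < 1" using p by (simp add: abs_square_less_1)
  have v2: "v\<^sup>2 * (1 - p \<bullet> p) = 1"
    using np by (simp add: v_def power_inverse power2_norm_eq_inner[symmetric])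
  have "(\<Sum>k\<in>UNIV. (e k \<bullet> x) * ((e k - (p \<bullet> e k) *\<^sub>R p) \<bullet> y))
      = (\<Sum>k\<in>UNIV. (e k \<bullet> x) * (e k \<bullet> (y - (p \<bullet> y) *\<^sub>R p)))"
    by (intro sum.cong refl) (simp add: inner_diff_left inner_diff_right inner_commute[of p "e _"] mult_ac)
  also have "\<dots> = x \<bullet> (y - (p \<bullet> y) *\<^sub>R p) + (v *\<^sub>R p \<bullet> x) * (v *\<^sub>R p \<bullet> (y - (p \<bullet> y) *\<^sub>R p))"
    unfolding e v_def ..
  also have "\<dots> = x \<bullet> y - (p \<bullet> y) * (x \<bullet> p) + (p \<bullet> x) * (p \<bullet> y) * (v\<^sup>2 * (1 - p \<bullet> p))"
    by (simp add: inner_diff_right power2_eq_square algebra_simps)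
  finally show ?thesis by (simp add: v2 inner_commute)
qed

lemma dual_frame_trace:
  fixes M :: "real^'n^'n" and e d :: "'k::finite \<Rightarrow> real^'n"
  assumes "\<And>x y. (\<Sum>k\<in>UNIV. (e k \<bullet> x) * (d k \<bullet> y)) = x \<bullet> y"
  shows "(\<Sum>k\<in>UNIV. d k \<bullet> (M *v e k)) = trace M"
proof -
  have "(\<Sum>k\<in>UNIV. d k \<bullet> (M *v e k)) = (\<Sum>k\<in>UNIV. \<Sum>i\<in>UNIV. \<Sum>j\<in>UNIV. M $ i $ j * ((e k \<bullet> axis j 1) * (d k \<bullet> axis i 1)))"
  proof (rule sum.cong[OF refl])
    fix k
    have "d k \<bullet> (M *v e k) = (\<Sum>i\<in>UNIV. \<Sum>j\<in>UNIV. M $ i $ j * (e k $ j * d k $ i))"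
      by (simp add: inner_vec_def matrix_vector_mult_def sum_distrib_left mult_ac)
    then show "d k \<bullet> (M *v e k) = (\<Sum>i\<in>UNIV. \<Sum>j\<in>UNIV. M $ i $ j * ((e k \<bullet> axis j 1) * (d k \<bullet> axis i 1)))"
      by (simp add: inner_axis)
  qed
  also have "\<dots> = (\<Sum>i\<in>UNIV. \<Sum>j\<in>UNIV. \<Sum>k\<in>UNIV. M $ i $ j * ((e k \<bullet> axis j 1) * (d k \<bullet> axis i 1)))"
    by (subst sum.swap, rule sum.cong[OF refl], rule sum.swap)
  also have "\<dots> = (\<Sum>i\<in>UNIV. \<Sum>j\<in>UNIV. M $ i $ j * (axis j 1 \<bullet> axis i (1::real)))"
    by (simp only: sum_distrib_left[symmetric] assms)
  also have "\<dots> = trace M"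
    by (simp add: trace_def inner_axis_axis if_distrib[where f="\<lambda>u. _ * u"] cong: if_cong)
  finally show ?thesis .
qed

text \<open>The inner sum inserts the identity, written as the sum of the e_b d_b^T, between the two
  factors M.\<close>

lemma dual_frame_trace_square:
  fixes M :: "real^'n^'n" and e d :: "'k::finite \<Rightarrow> real^'n"
  assumes "\<And>x y. (\<Sum>k\<in>UNIV. (e k \<bullet> x) * (d k \<bullet> y)) = x \<bullet> y"
  shows "(\<Sum>a\<in>UNIV. \<Sum>b\<in>UNIV. (d a \<bullet> (M *v e b)) * (d b \<bullet> (M *v e a))) = trace (M ** M)"
proof -
  have "(\<Sum>b\<in>UNIV. (d a \<bullet> (M *v e b)) * (d b \<bullet> (M *v e a))) = d a \<bullet> ((M ** M) *v e a)" for a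
    using assms[of "d a v* M" "M *v e a"]
    by (simp add: dot_lmul_matrix inner_commute[of "e _" "d a v* M"] matrix_vector_mul_assoc)
  then show ?thesis by (simp add: dual_frame_trace[OF assms])
qed

text \<open>In the frame of \<open>graph_frame\<close> the matrix A is diagonal, so tr A and tr A^2
  are the power sums of the curvatures. For the last two claims: each \<kappa>_i^2 is at most tr
  A^2, and the average of the \<kappa>_i is at most their maximum.\<close>

lemma graph_shape_eigvals:
  fixes p :: "real^'n" and U :: "real^'n^'n"
  assumes p: "norm p < 1" and U: "transpose U = U"
  defines "A \<equiv> graph_shape p U"
  shows "sigma 1 (eigvals A) = trace A"
    and "2 * sigma 2 (eigvals A) = (trace A)\<^sup>2 - trace (A ** A)"
    and "0 < trace A \<Longrightarrow> 0 < sigma 2 (eigvals A) \<Longrightarrow> Max (range (\<lambda>i. eigvals A $ i)) \<le> trace A"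
    and "trace A \<le> real CARD('n) * Max (range (\<lambda>i. eigvals A $ i))"
proof -
  obtain e :: "'n \<Rightarrow> real^'n" and \<kappa> :: "'n \<Rightarrow> real" where
    e1: "\<And>x y. (\<Sum>k\<in>UNIV. (e k \<bullet> x) * (e k \<bullet> y)) = x \<bullet> y +
       (inverse (sqrt (1 - (norm p)\<^sup>2)) *\<^sub>R p \<bullet> x) * (inverse (sqrt (1 - (norm p)\<^sup>2)) *\<^sub>R p \<bullet> y)"
    and e2: "\<And>k. A *v e k = \<kappa> k *\<^sub>R e k"
    and e3: "\<And>i j. e i \<bullet> e j - (p \<bullet> e i) * (p \<bullet> e j) = (if i = j then 1 else 0)"
    by (rule graph_frame[OF p U, folded A_def]) (rule that)
  define d where "d k = e k - (p \<bullet> e k) *\<^sub>R p" for k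
  have dual: "d i \<bullet> e j = (if i = j then 1 else 0)" for i j
    using e3[of i j] by (simp add: d_def inner_diff_left)
  have dsum: "(\<Sum>k\<in>UNIV. (e k \<bullet> x) * (d k \<bullet> y)) = x \<bullet> y" for x y
    unfolding d_def by (rule dual_frame[OF p e1])
  have tr: "trace A = (\<Sum>k\<in>UNIV. \<kappa> k)"
    using dual_frame_trace[OF dsum, of A] by (simp add: e2 dual)
  have tr2: "trace (A ** A) = (\<Sum>k\<in>UNIV. (\<kappa> k)\<^sup>2)"
    using dual_frame_trace[OF dsum, of "A ** A"]
    by (simp add: matrix_vector_mul_assoc[symmetric] e2 matrix_vector_mult_scaleR dual power2_eq_square)
  note ev = eigvals_eq_of_frame[OF e2 dual]
  have sums: "(\<Sum>k\<in>UNIV. f (eigvals A $ k)) = (\<Sum>k\<in>UNIV. f (\<kappa> k))" for f :: "real \<Rightarrow> real"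
    by (rule sum_eq_of_image_mset_eq[OF ev])
  have s1: "(\<Sum>k\<in>UNIV. eigvals A $ k) = trace A" using sums[of "\<lambda>x. x"] by (simp add: tr)
  have s2: "(\<Sum>k\<in>UNIV. (eigvals A $ k)\<^sup>2) = trace (A ** A)" using sums[of "\<lambda>x. x\<^sup>2"] by (simp add: tr2)
  show "sigma 1 (eigvals A) = trace A" by (simp only: sigma_1 s1)
  show sig2: "2 * sigma 2 (eigvals A) = (trace A)\<^sup>2 - trace (A ** A)" by (simp only: sigma_2 s1 s2)
  show "trace A \<le> real CARD('n) * Max (range (\<lambda>i. eigvals A $ i))"
  proof -
    have "(\<Sum>k\<in>(UNIV::'n set). eigvals A $ k) \<le> real (card (UNIV::'n set)) * Max (range (\<lambda>i. eigvals A $ i))"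
      by (rule sum_bounded_above) (auto intro: Max_ge)
    then show ?thesis by (simp add: s1)
  qed
  show "Max (range (\<lambda>i. eigvals A $ i)) \<le> trace A" if "0 < trace A" "0 < sigma 2 (eigvals A)"
  proof -
    have "eigvals A $ i \<le> trace A" for i
    proof -
      have "(eigvals A $ i)\<^sup>2 \<le> (\<Sum>k\<in>UNIV. (eigvals A $ k)\<^sup>2)" by (rule member_le_sum) auto
      also have "\<dots> \<le> (trace A)\<^sup>2" using sig2 that(2) s2 by simp
      finally show ?thesis using that(1) by (rule power2_le_imp_le[OF _ less_imp_le])
    qed
    then show ?thesis by (subst Max_le_iff) auto
  qed
qed


section \<open>The linearized equation for the mean curvature\<close>

text \<open>
  Here N2 a b k stands for the derivative \<partial>_k \<partial>_b n^a and X i l for \<partial>_l \<partial>_l \<partial>_i n^i, at a point where the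
  frame is orthonormal and \<partial>_b n^a = \<kappa>_a \<delta>_ab. The array c is the covariant derivative of the second
  fundamental form: the term added to N2 comes from the Christoffel symbols.
\<close>

lemma curvature_sum_commutation:
  fixes N2 :: "'i::finite \<Rightarrow> 'i \<Rightarrow> 'i \<Rightarrow> real" and X :: "'i \<Rightarrow> 'i \<Rightarrow> real"
    and \<kappa> n :: "'i \<Rightarrow> real"
  assumes sym2: "\<And>a b k. N2 a b k = N2 a k b"
    and codazzi: "\<And>a c k. N2 a c k + (if a = k then \<kappa> a * \<kappa> k * n c else 0) + (if c = k then \<kappa> a * \<kappa> k * n a else 0)
       = N2 c a k + (if c = k then \<kappa> c * \<kappa> k * n a else 0) + (if a = k then \<kappa> c * \<kappa> k * n c else 0)"
    and comm: "\<And>i l. X i l = X l i - 2 * \<kappa> i * n l * N2 i i l + 2 * \<kappa> l * n i * N2 l l i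
       - \<kappa> l * (\<Sum>b\<in>UNIV. n b * N2 i i b) + \<kappa> i * (\<Sum>b\<in>UNIV. n b * N2 l l b)
       - \<kappa> i * \<kappa> l * (\<kappa> i - \<kappa> l)"
  defines "h \<equiv> \<Sum>i\<in>UNIV. \<kappa> i"
  defines "H \<equiv> \<lambda>k. \<Sum>i\<in>UNIV. N2 i i k"
  defines "p \<equiv> \<lambda>k. \<Sum>i\<in>UNIV. (h - \<kappa> i) * N2 i i k"
  defines "c \<equiv> \<lambda>a b k. N2 a b k + (if b = k then n a * \<kappa> k * (\<kappa> a - \<kappa> k) else 0)"
  shows "c a b k = c a k b" "c a b k = c b a k" "c i i k = N2 i i k"
    and "(\<Sum>i\<in>UNIV. (h - \<kappa> i) * (\<Sum>a\<in>UNIV. X a i)) =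
      (\<Sum>k\<in>UNIV. (H k)\<^sup>2 - (\<Sum>a\<in>UNIV. \<Sum>b\<in>UNIV. N2 a b k * N2 b a k) + (\<Sum>i\<in>UNIV. (h - \<kappa> i) * X i k))
      + (\<Sum>a\<in>UNIV. \<Sum>b\<in>UNIV. \<Sum>k\<in>UNIV. (c a b k)\<^sup>2) - (\<Sum>k\<in>UNIV. (H k)\<^sup>2)
      + h * (\<Sum>k\<in>UNIV. n k * p k) - (\<Sum>i\<in>UNIV. (h - \<kappa> i) * \<kappa> i) * (\<Sum>k\<in>UNIV. n k * H k)
      + h * (\<Sum>i\<in>UNIV. (h - \<kappa> i) * (\<kappa> i)\<^sup>2) - (\<Sum>i\<in>UNIV. (h - \<kappa> i) * \<kappa> i) * (\<Sum>i\<in>UNIV. (\<kappa> i)\<^sup>2)"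
proof -
  show c1: "c a b k = c a k b" for a b k using sym2[of a b k] by (auto simp: c_def)
  show c2: "c a b k = c b a k" for a b k using codazzi[of a b k] sym2
    by (auto simp: c_def algebra_simps split: if_splits)
  show c3: "c i i k = N2 i i k" for i k by (auto simp: c_def)
  \<comment> \<open>Each term of \<open>comm\<close>, weighted by h - \<kappa>_i and summed, is a
    combination of these contractions.\<close>
  define t where "t k = (\<Sum>i\<in>UNIV. \<kappa> i * N2 i i k)" for k
  define r where "r k = (\<Sum>i\<in>UNIV. (\<kappa> i)\<^sup>2 * N2 i i k)" for k
  define w where "w = (\<Sum>i\<in>UNIV. (h - \<kappa> i) * \<kappa> i)"
  define q where "q = (\<Sum>i\<in>UNIV. (h - \<kappa> i) * (\<kappa> i)\<^sup>2)"
  define s where "s = (\<Sum>i\<in>UNIV. (\<kappa> i)\<^sup>2)"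
  define np where "np = (\<Sum>k\<in>UNIV. n k * p k)"
  define nH where "nH = (\<Sum>k\<in>UNIV. n k * H k)"
  define nt where "nt = (\<Sum>k\<in>UNIV. n k * t k)"
  define nkt where "nkt = (\<Sum>k\<in>UNIV. n k * \<kappa> k * t k)"
  define nr where "nr = (\<Sum>k\<in>UNIV. n k * r k)"
  have quad: "(\<Sum>a\<in>UNIV. \<Sum>b\<in>UNIV. \<Sum>k\<in>UNIV. N2 a b k * N2 b a k) =
    (\<Sum>a\<in>UNIV. \<Sum>b\<in>UNIV. \<Sum>k\<in>UNIV. (c a b k)\<^sup>2) - 2 * (nkt - nr)"
  proof -
    have "N2 a b k * N2 b a k = (c a b k)\<^sup>2 - (if b = k then c a b k * (n a * \<kappa> k * (\<kappa> a - \<kappa> k)) else 0)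
        - (if a = k then c a b k * (n b * \<kappa> k * (\<kappa> b - \<kappa> k)) else 0)" for a b k
    proof -
      define u where "u = (if b = k then n a * \<kappa> k * (\<kappa> a - \<kappa> k) else 0)"
      define v where "v = (if a = k then n b * \<kappa> k * (\<kappa> b - \<kappa> k) else 0)"
      have "N2 a b k = c a b k - u" "N2 b a k = c a b k - v"
        using c2[of a b k] by (simp_all add: c_def u_def v_def)
      \<comment> \<open>Both factors can be nonzero only if a = b = k, and then \<kappa>_a -
        \<kappa>_k vanishes.\<close>
      moreover have "u * v = 0" by (simp add: u_def v_def)
      ultimately have "N2 a b k * N2 b a k = (c a b k)\<^sup>2 - c a b k * u - c a b k * v"
        by algebra
      then show ?thesis by (simp add: u_def v_def if_distrib cong: if_cong)
    qed
    then have "(\<Sum>a\<in>UNIV. \<Sum>b\<in>UNIV. \<Sum>k\<in>UNIV. N2 a b k * N2 b a k) =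
      (\<Sum>a\<in>UNIV. \<Sum>b\<in>UNIV. \<Sum>k\<in>UNIV. (c a b k)\<^sup>2)
      - (\<Sum>a\<in>UNIV. \<Sum>b\<in>UNIV. c a b b * (n a * \<kappa> b * (\<kappa> a - \<kappa> b)))
      - (\<Sum>a\<in>UNIV. \<Sum>b\<in>UNIV. c a b a * (n b * \<kappa> a * (\<kappa> b - \<kappa> a)))"
      by (simp add: sum_subtractf)
    also have "(\<Sum>a\<in>UNIV. \<Sum>b\<in>UNIV. c a b a * (n b * \<kappa> a * (\<kappa> b - \<kappa> a)))
      = (\<Sum>a\<in>UNIV. \<Sum>b\<in>UNIV. c a b b * (n a * \<kappa> b * (\<kappa> a - \<kappa> b)))"
      by (subst sum.swap) (simp add: c2)
    also have "(\<Sum>a\<in>UNIV. \<Sum>b\<in>UNIV. c a b b * (n a * \<kappa> b * (\<kappa> a - \<kappa> b))) = nkt - nr"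
    proof -
      have "c a b b = N2 b b a" for a b using c1[of b a b] c2[of a b b] c3[of b a] by simp
      then have "c a b b * (n a * \<kappa> b * (\<kappa> a - \<kappa> b))
          = n a * \<kappa> a * (\<kappa> b * N2 b b a) - n a * ((\<kappa> b)\<^sup>2 * N2 b b a)" for a b
        by (simp add: power2_eq_square algebra_simps)
      then show ?thesis
        by (simp add: nkt_def nr_def t_def r_def sum_subtractf sum_distrib_left)
    qed
    finally show ?thesis by simp
  qed
  have T1: "(\<Sum>i\<in>UNIV. \<Sum>l\<in>UNIV. (h - \<kappa> i) * (2 * \<kappa> i * n l * N2 i i l)) = 2 * (h * nt - nr)"
  proof -
    have "(\<Sum>i\<in>UNIV. \<Sum>l\<in>UNIV. (h - \<kappa> i) * (2 * \<kappa> i * n l * N2 i i l))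
      = (\<Sum>l\<in>UNIV. \<Sum>i\<in>UNIV. 2 * (h * (n l * (\<kappa> i * N2 i i l)) - n l * ((\<kappa> i)\<^sup>2 * N2 i i l)))"
      by (subst sum.swap) (simp add: power2_eq_square algebra_simps)
    then show ?thesis by (simp add: nt_def nr_def t_def r_def sum_subtractf sum_distrib_left)
  qed
  have T2: "(\<Sum>i\<in>UNIV. \<Sum>l\<in>UNIV. (h - \<kappa> i) * (2 * \<kappa> l * n i * N2 l l i)) = 2 * (h * nt - nkt)"
  proof -
    have "(\<Sum>i\<in>UNIV. \<Sum>l\<in>UNIV. (h - \<kappa> i) * (2 * \<kappa> l * n i * N2 l l i))
      = (\<Sum>i\<in>UNIV. \<Sum>l\<in>UNIV. 2 * (h * (n i * (\<kappa> l * N2 l l i)) - n i * \<kappa> i * (\<kappa> l * N2 l l i)))"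
      by (simp add: algebra_simps)
    then show ?thesis by (simp add: nt_def nkt_def t_def sum_subtractf sum_distrib_left)
  qed
  have T3: "(\<Sum>i\<in>UNIV. \<Sum>l\<in>UNIV. (h - \<kappa> i) * (\<kappa> l * (\<Sum>b\<in>UNIV. n b * N2 i i b))) = h * np"
  proof -
    have "(\<Sum>i\<in>UNIV. \<Sum>l\<in>UNIV. (h - \<kappa> i) * (\<kappa> l * (\<Sum>b\<in>UNIV. n b * N2 i i b)))
      = (\<Sum>i\<in>UNIV. \<Sum>l\<in>UNIV. \<kappa> l * ((h - \<kappa> i) * (\<Sum>b\<in>UNIV. n b * N2 i i b)))"
      by (simp add: algebra_simps)
    also have "\<dots> = h * (\<Sum>i\<in>UNIV. (h - \<kappa> i) * (\<Sum>b\<in>UNIV. n b * N2 i i b))"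
      by (simp only: sum_distrib_right[symmetric] sum_distrib_left[symmetric] h_def[symmetric])
    also have "(\<Sum>i\<in>UNIV. (h - \<kappa> i) * (\<Sum>b\<in>UNIV. n b * N2 i i b)) = np"
      unfolding np_def p_def sum_distrib_left by (subst sum.swap) (simp add: algebra_simps)
    finally show ?thesis .
  qed
  have T4: "(\<Sum>i\<in>UNIV. \<Sum>l\<in>UNIV. (h - \<kappa> i) * (\<kappa> i * (\<Sum>b\<in>UNIV. n b * N2 l l b))) = w * nH"
  proof -
    have "(\<Sum>l\<in>UNIV. (\<Sum>b\<in>UNIV. n b * N2 l l b)) = nH"
      unfolding nH_def H_def sum_distrib_left by (subst sum.swap) simp
    moreover have "(\<Sum>i\<in>UNIV. \<Sum>l\<in>UNIV. (h - \<kappa> i) * (\<kappa> i * (\<Sum>b\<in>UNIV. n b * N2 l l b)))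
      = w * (\<Sum>l\<in>UNIV. (\<Sum>b\<in>UNIV. n b * N2 l l b))"
      unfolding w_def sum_product by (simp add: mult.assoc)
    ultimately show ?thesis by simp
  qed
  \<comment> \<open>This is the contribution of the Gauss equation and the only source of the
    positive term h * q.\<close>
  have T5: "(\<Sum>i\<in>UNIV. \<Sum>l\<in>UNIV. (h - \<kappa> i) * (\<kappa> i * \<kappa> l * (\<kappa> i - \<kappa> l))) = q * h - w * s"
  proof -
    have "(h - \<kappa> i) * (\<kappa> i * \<kappa> l * (\<kappa> i - \<kappa> l))
        = ((h - \<kappa> i) * (\<kappa> i)\<^sup>2) * \<kappa> l - ((h - \<kappa> i) * \<kappa> i) * (\<kappa> l)\<^sup>2" for i l
      by (simp add: power2_eq_square algebra_simps)
    moreover have "(\<Sum>i\<in>UNIV. \<Sum>l\<in>UNIV. ((h - \<kappa> i) * (\<kappa> i)\<^sup>2) * \<kappa> l) = q * h"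
      unfolding q_def h_def by (rule sum_product[symmetric])
    moreover have "(\<Sum>i\<in>UNIV. \<Sum>l\<in>UNIV. ((h - \<kappa> i) * \<kappa> i) * (\<kappa> l)\<^sup>2) = w * s"
      unfolding w_def s_def by (rule sum_product[symmetric])
    ultimately show ?thesis by (simp add: sum_subtractf)
  qed
  have "(\<Sum>i\<in>UNIV. \<Sum>l\<in>UNIV. (h - \<kappa> i) * X i l) =
     (\<Sum>i\<in>UNIV. \<Sum>l\<in>UNIV. (h - \<kappa> i) * X l i
       - (h - \<kappa> i) * (2 * \<kappa> i * n l * N2 i i l) + (h - \<kappa> i) * (2 * \<kappa> l * n i * N2 l l i)
       - (h - \<kappa> i) * (\<kappa> l * (\<Sum>b\<in>UNIV. n b * N2 i i b)) + (h - \<kappa> i) * (\<kappa> i * (\<Sum>b\<in>UNIV. n b * N2 l l b))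
       - (h - \<kappa> i) * (\<kappa> i * \<kappa> l * (\<kappa> i - \<kappa> l)))"
    by (intro sum.cong refl, subst comm) (simp add: ring_distribs)
  also have "\<dots> = (\<Sum>i\<in>UNIV. \<Sum>l\<in>UNIV. (h - \<kappa> i) * X l i)
      - 2 * (h * nt - nr) + 2 * (h * nt - nkt) - h * np + w * nH - (q * h - w * s)"
    by (simp only: sum.distrib sum_subtractf T1 T2 T3 T4 T5)
  finally have main: "(\<Sum>i\<in>UNIV. \<Sum>l\<in>UNIV. (h - \<kappa> i) * X i l) = (\<Sum>i\<in>UNIV. \<Sum>l\<in>UNIV. (h - \<kappa> i) * X l i)
      - 2 * (h * nt - nr) + 2 * (h * nt - nkt) - h * np + w * nH - (q * h - w * s)" .
  have e1: "(\<Sum>k\<in>UNIV. \<Sum>a\<in>UNIV. \<Sum>b\<in>UNIV. N2 a b k * N2 b a k)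
      = (\<Sum>a\<in>UNIV. \<Sum>b\<in>UNIV. \<Sum>k\<in>UNIV. N2 a b k * N2 b a k)"
    by (subst sum.swap, rule sum.cong[OF refl], rule sum.swap)
  have e2: "(\<Sum>k\<in>UNIV. \<Sum>i\<in>UNIV. (h - \<kappa> i) * X i k) = (\<Sum>i\<in>UNIV. \<Sum>l\<in>UNIV. (h - \<kappa> i) * X i l)"
    by (rule sum.swap)
  \<comment> \<open>In \<open>main\<close> the terms with \<open>nt\<close> cancel and 2 (nr - nkt)
    remains, which cancels against the correction in \<open>quad\<close>. Of the first derivative
    terms only \<open>np\<close> and \<open>nH\<close> survive.\<close>
  show "(\<Sum>i\<in>UNIV. (h - \<kappa> i) * (\<Sum>a\<in>UNIV. X a i)) =
      (\<Sum>k\<in>UNIV. (H k)\<^sup>2 - (\<Sum>a\<in>UNIV. \<Sum>b\<in>UNIV. N2 a b k * N2 b a k) + (\<Sum>i\<in>UNIV. (h - \<kappa> i) * X i k))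
      + (\<Sum>a\<in>UNIV. \<Sum>b\<in>UNIV. \<Sum>k\<in>UNIV. (c a b k)\<^sup>2) - (\<Sum>k\<in>UNIV. (H k)\<^sup>2)
      + h * (\<Sum>k\<in>UNIV. n k * p k) - (\<Sum>i\<in>UNIV. (h - \<kappa> i) * \<kappa> i) * (\<Sum>k\<in>UNIV. n k * H k)
      + h * (\<Sum>i\<in>UNIV. (h - \<kappa> i) * (\<kappa> i)\<^sup>2) - (\<Sum>i\<in>UNIV. (h - \<kappa> i) * \<kappa> i) * (\<Sum>i\<in>UNIV. (\<kappa> i)\<^sup>2)"
    unfolding sum.distrib sum_subtractf e1 e2 quad main
      sum_distrib_left[of _ "\<lambda>a. X a _"]
      np_def[symmetric] nH_def[symmetric] w_def[symmetric] q_def[symmetric] s_def[symmetric]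
    by (simp add: algebra_simps)
qed

section \<open>Leibniz rules for second derivatives\<close>

lemma partial2_cong:
  assumes "open S" "x \<in> S" "\<And>y. y \<in> S \<Longrightarrow> f y = g y"
  shows "partial w (partial v f) x = partial w (partial v g) x"
  by (rule partial_cong_open[OF assms(1,2)]) (rule partial_cong_open[OF assms(1) _ assms(3)])

lemma partial2_mult:
  assumes "open S" "x \<in> S" "diff_upto 2 S f" "diff_upto 2 S g"
  shows "partial w (partial v (\<lambda>y. f y * g y)) x = f x * partial w (partial v g) x
    + partial w f x * partial v g x + partial v f x * partial w g x + partial w (partial v f) x * g x"
proof -
  have d: "f differentiable (at y)" "g differentiable (at y)" "partial u f differentiable (at y)"
    "partial u g differentiable (at y)" if "y \<in> S" for y u
    using assms(3,4) that by (auto simp: eval_nat_numeral)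
  have "partial w (partial v (\<lambda>y. f y * g y)) x
      = partial w (\<lambda>y. f y * partial v g y + partial v f y * g y) x"
    by (rule partial_cong_open[OF assms(1,2)]) (simp add: partial_mult d)
  also have "\<dots> = f x * partial w (partial v g) x + partial w f x * partial v g x
      + (partial v f x * partial w g x + partial w (partial v f) x * g x)"
    using d[OF assms(2)] by (simp add: partial_add partial_mult)
  finally show ?thesis by simp
qed

lemma partial2_add:
  assumes "open S" "x \<in> S" "diff_upto 2 S f" "diff_upto 2 S g"
  shows "partial w (partial v (\<lambda>y. f y + g y)) x = partial w (partial v f) x + partial w (partial v g) x"
proof -
  have d: "f differentiable (at y)" "g differentiable (at y)" "partial u f differentiable (at y)"
    "partial u g differentiable (at y)" if "y \<in> S" for y u
    using assms(3,4) that by (auto simp: eval_nat_numeral)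
  have "partial w (partial v (\<lambda>y. f y + g y)) x = partial w (\<lambda>y. partial v f y + partial v g y) x"
    by (rule partial_cong_open[OF assms(1,2)]) (simp add: partial_add d)
  then show ?thesis using d[OF assms(2)] by (simp add: partial_add)
qed

lemma partial2_diff:
  assumes "open S" "x \<in> S" "diff_upto 2 S f" "diff_upto 2 S g"
  shows "partial w (partial v (\<lambda>y. f y - g y)) x = partial w (partial v f) x - partial w (partial v g) x"
proof -
  have d: "f differentiable (at y)" "g differentiable (at y)" "partial u f differentiable (at y)"
    "partial u g differentiable (at y)" if "y \<in> S" for y u
    using assms(3,4) that by (auto simp: eval_nat_numeral)
  have "partial w (partial v (\<lambda>y. f y - g y)) x = partial w (\<lambda>y. partial v f y - partial v g y) x"
    by (rule partial_cong_open[OF assms(1,2)]) (simp add: partial_diff d)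
  then show ?thesis using d[OF assms(2)] by (simp add: partial_diff)
qed

lemma partial2_sum:
  assumes "open S" "x \<in> S" "\<And>i. i \<in> I \<Longrightarrow> diff_upto 2 S (f i)"
  shows "partial w (partial v (\<lambda>y. \<Sum>i\<in>I. f i y)) x = (\<Sum>i\<in>I. partial w (partial v (f i)) x)"
proof -
  have d: "f i differentiable (at y)" "partial u (f i) differentiable (at y)" if "y \<in> S" "i \<in> I" for y u i
    using assms(3)[OF that(2)] that(1) by (auto simp: eval_nat_numeral)
  have "partial w (partial v (\<lambda>y. \<Sum>i\<in>I. f i y)) x = partial w (\<lambda>y. \<Sum>i\<in>I. partial v (f i) y) x"
    by (rule partial_cong_open[OF assms(1,2)]) (simp add: partial_sum d)
  then show ?thesis using d[OF assms(2)] by (simp add: partial_sum)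
qed

lemma partial2_const [simp]: "partial w (partial v (\<lambda>x. c)) x = 0"
proof -
  have "partial v (\<lambda>x. c) = (\<lambda>x. 0)" by (rule ext) simp
  then show ?thesis by simp
qed

text \<open>
  The functions n^a are the components of \<nu> in a constant frame e. In this frame the inverse metric is
  K + n n^T with a constant matrix K, and the assumption Rsym says that the second fundamental form
  with both indices raised is symmetric.
\<close>

lemma linearized_mean_curvature_equation:
  fixes n :: "'i::finite \<Rightarrow> 'a::euclidean_space \<Rightarrow> real" and e :: "'i \<Rightarrow> 'a" and K :: "'i \<Rightarrow> 'i \<Rightarrow> real"
    and P :: "'a \<Rightarrow> real" and \<kappa> :: "'i \<Rightarrow> real"
  defines "A \<equiv> \<lambda>a b. partial (e b) (n a)"
  defines "H \<equiv> \<lambda>y. \<Sum>a\<in>UNIV. A a a y"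
  defines "h \<equiv> \<Sum>i\<in>UNIV. \<kappa> i"
  assumes S: "open S" "x \<in> S" and td: "\<And>a. diff_upto 3 S (n a)"
    and Rsym: "\<And>y a c. y \<in> S \<Longrightarrow> (\<Sum>b\<in>UNIV. A a b y * (K b c + n b y * n c y))
        = (\<Sum>b\<in>UNIV. A c b y * (K b a + n b y * n a y))"
    and g0: "\<And>b c. K b c + n b x * n c x = (if b = c then 1 else 0)"
    and A0: "\<And>a b. A a b x = (if a = b then \<kappa> a else 0)"
    and P: "\<And>y. y \<in> S \<Longrightarrow> 2 * P y = (H y)\<^sup>2 - (\<Sum>a\<in>UNIV. \<Sum>b\<in>UNIV. A a b y * A b a y)"
  obtains c :: "'i \<Rightarrow> 'i \<Rightarrow> 'i \<Rightarrow> real"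
    where "\<And>a b k. c a b k = c a k b" "\<And>a b k. c a b k = c b a k"
      and "\<And>k. (\<Sum>i\<in>UNIV. c i i k) = partial (e k) H x"
      and "\<And>k. (\<Sum>i\<in>UNIV. (h - \<kappa> i) * c i i k) = partial (e k) P x"
      and "(\<Sum>i\<in>UNIV. (h - \<kappa> i) * partial (e i) (partial (e i) H) x) =
        (\<Sum>k\<in>UNIV. partial (e k) (partial (e k) P) x)
        + (\<Sum>a\<in>UNIV. \<Sum>b\<in>UNIV. \<Sum>k\<in>UNIV. (c a b k)\<^sup>2) - (\<Sum>k\<in>UNIV. (partial (e k) H x)\<^sup>2)
        + h * (\<Sum>k\<in>UNIV. n k x * partial (e k) P x)
        - (\<Sum>i\<in>UNIV. (h - \<kappa> i) * \<kappa> i) * (\<Sum>k\<in>UNIV. n k x * partial (e k) H x)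
        + h * (\<Sum>i\<in>UNIV. (h - \<kappa> i) * (\<kappa> i)\<^sup>2) - (\<Sum>i\<in>UNIV. (h - \<kappa> i) * \<kappa> i) * (\<Sum>i\<in>UNIV. (\<kappa> i)\<^sup>2)"
proof -
  note tdI = diff_upto_sum[OF S(1)] diff_upto_mult[OF S(1)]
    diff_upto_add[OF S(1)] diff_upto_diff[OF S(1)] diff_upto_const
  note diffI = diff_uptoD[OF _ _ S(2), of 2]
  have tA: "diff_upto 2 S (A a b)" for a b
    using td[of a] unfolding A_def by (simp add: eval_nat_numeral)
  have tn: "diff_upto 2 S (n a)" for a
    using diff_upto_mono[OF td, of 2 a] by simp
  have tH: "diff_upto 2 S H" unfolding H_def by (intro tdI tA) simp
  have dn: "n a differentiable (at x)" for a by (rule diffI[OF tn]) simp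
  have dA: "A a b differentiable (at x)" for a b by (rule diffI[OF tA]) simp
  have dH: "H differentiable (at x)" by (rule diffI[OF tH]) simp
  define g where "g b c y = K b c + n b y * n c y" for b c y
  have tg: "diff_upto 2 S (g b c)" for b c
    unfolding g_def[abs_def] by (intro tdI tn)
  have dg: "g b c differentiable (at x)" for b c by (rule diffI[OF tg]) simp
  define N2 where "N2 a b k = partial (e k) (A a b) x" for a b k
  define X where "X i l = partial (e l) (partial (e l) (A i i)) x" for i l
  define m where "m a = n a x" for a
  have swapA: "partial (e k) (A a b) y = partial (e b) (A a k) y" if "y \<in> S" for a b k y
    unfolding A_def by (rule partial_commute[OF S(1) that tn])
  have sym2: "N2 a b k = N2 a k b" for a b k unfolding N2_def by (rule swapA[OF S(2)])
  have N3: "partial (e i) (partial (e l) (A i l)) x = X i l" for i l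
  proof -
    have "partial (e i) (partial (e l) (A i l)) x = partial (e l) (partial (e i) (A i l)) x"
      by (rule partial_commute[OF S tA])
    also have "\<dots> = partial (e l) (partial (e l) (A i i)) x"
      by (rule partial_cong_open[OF S swapA])
    finally show ?thesis by (simp add: X_def)
  qed
  have g1: "partial (e k) (g b c) x = m b * A c k x + A b k x * m c" for b c k
    unfolding g_def[abs_def]
    by (simp add: partial_add partial_mult dn differentiable_mult A_def m_def)
  have g2: "partial (e i) (partial (e l) (g b c)) x
      = m b * N2 c l i + A b i x * A c l x + A b l x * A c i x + N2 b l i * m c" for b c i l
    unfolding g_def[abs_def]
    by (simp add: partial2_add[OF S] partial2_mult[OF S] tn tdI A_def N2_def m_def)
  \<comment> \<open>R is the second fundamental form with both indices raised. Differentiating its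
    symmetry once gives the Codazzi equation, differentiating it twice gives the commutation rule
    \<open>comm\<close>.\<close>
  define R where "R a c y = (\<Sum>b\<in>UNIV. A a b y * g b c y)" for a c y
  have tR: "diff_upto 2 S (R a c)" for a c
    unfolding R_def[abs_def] by (intro tdI tA tg) simp
  have Rs: "R a c y = R c a y" if "y \<in> S" for a c y
    using Rsym[OF that] by (simp add: R_def g_def)
  have R1: "partial (e k) (R a c) x =
      N2 a c k + (if a = k then \<kappa> a * \<kappa> k * m c else 0) + (if c = k then \<kappa> a * \<kappa> k * m a else 0)" for a c k
  proof -
    have "partial (e k) (R a c) x = (\<Sum>b\<in>UNIV. A a b x * partial (e k) (g b c) x + N2 a b k * g b c x)"
      unfolding R_def[abs_def] by (simp add: partial_sum partial_mult dA dg differentiable_mult N2_def)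
    also have "\<dots> = \<kappa> a * (m a * A c k x + A a k x * m c) + N2 a c k"
      by (simp add: g1 A0 g_def g0 sum.distrib if_distrib[where f="\<lambda>u. u * _"] if_distrib[where f="\<lambda>u. _ * u"]
          cong: if_cong)
    finally show ?thesis by (simp add: A0 algebra_simps)
  qed
  have codazzi: "N2 a c k + (if a = k then \<kappa> a * \<kappa> k * m c else 0) + (if c = k then \<kappa> a * \<kappa> k * m a else 0)
       = N2 c a k + (if c = k then \<kappa> c * \<kappa> k * m a else 0) + (if a = k then \<kappa> c * \<kappa> k * m c else 0)" for a c k
  proof -
    have "partial (e k) (R a c) x = partial (e k) (R c a) x"
      by (rule partial_cong_open[OF S]) (rule Rs)
    then show ?thesis by (simp add: R1)
  qed
  have R2: "partial (e i) (partial (e l) (R i l)) x =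
      \<kappa> i * (m i * N2 l l i + A i i x * A l l x + A i l x * A l i x + N2 i l i * m l)
      + (\<kappa> l * (\<Sum>b\<in>UNIV. m b * N2 i i b) + N2 i l i * \<kappa> l * m l)
      + ((if l = i then \<kappa> l * (\<Sum>b\<in>UNIV. m b * N2 i b l) else 0) + N2 i i l * \<kappa> i * m l)
      + X i l" for i l
  proof -
    have "partial (e i) (partial (e l) (R i l)) x =
      (\<Sum>b\<in>UNIV. A i b x * partial (e i) (partial (e l) (g b l)) x
        + N2 i b i * partial (e l) (g b l) x + N2 i b l * partial (e i) (g b l) x
        + partial (e i) (partial (e l) (A i b)) x * g b l x)"
      unfolding R_def[abs_def] by (simp add: partial2_sum[OF S] partial2_mult[OF S] tA tg tdI N2_def)
    moreover have "(\<Sum>b\<in>UNIV. A i b x * partial (e i) (partial (e l) (g b l)) x)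
        = \<kappa> i * (m i * N2 l l i + A i i x * A l l x + A i l x * A l i x + N2 i l i * m l)"
      by (simp add: A0 g2 if_distrib[where f="\<lambda>u. u * _"] cong: if_cong)
    moreover have "(\<Sum>b\<in>UNIV. N2 i b i * partial (e l) (g b l) x)
        = \<kappa> l * (\<Sum>b\<in>UNIV. m b * N2 i i b) + N2 i l i * \<kappa> l * m l"
    proof -
      have "(\<Sum>b\<in>UNIV. N2 i b i * partial (e l) (g b l) x)
          = (\<Sum>b\<in>UNIV. \<kappa> l * (m b * N2 i i b) + (if b = l then N2 i l i * \<kappa> l * m l else 0))"
        by (intro sum.cong refl) (auto simp: g1 A0 sym2 algebra_simps)
      then show ?thesis by (simp add: sum.distrib sum_distrib_left)
    qed
    moreover have "(\<Sum>b\<in>UNIV. N2 i b l * partial (e i) (g b l) x)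
        = (if l = i then \<kappa> l * (\<Sum>b\<in>UNIV. m b * N2 i b l) else 0) + N2 i i l * \<kappa> i * m l"
    proof -
      have "(\<Sum>b\<in>UNIV. N2 i b l * partial (e i) (g b l) x)
          = (\<Sum>b\<in>UNIV. (if l = i then \<kappa> l * (m b * N2 i b l) else 0) + (if b = i then N2 i i l * \<kappa> i * m l else 0))"
        by (intro sum.cong refl) (auto simp: g1 A0 algebra_simps)
      then show ?thesis by (simp add: sum.distrib sum_distrib_left)
    qed
    moreover have "(\<Sum>b\<in>UNIV. partial (e i) (partial (e l) (A i b)) x * g b l x) = X i l"
      by (simp add: g_def g0 if_distrib[where f="\<lambda>u. _ * u"] N3 cong: if_cong)
    ultimately show ?thesis by (simp add: sum.distrib)
  qed
  \<comment> \<open>The cubic term comes from the second derivative of the inverse metric: it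
    contributes \<kappa>_i^2 \<kappa>_l to the derivative of R i l and \<kappa>_l^2 \<kappa>_i to
    that of R l i.\<close>
  have comm: "X i l = X l i - 2 * \<kappa> i * m l * N2 i i l + 2 * \<kappa> l * m i * N2 l l i
       - \<kappa> l * (\<Sum>b\<in>UNIV. m b * N2 i i b) + \<kappa> i * (\<Sum>b\<in>UNIV. m b * N2 l l b)
       - \<kappa> i * \<kappa> l * (\<kappa> i - \<kappa> l)" for i l
  proof (cases "i = l")
    case False
    have "partial (e i) (partial (e l) (R i l)) x = partial (e i) (partial (e l) (R l i)) x"
      by (rule partial2_cong[OF S Rs])
    also have "\<dots> = partial (e l) (partial (e i) (R l i)) x"
      by (rule partial_commute[OF S tR])
    finally show ?thesis using False
      by (simp add: R2 A0 sym2[of i l i] sym2[of l i l] algebra_simps)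
  qed simp
  define c where "c a b k = N2 a b k + (if b = k then m a * \<kappa> k * (\<kappa> a - \<kappa> k) else 0)" for a b k
  note alg = curvature_sum_commutation[of N2 \<kappa> m X, OF sym2 codazzi comm,
      folded h_def c_def]
  have H1: "partial (e k) H x = (\<Sum>i\<in>UNIV. N2 i i k)" for k
    unfolding H_def by (simp add: partial_sum dA N2_def)
  have H2: "partial (e k) (partial (e k) H) x = (\<Sum>i\<in>UNIV. X i k)" for k
    unfolding H_def by (simp add: partial2_sum[OF S] tA X_def)
  have Hx: "H x = h" by (simp add: H_def A0 h_def)
  \<comment> \<open>P is known only through its values on S; on this open set its derivatives are
    those of Q / 2.\<close>
  define Q where "Q y = H y * H y - (\<Sum>a\<in>UNIV. \<Sum>b\<in>UNIV. A a b y * A b a y)" for y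
  have tQ: "diff_upto 2 S Q" unfolding Q_def[abs_def] by (intro tdI tA tH) simp_all
  have PQ: "P y = (1/2) * Q y" if "y \<in> S" for y using P[OF that] by (simp add: Q_def power2_eq_square)
  have P1: "partial (e k) P x = (\<Sum>i\<in>UNIV. (h - \<kappa> i) * N2 i i k)" for k
  proof -
    have "partial (e k) P x = (1/2) * partial (e k) Q x"
      using partial_cong_open[OF S PQ, where v="e k"] partial_mult[where f="\<lambda>x. 1/2" and v="e k", OF _ diffI[OF tQ]] by simp
    also have "partial (e k) Q x = 2 * h * partial (e k) H x
        - (\<Sum>a\<in>UNIV. \<Sum>b\<in>UNIV. A a b x * N2 b a k + N2 a b k * A b a x)"
      unfolding Q_def[abs_def]
      by (simp add: partial_diff partial_sum partial_mult dA dH differentiable_mult differentiable_sum Hx N2_def)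
    also have "(\<Sum>a\<in>UNIV. \<Sum>b\<in>UNIV. A a b x * N2 b a k + N2 a b k * A b a x) = 2 * (\<Sum>i\<in>UNIV. \<kappa> i * N2 i i k)"
      by (simp add: A0 sum.distrib if_distrib[where f="\<lambda>u. u * _"] if_distrib[where f="\<lambda>u. _ * u"]
          sum_distrib_left algebra_simps cong: if_cong)
    finally have "partial (e k) P x = h * (\<Sum>i\<in>UNIV. N2 i i k) - (\<Sum>i\<in>UNIV. \<kappa> i * N2 i i k)"
      by (simp add: H1)
    then show ?thesis by (simp add: left_diff_distrib sum_subtractf sum_distrib_left)
  qed
  have P2: "partial (e k) (partial (e k) P) x = (\<Sum>i\<in>UNIV. N2 i i k)\<^sup>2
      - (\<Sum>a\<in>UNIV. \<Sum>b\<in>UNIV. N2 a b k * N2 b a k) + (\<Sum>i\<in>UNIV. (h - \<kappa> i) * X i k)" for k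
  proof -
    have "partial (e k) (partial (e k) P) x = (1/2) * partial (e k) (partial (e k) Q) x"
      using partial2_cong[OF S PQ, where v="e k" and w="e k"] partial2_mult[where f="\<lambda>x. 1/2" and v="e k" and w="e k", OF S _ tQ] by simp
    also have "partial (e k) (partial (e k) Q) x = 2 * h * partial (e k) (partial (e k) H) x
        + 2 * (partial (e k) H x)\<^sup>2
        - (\<Sum>a\<in>UNIV. \<Sum>b\<in>UNIV. A a b x * partial (e k) (partial (e k) (A b a)) x
            + 2 * (N2 a b k * N2 b a k) + partial (e k) (partial (e k) (A a b)) x * A b a x)"
      unfolding Q_def[abs_def]
      by (simp add: partial2_diff[OF S] partial2_sum[OF S] partial2_mult[OF S] tA tH tdI Hx N2_def power2_eq_square algebra_simps)
    also have "(\<Sum>a\<in>UNIV. \<Sum>b\<in>UNIV. A a b x * partial (e k) (partial (e k) (A b a)) x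
            + 2 * (N2 a b k * N2 b a k) + partial (e k) (partial (e k) (A a b)) x * A b a x)
        = 2 * (\<Sum>i\<in>UNIV. \<kappa> i * X i k) + 2 * (\<Sum>a\<in>UNIV. \<Sum>b\<in>UNIV. N2 a b k * N2 b a k)"
      by (simp add: A0 X_def sum.distrib if_distrib[where f="\<lambda>u. u * _"] if_distrib[where f="\<lambda>u. _ * u"]
          sum_distrib_left algebra_simps cong: if_cong)
    finally have "partial (e k) (partial (e k) P) x = (\<Sum>i\<in>UNIV. N2 i i k)\<^sup>2
        - (\<Sum>a\<in>UNIV. \<Sum>b\<in>UNIV. N2 a b k * N2 b a k)
        + (h * (\<Sum>i\<in>UNIV. X i k) - (\<Sum>i\<in>UNIV. \<kappa> i * X i k))"
      by (simp add: H1 H2)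
    then show ?thesis by (simp add: left_diff_distrib sum_subtractf sum_distrib_left)
  qed
  show ?thesis
  proof (rule that[of c])
    show "c a b k = c a k b" "c a b k = c b a k" for a b k by (rule alg)+
    show "(\<Sum>i\<in>UNIV. c i i k) = partial (e k) H x" for k by (simp add: alg(3) H1)
    show "(\<Sum>i\<in>UNIV. (h - \<kappa> i) * c i i k) = partial (e k) P x" for k by (simp add: alg(3) P1)
    show "(\<Sum>i\<in>UNIV. (h - \<kappa> i) * partial (e i) (partial (e i) H) x) =
        (\<Sum>k\<in>UNIV. partial (e k) (partial (e k) P) x)
        + (\<Sum>a\<in>UNIV. \<Sum>b\<in>UNIV. \<Sum>k\<in>UNIV. (c a b k)\<^sup>2) - (\<Sum>k\<in>UNIV. (partial (e k) H x)\<^sup>2)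
        + h * (\<Sum>k\<in>UNIV. n k x * partial (e k) P x)
        - (\<Sum>i\<in>UNIV. (h - \<kappa> i) * \<kappa> i) * (\<Sum>k\<in>UNIV. n k x * partial (e k) H x)
        + h * (\<Sum>i\<in>UNIV. (h - \<kappa> i) * (\<kappa> i)\<^sup>2) - (\<Sum>i\<in>UNIV. (h - \<kappa> i) * \<kappa> i) * (\<Sum>i\<in>UNIV. (\<kappa> i)\<^sup>2)"
      using alg(4) by (simp add: H1 H2 P1 P2 m_def)
  qed
qed


section \<open>The third order terms\<close>

lemma square_sum3_le: "(a + b + c)\<^sup>2 \<le> 3 * (a\<^sup>2 + b\<^sup>2 + c\<^sup>2)" for a b c :: real
proof -
  have "0 \<le> (a - b)\<^sup>2 + (b - c)\<^sup>2 + (a - c)\<^sup>2" by simp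
  then show ?thesis by (simp add: power2_eq_square algebra_simps)
qed

text \<open>Used for a direction k other than the direction j of the largest curvature, with x =
  c_jjk, s the sum and r^2 the sum of squares of the remaining c_iik. The coefficient 3 counts the
  positions of c_jjk in the symmetric array c; it beats the factor 1 + \<phi> <= 2.01 even after the
  loss in (x + s)^2 <= (5/4) x^2 + 5 s^2, because 2.01 * 5/4 < 3.\<close>

lemma transversal_third_order_bound:
  fixes x s r t \<phi> :: real
  assumes "\<bar>s\<bar> \<le> t + \<bar>x\<bar> / 100 + r / 100" "0 \<le> r" "0 \<le> t" "\<phi> \<le> 1 + 1 / 100"
  shows "3 * x\<^sup>2 + r\<^sup>2 - (x + s)\<^sup>2 - \<phi> * (x + s)\<^sup>2 \<ge> - 32 * t\<^sup>2"
proof -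
  have "s\<^sup>2 \<le> (t + \<bar>x\<bar> / 100 + r / 100)\<^sup>2" using assms by (intro power2_le_iff_abs_le[THEN iffD2]) auto
  also have "\<dots> \<le> 3 * (t\<^sup>2 + (\<bar>x\<bar> / 100)\<^sup>2 + (r / 100)\<^sup>2)" by (rule square_sum3_le)
  finally have s: "s\<^sup>2 \<le> 3 * t\<^sup>2 + 3 * x\<^sup>2 / 10000 + 3 * r\<^sup>2 / 10000" by (simp add: power2_eq_square)
  have "0 \<le> (x / 2 - 2 * s)\<^sup>2" by simp
  then have xs: "(x + s)\<^sup>2 \<le> (5/4) * x\<^sup>2 + 5 * s\<^sup>2" by (simp add: power2_eq_square algebra_simps)
  have "\<phi> * (x + s)\<^sup>2 \<le> (1 + 1/100) * (x + s)\<^sup>2" using assms by (intro mult_right_mono) auto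
  moreover have "0 \<le> x\<^sup>2" "0 \<le> r\<^sup>2" "0 \<le> t\<^sup>2" by auto
  ultimately show ?thesis using s xs by argo
qed

text \<open>Used for k = j, where x = c_jjj occurs only once and leaves no slack. Now x^2 - (x +
  s)^2 = s^2 - 2 (x + s) s is bounded through |x + s| <= m h and the smallness of s; the errors with
  m^2 carry a factor \<delta> or B^2, so that they can be paid for by the curvature term.\<close>

lemma tangential_third_order_bound:
  fixes x s r p B m \<delta> h :: real
  assumes "h * \<bar>s\<bar> \<le> \<bar>p\<bar> + \<delta> * \<bar>x\<bar> + B * r" "0 \<le> r" "0 \<le> \<delta>" "\<delta> \<le> h / 100" "0 < h"
    and "\<bar>x + s\<bar> \<le> m * h" "0 \<le> m"
  shows "x\<^sup>2 + r\<^sup>2 - (x + s)\<^sup>2 - \<delta> / h * (x + s)\<^sup>2 \<ge> - 4 * m * \<bar>p\<bar> - 5 * m\<^sup>2 * \<delta> * h - 4 * m\<^sup>2 * B\<^sup>2"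
proof -
  define H where "H = x + s"
  \<comment> \<open>The term \<delta> |x| is traded for \<delta> m h plus \<delta> |s|, and the
    latter is at most a hundredth of the left side.\<close>
  have "\<bar>x\<bar> \<le> m * h + \<bar>s\<bar>" using assms(6) by linarith
  then have "\<delta> * \<bar>x\<bar> \<le> \<delta> * (m * h + \<bar>s\<bar>)" using assms(3) by (intro mult_left_mono)
  moreover have "\<delta> * \<bar>s\<bar> \<le> (h / 100) * \<bar>s\<bar>" using assms(4) by (intro mult_right_mono) auto
  moreover have "0 \<le> h * \<bar>s\<bar>" using assms(5) by simp
  ultimately have hs: "h * \<bar>s\<bar> \<le> 2 * (\<bar>p\<bar> + \<delta> * m * h + B * r)"
    using assms(1) by (simp add: algebra_simps)
  have "\<bar>H * s\<bar> \<le> (m * h) * \<bar>s\<bar>" unfolding abs_mult using assms(6) by (intro mult_right_mono) (auto simp: H_def)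
  also have "\<dots> = m * (h * \<bar>s\<bar>)" by simp
  also have "\<dots> \<le> m * (2 * (\<bar>p\<bar> + \<delta> * m * h + B * r))" using hs assms(7) by (intro mult_left_mono)
  finally have Hs: "\<bar>H * s\<bar> \<le> m * (2 * (\<bar>p\<bar> + \<delta> * m * h + B * r))" .
  have "H\<^sup>2 \<le> (m * h)\<^sup>2" using assms(6) by (intro power2_le_iff_abs_le[THEN iffD2]) (auto simp: H_def)
  then have "\<delta> / h * H\<^sup>2 \<le> \<delta> / h * (m * h)\<^sup>2" using assms by (intro mult_left_mono) auto
  also have "\<dots> = m\<^sup>2 * \<delta> * h" using assms(5) by (simp add: power2_eq_square)
  finally have dH: "\<delta> / h * H\<^sup>2 \<le> m\<^sup>2 * \<delta> * h" .
  have "0 \<le> (r - 2 * m * B)\<^sup>2" by simp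
  then have rB: "4 * m * (B * r) \<le> r\<^sup>2 + 4 * m\<^sup>2 * B\<^sup>2" by (simp add: power2_eq_square algebra_simps)
  have "x\<^sup>2 - H\<^sup>2 = s\<^sup>2 - 2 * (H * s)" by (simp add: H_def power2_eq_square algebra_simps)
  also have "\<dots> \<ge> - 2 * (m * (2 * (\<bar>p\<bar> + \<delta> * m * h + B * r)))"
    using Hs abs_ge_self[of "H * s"] zero_le_power2[of s] by linarith
  finally have "x\<^sup>2 - H\<^sup>2 \<ge> - 4 * m * \<bar>p\<bar> - 4 * m\<^sup>2 * \<delta> * h - 4 * m * (B * r)"
    by (simp add: power2_eq_square algebra_simps)
  then show ?thesis using dH rB by (simp add: H_def[symmetric])
qed

text \<open>The two subtracted sums are |DH|^2 from differentiating the equation twice and the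
  gradient term of the maximum condition for log H. Here m h bounds DH and M (1 + h) bounds the
  derivative of the right side. Since m grows with the weight of the test function, it is essential
  that the final error is only linear in m and in h.\<close>

lemma third_order_terms_bound:
  fixes \<kappa> :: "'i::finite \<Rightarrow> real" and c :: "'i \<Rightarrow> 'i \<Rightarrow> 'i \<Rightarrow> real"
  defines "h \<equiv> \<Sum>i\<in>UNIV. \<kappa> i" and "N \<equiv> real CARD('i)"
  defines "H \<equiv> \<lambda>k. \<Sum>i\<in>UNIV. c i i k" and "p \<equiv> \<lambda>k. \<Sum>i\<in>UNIV. (h - \<kappa> i) * c i i k"
  assumes sym: "\<And>a b k. c a b k = c a k b" "\<And>a b k. c a b k = c b a k"
    and s2: "(\<Sum>i\<in>UNIV. (\<kappa> i)\<^sup>2) < h\<^sup>2"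
    and H: "\<And>k. \<bar>H k\<bar> \<le> m * h" and p: "\<And>k. \<bar>p k\<bar> \<le> M * (1 + h)"
    and m: "0 \<le> m" and M: "0 \<le> M"
    and h: "1 \<le> h" "400 * N\<^sup>2 * m \<le> h"
  shows "(\<Sum>a\<in>UNIV. \<Sum>b\<in>UNIV. \<Sum>k\<in>UNIV. (c a b k)\<^sup>2) - (\<Sum>k\<in>UNIV. (H k)\<^sup>2)
      - (\<Sum>k\<in>UNIV. (h - \<kappa> k) * (H k)\<^sup>2) / h + h * (\<Sum>i\<in>UNIV. (h - \<kappa> i) * (\<kappa> i)\<^sup>2)
      \<ge> - (8 * m * M + 128 * N * M\<^sup>2) * h"
proof -
  have N: "1 \<le> N" by (simp add: N_def Suc_leI)
  have kh: "\<bar>\<kappa> i\<bar> < h" for i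
  proof -
    have "(\<kappa> i)\<^sup>2 \<le> (\<Sum>i\<in>UNIV. (\<kappa> i)\<^sup>2)" by (rule member_le_sum) auto
    then have "(\<kappa> i)\<^sup>2 < h\<^sup>2" using s2 by simp
    then show ?thesis using h(1) by (intro power2_less_imp_less[of "\<bar>\<kappa> i\<bar>" h]) auto
  qed
  have f: "0 < h - \<kappa> i" "h - \<kappa> i \<le> 2 * h" for i using kh[of i] by linarith+
  obtain j where j: "\<And>i. \<kappa> i \<le> \<kappa> j"
  proof -
    have "Max (range \<kappa>) \<in> range \<kappa>" by (rule Max_in) auto
    then obtain j where "\<kappa> j = Max (range \<kappa>)" by (metis imageE)
    then show ?thesis using that[of j] by simp
  qed
  have kj: "h / N \<le> \<kappa> j"
  proof -
    have "h \<le> (\<Sum>i\<in>(UNIV::'i set). \<kappa> j)" unfolding h_def using j by (intro sum_mono)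
    then have "h \<le> N * \<kappa> j" by (simp add: N_def)
    then show ?thesis using N by (simp add: divide_le_eq mult.commute)
  qed
  define \<delta> where "\<delta> = h - \<kappa> j"
  define B where "B = sqrt (\<Sum>i\<in>-{j}. (\<kappa> i)\<^sup>2)"
  have B2: "B\<^sup>2 = (\<Sum>i\<in>-{j}. (\<kappa> i)\<^sup>2)" unfolding B_def by (intro real_sqrt_pow2 sum_nonneg) auto
  have B0: "0 \<le> B" unfolding B_def by (intro real_sqrt_ge_zero sum_nonneg) auto
  have d0: "0 < \<delta>" using f by (simp add: \<delta>_def)
  have split: "(\<Sum>i\<in>UNIV. F i) = F j + (\<Sum>i\<in>-{j}. F i)" for F :: "'i \<Rightarrow> real"
    using sum.remove[of UNIV j F] by (simp add: Compl_eq_Diff_UNIV)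
  \<comment> \<open>Two curvatures above 3h/4 would contribute more than 2 * (9/16) h^2 > h^2 to the
    sum of squares.\<close>
  have fi: "h / 4 \<le> h - \<kappa> i" if "i \<noteq> j" for i
  proof (rule ccontr)
    assume "\<not> ?thesis"
    then have ki: "3 * h / 4 < \<kappa> i" by simp
    then have "(3 * h / 4)\<^sup>2 < (\<kappa> i)\<^sup>2" "(3 * h / 4)\<^sup>2 < (\<kappa> j)\<^sup>2"
      using j[of i] h(1) by (auto intro!: power_strict_mono)
    moreover have "(\<kappa> i)\<^sup>2 \<le> (\<Sum>i\<in>-{j}. (\<kappa> i)\<^sup>2)" using that by (intro member_le_sum) auto
    ultimately have "2 * (3 * h / 4)\<^sup>2 < h\<^sup>2" using s2 split[of "\<lambda>i. (\<kappa> i)\<^sup>2"] by linarith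
    then show False using h(1) by (simp add: power2_eq_square)
  qed
  define q where "q = (\<Sum>i\<in>UNIV. (h - \<kappa> i) * (\<kappa> i)\<^sup>2)"
  \<comment> \<open>The index j contributes \<delta> \<kappa>_j^2 with \<kappa>_j >= h / N, every
    other index at least (h / 4) \<kappa>_i^2.\<close>
  have q: "\<delta> * h\<^sup>2 / N\<^sup>2 + h / 4 * B\<^sup>2 \<le> q"
  proof -
    have "(h / N)\<^sup>2 \<le> (\<kappa> j)\<^sup>2" using kj h(1) N by (intro power_mono) auto
    then have "\<delta> * (h / N)\<^sup>2 \<le> \<delta> * (\<kappa> j)\<^sup>2" using d0 by (intro mult_left_mono) auto
    moreover have "h / 4 * B\<^sup>2 \<le> (\<Sum>i\<in>-{j}. (h - \<kappa> i) * (\<kappa> i)\<^sup>2)"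
      unfolding B2 sum_distrib_left using fi by (intro sum_mono mult_right_mono) auto
    ultimately show ?thesis using split[of "\<lambda>i. (h - \<kappa> i) * (\<kappa> i)\<^sup>2"]
      by (simp add: q_def \<delta>_def power_divide)
  qed
  have C: "0 \<le> 8 * m * M + 128 * N * M\<^sup>2" using m M N by simp
  have H2: "(H k)\<^sup>2 \<le> (m * h)\<^sup>2" for k
    using H[of k] by (intro power2_le_iff_abs_le[THEN iffD2]) auto
  have mh: "160000 * (N^4 * m\<^sup>2) \<le> h\<^sup>2"
    using power_mono[OF h(2), of 2] m N by (simp add: power_mult_distrib power_mult[symmetric])
  have Nm: "N^k * m\<^sup>2 \<le> N^4 * m\<^sup>2" if "k \<le> 4" for k
    using that N by (intro mult_right_mono power_increasing) auto
  have Nm0: "0 \<le> N^k * m\<^sup>2" for k using N by simp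
  \<comment> \<open>If \<delta> or B is at least h/100, then q is of order h^3 and dominates. Otherwise the equation
    p k = \<delta> * x k + h * s k - ... below shows that s k, the part of H k that does not come from the
    direction j of the largest curvature, is small.\<close>
  show ?thesis
  proof (cases "\<delta> \<le> h / 100 \<and> B \<le> h / 100")
    case False
    \<comment> \<open>|DH|^2 is at most N m^2 h^2, and the weighted sum at most twice that because h
      - \<kappa>_k <= 2h; the factor 3 pays for both.\<close>
    have "3 * N * m\<^sup>2 * h \<le> q"
    proof -
      consider "h / 100 < \<delta>" | "h / 100 < B" using False by linarith
      then show ?thesis
      proof cases
        case 1
        have "3 * N^3 * m\<^sup>2 * h \<le> (h\<^sup>2 / 100) * h" using Nm[of 3] mh Nm0[of 3] h(1) by (intro mult_right_mono) auto
        also have "\<dots> = h / 100 * h\<^sup>2" by simp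
        also have "\<dots> \<le> \<delta> * h\<^sup>2" using 1 by (intro mult_right_mono) auto
        finally have "3 * N^3 * m\<^sup>2 * h / N\<^sup>2 \<le> \<delta> * h\<^sup>2 / N\<^sup>2" by (intro divide_right_mono) auto
        moreover have "3 * N^3 * m\<^sup>2 * h / N\<^sup>2 = 3 * N * m\<^sup>2 * h"
          using N by (simp add: power2_eq_square power3_eq_cube)
        moreover have "0 \<le> h / 4 * B\<^sup>2" using h(1) by simp
        ultimately show ?thesis using q by linarith
      next
        case 2
        have "(h / 100)\<^sup>2 \<le> B\<^sup>2" using 2 h(1) by (intro power_mono) auto
        then have "h / 4 * (h / 100)\<^sup>2 \<le> h / 4 * B\<^sup>2" using h(1) by (intro mult_left_mono) auto
        moreover have "3 * N * m\<^sup>2 * h \<le> (h\<^sup>2 / 40000) * h"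
          using Nm[of 1] mh Nm0[of 1] h(1) by (intro mult_right_mono) auto
        moreover have "0 \<le> \<delta> * h\<^sup>2 / N\<^sup>2" using d0 by simp
        ultimately show ?thesis using q by (simp add: power2_eq_square)
      qed
    qed
    then have "h * (3 * N * m\<^sup>2 * h) \<le> h * q" using h(1) by (intro mult_left_mono) auto
    moreover have "(\<Sum>k\<in>UNIV. (H k)\<^sup>2) \<le> N * (m * h)\<^sup>2"
      using sum_mono[of UNIV "\<lambda>k. (H k)\<^sup>2" "\<lambda>k. (m * h)\<^sup>2"] H2 by (simp add: N_def)
    moreover have "(\<Sum>k\<in>UNIV. (h - \<kappa> k) * (H k)\<^sup>2) / h \<le> 2 * N * (m * h)\<^sup>2"
    proof -
      have "(\<Sum>k\<in>UNIV. (h - \<kappa> k) * (H k)\<^sup>2) \<le> (\<Sum>k\<in>(UNIV::'i set). 2 * h * (m * h)\<^sup>2)"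
        using f H2 h(1) by (intro sum_mono mult_mono) auto
      also have "\<dots> = 2 * N * (m * h)\<^sup>2 * h" by (simp add: N_def)
      finally show ?thesis using h(1) by (simp add: divide_le_eq)
    qed
    moreover have "0 \<le> (\<Sum>a\<in>UNIV. \<Sum>b\<in>UNIV. \<Sum>k\<in>UNIV. (c a b k)\<^sup>2)" by (intro sum_nonneg) auto
    moreover have "0 \<le> (8 * m * M + 128 * N * M\<^sup>2) * h" using C h(1) by simp
    moreover have "h * (3 * N * m\<^sup>2 * h) = 3 * N * (m * h)\<^sup>2" by (simp add: power2_eq_square)
    ultimately show ?thesis unfolding q_def[symmetric] minus_mult_left[symmetric] by linarith
  next
    case True
    define x where "x k = c j j k" for k
    define S where "S k = (\<Sum>i\<in>-{j}. (c i i k)\<^sup>2)" for k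
    define s where "s k = (\<Sum>i\<in>-{j}. c i i k)" for k
    define r where "r k = sqrt (S k)" for k
    have S0: "0 \<le> S k" for k unfolding S_def by (intro sum_nonneg) auto
    have r: "0 \<le> r k" "(r k)\<^sup>2 = S k" for k using S0 by (auto simp: r_def)
    have Hk: "H k = x k + s k" for k by (simp add: H_def x_def s_def split)
    have hs: "h * \<bar>s k\<bar> \<le> \<bar>p k\<bar> + \<delta> * \<bar>x k\<bar> + B * r k" for k
    proof -
      have "(\<Sum>i\<in>-{j}. \<kappa> i * c i i k)\<^sup>2 \<le> (B * r k)\<^sup>2"
        using Cauchy_Schwarz_ineq_sum[of \<kappa> "\<lambda>i. c i i k" "-{j}"] r(2) B2
        by (simp add: power_mult_distrib S_def)
      then have cs: "\<bar>\<Sum>i\<in>-{j}. \<kappa> i * c i i k\<bar> \<le> B * r k"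
        using B0 r(1) by (simp add: power2_le_iff_abs_le)
      have "p k = \<delta> * x k + (h * s k - (\<Sum>i\<in>-{j}. \<kappa> i * c i i k))"
        by (simp add: p_def split \<delta>_def x_def s_def left_diff_distrib sum_subtractf sum_distrib_left)
      then have "h * s k = p k - \<delta> * x k + (\<Sum>i\<in>-{j}. \<kappa> i * c i i k)" by simp
      then have "\<bar>h * s k\<bar> \<le> \<bar>p k\<bar> + \<bar>\<delta> * x k\<bar> + \<bar>\<Sum>i\<in>-{j}. \<kappa> i * c i i k\<bar>" by linarith
      then show ?thesis using cs h(1) d0 by (simp add: abs_mult)
    qed
    \<comment> \<open>The contribution of the last index k. The extra 2 x_k^2 for k other than j is
      borrowed from the entries c_jkj and c_kjj, which equal c_jjk by symmetry.\<close>
    define L where "L k = (x k)\<^sup>2 + S k + (if k = j then 0 else 2 * (x k)\<^sup>2) - (H k)\<^sup>2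
        - (h - \<kappa> k) / h * (H k)\<^sup>2" for k
    have Lk: "L k \<ge> - 128 * M\<^sup>2" if "k \<noteq> j" for k
    proof -
      have "(\<kappa> k)\<^sup>2 \<le> B\<^sup>2" unfolding B2 using that by (intro member_le_sum) auto
      then have "\<bar>\<kappa> k\<bar> \<le> h / 100" using B0 True by (simp add: abs_le_square_iff[symmetric])
      then have phi: "(h - \<kappa> k) / h \<le> 1 + 1 / 100" using h(1) by (simp add: divide_simps)
      have "h * \<bar>s k\<bar> \<le> 2 * M * h + h / 100 * \<bar>x k\<bar> + h / 100 * r k"
      proof -
        have "M * (1 + h) \<le> M * (2 * h)" using M h(1) by (intro mult_left_mono) auto
        moreover have "\<delta> * \<bar>x k\<bar> \<le> h / 100 * \<bar>x k\<bar>" using True by (intro mult_right_mono) auto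
        moreover have "B * r k \<le> h / 100 * r k" using True r(1) by (intro mult_right_mono) auto
        ultimately show ?thesis using hs[of k] p[of k] by linarith
      qed
      also have "\<dots> = h * (2 * M + \<bar>x k\<bar> / 100 + r k / 100)" by (simp add: algebra_simps)
      finally have "\<bar>s k\<bar> \<le> 2 * M + \<bar>x k\<bar> / 100 + r k / 100" using h(1) by simp
      from transversal_third_order_bound[OF this r(1) _ phi] M
      have "3 * (x k)\<^sup>2 + S k - (H k)\<^sup>2 - (h - \<kappa> k) / h * (H k)\<^sup>2 \<ge> - 32 * (2 * M)\<^sup>2"
        by (simp add: Hk r(2))
      then show ?thesis using that by (simp add: L_def power_mult_distrib)
    qed
    \<comment> \<open>The two parts of the lower bound for q, multiplied by h, absorb 5 m^2 \<delta>
      h and 4 m^2 B^2 respectively; only 4 m |p_j| is left.\<close>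
    have Lj: "L j + h * q \<ge> - 8 * m * M * h"
    proof -
      have "L j \<ge> - 4 * m * \<bar>p j\<bar> - 5 * m\<^sup>2 * \<delta> * h - 4 * m\<^sup>2 * B\<^sup>2"
        using tangential_third_order_bound[OF hs[of j] r(1), of m] d0 True h(1) H[of j] m
        by (simp add: L_def Hk r(2) \<delta>_def)
      moreover have "4 * m * \<bar>p j\<bar> \<le> 8 * m * M * h"
      proof -
        have "M * (1 + h) \<le> M * (2 * h)" using M h(1) by (intro mult_left_mono) auto
        then have "m * \<bar>p j\<bar> \<le> m * (2 * M * h)" using m p[of j] by (intro mult_left_mono) auto
        then show ?thesis by (simp add: mult_ac)
      qed
      moreover have "5 * m\<^sup>2 * \<delta> * h \<le> h * (\<delta> * h\<^sup>2 / N\<^sup>2)"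
      proof -
        have "5 * m\<^sup>2 * N\<^sup>2 = 5 * (N\<^sup>2 * m\<^sup>2)" by simp
        also have "\<dots> \<le> h\<^sup>2" using mh Nm[of 2] Nm0[of 2] by linarith
        finally have "5 * m\<^sup>2 * N\<^sup>2 \<le> h\<^sup>2" .
        then have "5 * m\<^sup>2 \<le> h\<^sup>2 / N\<^sup>2" using N by (simp add: le_divide_eq)
        then have "(\<delta> * h) * (5 * m\<^sup>2) \<le> (\<delta> * h) * (h\<^sup>2 / N\<^sup>2)" using d0 h(1) by (intro mult_left_mono) auto
        then show ?thesis by (simp add: mult_ac)
      qed
      moreover have "4 * m\<^sup>2 * B\<^sup>2 \<le> h * (h / 4 * B\<^sup>2)"
      proof -
        have "4 * m\<^sup>2 \<le> h\<^sup>2 / 4" using mh Nm[of 0, simplified] zero_le_power2[of m] by linarith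
        then have "4 * m\<^sup>2 * B\<^sup>2 \<le> h\<^sup>2 / 4 * B\<^sup>2" by (intro mult_right_mono) auto
        then show ?thesis by (simp add: power2_eq_square mult_ac)
      qed
      moreover have "h * (\<delta> * h\<^sup>2 / N\<^sup>2 + h / 4 * B\<^sup>2) \<le> h * q" using q h(1) by (intro mult_left_mono) auto
      ultimately show ?thesis unfolding distrib_left minus_mult_left[symmetric] by linarith
    qed
    have "(\<Sum>k\<in>-{j}. L k) \<ge> (\<Sum>k\<in>-{j}. - 128 * M\<^sup>2)" using Lk by (intro sum_mono) auto
    moreover have "(\<Sum>k\<in>-{j}. - 128 * M\<^sup>2) \<ge> - 128 * N * M\<^sup>2"
    proof -
      have "card (-{j}) \<le> CARD('i)" by (intro card_mono) auto
      then have "real (card (-{j})) * M\<^sup>2 \<le> N * M\<^sup>2" by (intro mult_right_mono) (auto simp: N_def)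
      then show ?thesis by simp
    qed
    moreover have "128 * N * M\<^sup>2 \<le> 128 * N * M\<^sup>2 * h" using N M h(1) by (intro mult_left_mono[of 1 h, simplified]) auto
    ultimately have sumL: "(\<Sum>k\<in>UNIV. L k) + h * q \<ge> - (8 * m * M + 128 * N * M\<^sup>2) * h"
      using Lj split[of L] by (simp add: algebra_simps)
    have cc: "(\<Sum>k\<in>UNIV. (x k)\<^sup>2 + S k + (if k = j then 0 else 2 * (x k)\<^sup>2))
        \<le> (\<Sum>a\<in>UNIV. \<Sum>b\<in>UNIV. \<Sum>k\<in>UNIV. (c a b k)\<^sup>2)"
    proof -
      have diag: "(x k)\<^sup>2 + S k = (\<Sum>a\<in>UNIV. (c a a k)\<^sup>2)" for k by (simp add: x_def S_def split)
      have row: "(\<Sum>b\<in>UNIV. (c a b k)\<^sup>2) \<ge> (c a a k)\<^sup>2" for a k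
        by (rule member_le_sum) auto
      \<comment> \<open>The slice with last index j supplies the two borrowed copies of each x_k:
        one in column j, at (k, j), and one in row j, at (j, k).\<close>
      have row_j: "(\<Sum>a\<in>UNIV. \<Sum>b\<in>UNIV. (c a b j)\<^sup>2) \<ge> (\<Sum>a\<in>UNIV. (c a a j)\<^sup>2) + 2 * (\<Sum>k\<in>-{j}. (x k)\<^sup>2)"
      proof -
        have "(\<Sum>b\<in>UNIV. (c a b j)\<^sup>2) \<ge> (c a a j)\<^sup>2 + (x a)\<^sup>2" if "a \<noteq> j" for a
        proof -
          have "(\<Sum>b\<in>{a, j}. (c a b j)\<^sup>2) \<le> (\<Sum>b\<in>UNIV. (c a b j)\<^sup>2)" by (rule sum_mono2) auto
          moreover have "c a j j = x a" using sym(1)[of j a j] sym(2)[of a j j] by (simp add: x_def)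
          ultimately show ?thesis using that by simp
        qed
        then have "(\<Sum>a\<in>-{j}. (c a a j)\<^sup>2 + (x a)\<^sup>2) \<le> (\<Sum>a\<in>-{j}. \<Sum>b\<in>UNIV. (c a b j)\<^sup>2)"
          by (intro sum_mono) auto
        moreover have "(\<Sum>b\<in>UNIV. (c j b j)\<^sup>2) = (c j j j)\<^sup>2 + (\<Sum>b\<in>-{j}. (x b)\<^sup>2)"
        proof -
          have "c j b j = x b" for b using sym(1)[of j b j] by (simp add: x_def)
          then show ?thesis by (simp add: split)
        qed
        ultimately show ?thesis by (simp add: split sum.distrib)
      qed
      have "(\<Sum>k\<in>UNIV. (x k)\<^sup>2 + S k + (if k = j then 0 else 2 * (x k)\<^sup>2))
          = (\<Sum>a\<in>UNIV. (c a a j)\<^sup>2) + 2 * (\<Sum>k\<in>-{j}. (x k)\<^sup>2) + (\<Sum>k\<in>-{j}. \<Sum>a\<in>UNIV. (c a a k)\<^sup>2)"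
      proof -
        have "(\<Sum>k\<in>-{j}. (x k)\<^sup>2 + S k + (if k = j then 0 else 2 * (x k)\<^sup>2))
            = (\<Sum>k\<in>-{j}. (\<Sum>a\<in>UNIV. (c a a k)\<^sup>2) + 2 * (x k)\<^sup>2)"
          by (intro sum.cong) (auto simp: diag)
        then show ?thesis
          by (simp only: split[of "\<lambda>k. (x k)\<^sup>2 + S k + (if k = j then 0 else 2 * (x k)\<^sup>2)"])
            (simp add: diag sum.distrib sum_distrib_left)
      qed
      also have "\<dots> \<le> (\<Sum>a\<in>UNIV. \<Sum>b\<in>UNIV. (c a b j)\<^sup>2) + (\<Sum>k\<in>-{j}. \<Sum>a\<in>UNIV. \<Sum>b\<in>UNIV. (c a b k)\<^sup>2)"
        using row row_j by (intro add_mono sum_mono) auto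
      also have "\<dots> = (\<Sum>k\<in>UNIV. \<Sum>a\<in>UNIV. \<Sum>b\<in>UNIV. (c a b k)\<^sup>2)"
        by (rule split[symmetric])
      also have "\<dots> = (\<Sum>a\<in>UNIV. \<Sum>b\<in>UNIV. \<Sum>k\<in>UNIV. (c a b k)\<^sup>2)"
        by (subst sum.swap, rule sum.cong[OF refl], rule sum.swap)
      finally show ?thesis .
    qed
    have "(\<Sum>k\<in>UNIV. L k) = (\<Sum>k\<in>UNIV. (x k)\<^sup>2 + S k + (if k = j then 0 else 2 * (x k)\<^sup>2))
        - (\<Sum>k\<in>UNIV. (H k)\<^sup>2) - (\<Sum>k\<in>UNIV. (h - \<kappa> k) * (H k)\<^sup>2) / h"
      unfolding L_def by (simp add: sum_subtractf sum_divide_distrib)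
    then show ?thesis using sumL cc by (simp add: q_def)
  qed
qed


section \<open>Derivatives of a composition at a maximum point\<close>

lemma partial_compose:
  fixes c :: "'a::euclidean_space \<Rightarrow> 'b::euclidean_space" and \<psi> :: "'b \<Rightarrow> real"
  assumes c: "\<And>b. b \<in> Basis \<Longrightarrow> (\<lambda>y. c y \<bullet> b) differentiable (at x)" and \<psi>: "\<psi> differentiable (at (c x))"
  shows "(\<lambda>y. \<psi> (c y)) differentiable (at x)"
    and "partial v (\<lambda>y. \<psi> (c y)) x = (\<Sum>b\<in>Basis. partial v (\<lambda>y. c y \<bullet> b) x * partial b \<psi> (c x))"
proof -
  define c' where "c' v = (\<Sum>b\<in>Basis. partial v (\<lambda>y. c y \<bullet> b) x *\<^sub>R b)" for v
  have "(c has_derivative c') (at x)"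
    by (subst has_derivative_componentwise_within)
      (auto simp: c'_def inner_sum_left inner_Basis if_distrib[where f="\<lambda>u. _ * u"] cong: if_cong
        intro!: partial_has_derivative c)
  from has_derivative_compose[OF this partial_has_derivative[OF \<psi>]]
  have *: "((\<lambda>y. \<psi> (c y)) has_derivative (\<lambda>v. partial (c' v) \<psi> (c x))) (at x)" .
  then show "(\<lambda>y. \<psi> (c y)) differentiable (at x)" unfolding differentiable_def by blast
  have "partial v (\<lambda>y. \<psi> (c y)) x = partial (c' v) \<psi> (c x)" by (rule partial_eqI[OF *])
  then show "partial v (\<lambda>y. \<psi> (c y)) x = (\<Sum>b\<in>Basis. partial v (\<lambda>y. c y \<bullet> b) x * partial b \<psi> (c x))"
    unfolding c'_def linear_sum[OF linear_partial[OF \<psi>]] linear_cmul[OF linear_partial[OF \<psi>]] by simp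
qed

lemma partial2_compose:
  fixes c :: "'a::euclidean_space \<Rightarrow> 'b::euclidean_space" and \<psi> :: "'b \<Rightarrow> real"
  assumes S: "open S" "x \<in> S" and c: "\<And>b. b \<in> Basis \<Longrightarrow> diff_upto 2 S (\<lambda>y. c y \<bullet> b)"
    and T: "\<And>y. y \<in> S \<Longrightarrow> c y \<in> T" and \<psi>: "diff_upto 2 T \<psi>"
  shows "partial w (partial v (\<lambda>y. \<psi> (c y))) x = (\<Sum>b\<in>Basis.
    partial v (\<lambda>y. c y \<bullet> b) x * (\<Sum>d\<in>Basis. partial w (\<lambda>y. c y \<bullet> d) x * partial d (partial b \<psi>) (c x))
    + partial w (partial v (\<lambda>y. c y \<bullet> b)) x * partial b \<psi> (c x))"
proof -
  have dc: "(\<lambda>y. c y \<bullet> b) differentiable (at y)" "partial v (\<lambda>y. c y \<bullet> b) differentiable (at y)"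
    if "y \<in> S" "b \<in> Basis" for y b v
    using c[OF that(2)] that(1) by (auto simp: eval_nat_numeral)
  have d\<psi>: "\<psi> differentiable (at (c y))" "partial b \<psi> differentiable (at (c y))" if "y \<in> S" for y b
    using \<psi> T[OF that] by (auto simp: eval_nat_numeral)
  have "partial w (partial v (\<lambda>y. \<psi> (c y))) x
      = partial w (\<lambda>y. \<Sum>b\<in>Basis. partial v (\<lambda>y. c y \<bullet> b) y * partial b \<psi> (c y)) x"
    by (rule partial_cong_open[OF S]) (rule partial_compose(2)[OF dc(1) d\<psi>(1)])
  also have "\<dots> = (\<Sum>b\<in>Basis. partial w (\<lambda>y. partial v (\<lambda>y. c y \<bullet> b) y * partial b \<psi> (c y)) x)"
  proof (rule partial_sum)
    fix b :: 'b assume b: "b \<in> Basis"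
    show "(\<lambda>y. partial v (\<lambda>y. c y \<bullet> b) y * partial b \<psi> (c y)) differentiable (at x)"
      by (rule differentiable_mult[OF dc(2)[OF S(2) b] partial_compose(1)[OF dc(1)[OF S(2)] d\<psi>(2)[OF S(2)]]])
  qed
  also have "\<dots> = (\<Sum>b\<in>Basis.
    partial v (\<lambda>y. c y \<bullet> b) x * (\<Sum>d\<in>Basis. partial w (\<lambda>y. c y \<bullet> d) x * partial d (partial b \<psi>) (c x))
    + partial w (partial v (\<lambda>y. c y \<bullet> b)) x * partial b \<psi> (c x))"
  proof (intro sum.cong refl)
    fix b :: 'b assume b: "b \<in> Basis"
    have "partial w (\<lambda>y. partial b \<psi> (c y)) x = (\<Sum>d\<in>Basis. partial w (\<lambda>y. c y \<bullet> d) x * partial d (partial b \<psi>) (c x))"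
      by (rule partial_compose(2)[OF dc(1)[OF S(2)] d\<psi>(2)[OF S(2)]])
    moreover have "(\<lambda>y. partial b \<psi> (c y)) differentiable (at x)"
      by (rule partial_compose(1)[OF dc(1)[OF S(2)] d\<psi>(2)[OF S(2)]])
    ultimately show "partial w (\<lambda>y. partial v (\<lambda>y. c y \<bullet> b) y * partial b \<psi> (c y)) x =
      partial v (\<lambda>y. c y \<bullet> b) x * (\<Sum>d\<in>Basis. partial w (\<lambda>y. c y \<bullet> d) x * partial d (partial b \<psi>) (c x))
      + partial w (partial v (\<lambda>y. c y \<bullet> b)) x * partial b \<psi> (c x)"
      using partial_mult[OF dc(2)[OF S(2) b]] by simp
  qed
  finally show ?thesis .
qed

text \<open>First derivatives of c are bounded one by one, second derivatives only after summation
  over the frame. For c(y) = (y, u, Du) the latter include third derivatives of u, of which only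
  this trace is controlled.\<close>

lemma compose_derivative_bounds:
  fixes c :: "'a::euclidean_space \<Rightarrow> 'b::euclidean_space" and \<psi> :: "'b \<Rightarrow> real" and e :: "'i::finite \<Rightarrow> 'a"
  assumes S: "open S" "x \<in> S" and c: "\<And>b. b \<in> Basis \<Longrightarrow> diff_upto 2 S (\<lambda>y. c y \<bullet> b)"
    and T: "\<And>y. y \<in> S \<Longrightarrow> c y \<in> T" and \<psi>: "diff_upto 2 T \<psi>"
    and M1: "\<And>b. b \<in> Basis \<Longrightarrow> \<bar>partial b \<psi> (c x)\<bar> \<le> M"
    and M2: "\<And>b d. b \<in> Basis \<Longrightarrow> d \<in> Basis \<Longrightarrow> \<bar>partial d (partial b \<psi>) (c x)\<bar> \<le> M"
    and \<alpha>: "\<And>b k. b \<in> Basis \<Longrightarrow> \<bar>partial (e k) (\<lambda>y. c y \<bullet> b) x\<bar> \<le> \<alpha>"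
    and \<beta>: "\<And>b. b \<in> Basis \<Longrightarrow> \<bar>\<Sum>k\<in>UNIV. partial (e k) (partial (e k) (\<lambda>y. c y \<bullet> b)) x\<bar> \<le> \<beta>"
  shows "\<bar>partial (e k) (\<lambda>y. \<psi> (c y)) x\<bar> \<le> real DIM('b) * (\<alpha> * M)"
    and "(\<Sum>k\<in>UNIV. partial (e k) (partial (e k) (\<lambda>y. \<psi> (c y))) x)
      \<ge> - real DIM('b) * (\<beta> * M) - real CARD('i) * (real DIM('b))\<^sup>2 * (\<alpha>\<^sup>2 * M)"
proof -
  obtain b0 :: 'b where b0: "b0 \<in> Basis" using nonempty_Basis by blast
  have nn: "0 \<le> M" "0 \<le> \<alpha>" "0 \<le> \<beta>" using M1[OF b0] \<alpha>[OF b0, of undefined] \<beta>[OF b0] by linarith+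
  have dc: "(\<lambda>y. c y \<bullet> b) differentiable (at x)" if "b \<in> Basis" for b
    using c[OF that] S(2) by (auto simp: eval_nat_numeral)
  have d\<psi>: "\<psi> differentiable (at (c x))" using \<psi> T[OF S(2)] by (auto simp: eval_nat_numeral)
  show "\<bar>partial (e k) (\<lambda>y. \<psi> (c y)) x\<bar> \<le> real DIM('b) * (\<alpha> * M)"
  proof -
    have "partial (e k) (\<lambda>y. \<psi> (c y)) x = (\<Sum>b\<in>Basis. partial (e k) (\<lambda>y. c y \<bullet> b) x * partial b \<psi> (c x))"
      by (rule partial_compose(2)[OF dc d\<psi>])
    also have "\<bar>\<dots>\<bar> \<le> real DIM('b) * (\<alpha> * M)"
      by (rule order_trans[OF sum_abs], rule sum_bounded_above)
        (auto simp: abs_mult intro!: mult_mono M1 \<alpha> nn)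
    finally show ?thesis .
  qed
  define F where "F k b d = partial (e k) (\<lambda>y. c y \<bullet> b) x * (partial (e k) (\<lambda>y. c y \<bullet> d) x * partial d (partial b \<psi>) (c x))" for k b d
  have F: "\<bar>F k b d\<bar> \<le> \<alpha>\<^sup>2 * M" if "b \<in> Basis" "d \<in> Basis" for k b d
  proof -
    have "\<bar>F k b d\<bar> \<le> \<alpha> * (\<alpha> * M)" unfolding F_def abs_mult
      using that by (intro mult_mono \<alpha> M2 nn mult_nonneg_nonneg) auto
    then show ?thesis by (simp add: power2_eq_square)
  qed
  have "(\<Sum>k\<in>UNIV. partial (e k) (partial (e k) (\<lambda>y. \<psi> (c y))) x) =
     (\<Sum>k\<in>UNIV. \<Sum>b\<in>Basis. \<Sum>d\<in>Basis. F k b d)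
     + (\<Sum>b\<in>Basis. (\<Sum>k\<in>UNIV. partial (e k) (partial (e k) (\<lambda>y. c y \<bullet> b)) x) * partial b \<psi> (c x))"
  proof -
    have "(\<Sum>b\<in>Basis. (\<Sum>k\<in>UNIV. partial (e k) (partial (e k) (\<lambda>y. c y \<bullet> b)) x) * partial b \<psi> (c x))
      = (\<Sum>k\<in>UNIV. \<Sum>b\<in>Basis. partial (e k) (partial (e k) (\<lambda>y. c y \<bullet> b)) x * partial b \<psi> (c x))"
      unfolding sum_distrib_right by (rule sum.swap)
    then show ?thesis
      by (simp add: partial2_compose[OF S c T \<psi>] F_def sum.distrib sum_distrib_left)
  qed
  moreover have "\<bar>\<Sum>k\<in>UNIV. \<Sum>b\<in>Basis. \<Sum>d\<in>Basis. F k b d\<bar> \<le> real CARD('i) * (real DIM('b) * (real DIM('b) * (\<alpha>\<^sup>2 * M)))"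
  proof -
    have "\<bar>\<Sum>d\<in>Basis. F k b d\<bar> \<le> real DIM('b) * (\<alpha>\<^sup>2 * M)" if "b \<in> Basis" for k b
      by (rule order_trans[OF sum_abs], rule sum_bounded_above, rule F[OF that])
    then have "\<bar>\<Sum>b\<in>Basis. \<Sum>d\<in>Basis. F k b d\<bar> \<le> real DIM('b) * (real DIM('b) * (\<alpha>\<^sup>2 * M))" for k
      by (rule order_trans[OF sum_abs, OF sum_bounded_above])
    then show ?thesis by (rule order_trans[OF sum_abs, OF sum_bounded_above])
  qed
  moreover have "\<bar>\<Sum>b\<in>Basis. (\<Sum>k\<in>UNIV. partial (e k) (partial (e k) (\<lambda>y. c y \<bullet> b)) x) * partial b \<psi> (c x)\<bar>
      \<le> real DIM('b) * (\<beta> * M)"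
    by (rule order_trans[OF sum_abs], rule sum_bounded_above)
      (auto simp: abs_mult intro!: mult_mono M1 \<beta> nn)
  ultimately show "(\<Sum>k\<in>UNIV. partial (e k) (partial (e k) (\<lambda>y. \<psi> (c y))) x)
      \<ge> - real DIM('b) * (\<beta> * M) - real CARD('i) * (real DIM('b))\<^sup>2 * (\<alpha>\<^sup>2 * M)"
    by (simp add: power2_eq_square mult.assoc)
qed

text \<open>The conditions at a maximum of log H + c |x|^2 / 2, obtained from the product H exp(c
  |x|^2 / 2). The product form is meaningful without positivity of H away from x.\<close>

lemma weighted_max_derivatives:
  fixes H :: "'a::euclidean_space \<Rightarrow> real"
  assumes S: "open S" "x \<in> S" and H: "diff_upto 2 S H" "0 < H x"
    and max: "\<And>y. y \<in> S \<Longrightarrow> H y * exp (c / 2 * (y \<bullet> y)) \<le> H x * exp (c / 2 * (x \<bullet> x))"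
  shows "partial v H x = - c * (x \<bullet> v) * H x"
    and "partial v (partial v H) x \<le> (partial v H x)\<^sup>2 / H x - c * H x * (v \<bullet> v)"
proof -
  define s where "s y = c / 2 * (y \<bullet> y)" for y :: 'a
  define E where "E y = exp (s y)" for y
  have ds: "s differentiable (at y)" "partial w s y = c * (y \<bullet> w)" for y w
  proof -
    have "(s has_derivative (\<lambda>w. c * (y \<bullet> w))) (at y)"
      unfolding s_def by (auto intro!: derivative_eq_intros simp: inner_commute algebra_simps)
    then show "s differentiable (at y)" "partial w s y = c * (y \<bullet> w)"
      unfolding differentiable_def by (auto intro: partial_eqI)
  qed
  have ps: "partial w s = (\<lambda>y. c * (y \<bullet> w))" for w using ds(2) by blast
  have ts: "diff_upto 2 S s"
    using diff_upto_mult[OF S(1) diff_upto_const[of 1 S c] diff_upto_inner[of 1 S]]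
    by (simp add: eval_nat_numeral ds(1) ps)
  have tE: "diff_upto 2 S E"
    unfolding E_def[abs_def] by (rule diff_upto_exp[OF S(1) ts])
  have pE: "partial w E = (\<lambda>y. E y * (c * (y \<bullet> w)))" for w
    unfolding E_def[abs_def] using partial_exp(2)[OF ds(1)] by (auto simp: ps)
  have dE: "E differentiable (at x)" by (rule diff_uptoD[OF tE _ S(2)]) simp
  have pcy: "partial w (\<lambda>y. c * (y \<bullet> w)) x = c * (w \<bullet> w)" for w
    by (rule partial_eqI) (auto intro!: derivative_eq_intros)
  have ppE: "partial w (partial w E) x = E x * ((c * (x \<bullet> w))\<^sup>2 + c * (w \<bullet> w))" for w
  proof -
    have "(\<lambda>y. c * (y \<bullet> w)) differentiable (at x)" by (auto intro!: derivative_intros)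
    then show ?thesis unfolding pE[of w]
      by (simp add: partial_mult dE pcy) (simp add: pE power2_eq_square algebra_simps)
  qed
  have E0: "0 < E x" by (simp add: E_def)
  have tG: "diff_upto 2 S (\<lambda>y. H y * E y)"
    by (rule diff_upto_mult[OF S(1) H(1) tE])
  have mG: "H y * E y \<le> H x * E x" if "y \<in> S" for y using max[OF that] by (simp add: E_def s_def)
  have dH: "H differentiable (at x)" by (rule diff_uptoD[OF H(1) _ S(2)]) simp
  have "partial v (\<lambda>y. H y * E y) x = 0"
    by (rule interior_max_partial[OF S diff_uptoD[OF tG _ S(2)] mG]) simp_all
  then have "(H x * (c * (x \<bullet> v)) + partial v H x) * E x = 0"
    by (simp add: partial_mult dH dE pE algebra_simps)
  then have "partial v H x = - (H x * (c * (x \<bullet> v)))" using E0 by (auto simp: add_eq_0_iff)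
  then show Hv: "partial v H x = - c * (x \<bullet> v) * H x" by (simp add: mult_ac)
  have "partial v (partial v (\<lambda>y. H y * E y)) x \<le> 0"
    by (rule interior_max_second_partial[OF S tG mG])
  then have "(H x * ((c * (x \<bullet> v))\<^sup>2 + c * (v \<bullet> v)) + 2 * partial v H x * (c * (x \<bullet> v))
      + partial v (partial v H) x) * E x \<le> 0"
    by (simp add: partial2_mult[OF S H(1) tE] ppE) (simp add: pE algebra_simps)
  then have "H x * ((c * (x \<bullet> v))\<^sup>2 + c * (v \<bullet> v)) + 2 * partial v H x * (c * (x \<bullet> v))
      + partial v (partial v H) x \<le> 0"
    using E0 by (simp add: mult_le_0_iff)
  moreover have "(partial v H x)\<^sup>2 / H x = H x * (c * (x \<bullet> v))\<^sup>2"
    using H(2) by (simp add: Hv power2_eq_square)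
  ultimately show "partial v (partial v H) x \<le> (partial v H x)\<^sup>2 / H x - c * H x * (v \<bullet> v)"
    by (simp add: Hv power2_eq_square algebra_simps)
qed


section \<open>The geometry of a graph\<close>

text \<open>Pointwise derivatives for use at interior points. \<open>Grad\<close> and
  \<open>Hess\<close> are defined as continuous extensions and agree with these inside the domain
  for functions of class C^2 up to the boundary.\<close>

definition gradient :: "(real^'n \<Rightarrow> real) \<Rightarrow> real^'n \<Rightarrow> real^'n"
  where "gradient u y = (\<chi> i. partial (axis i 1) u y)"

definition hessian :: "(real^'n \<Rightarrow> real) \<Rightarrow> real^'n \<Rightarrow> real^'n^'n"
  where "hessian u y = (\<chi> i j. partial (axis i 1) (partial (axis j 1) u) y)"

definition slope_factor :: "(real^'n \<Rightarrow> real) \<Rightarrow> real^'n \<Rightarrow> real"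
  where "slope_factor u y = inverse (sqrt (1 - (norm (gradient u y))\<^sup>2))"

text \<open>The horizontal part of the timelike unit normal (Du, 1) / w of the graph.\<close>

definition normal :: "(real^'n \<Rightarrow> real) \<Rightarrow> real^'n \<Rightarrow> real^'n"
  where "normal u y = slope_factor u y *\<^sub>R gradient u y"

definition shape :: "(real^'n \<Rightarrow> real) \<Rightarrow> real^'n \<Rightarrow> real^'n^'n"
  where "shape u y = graph_shape (gradient u y) (hessian u y)"

lemma partial_axes:
  fixes f :: "real^'n \<Rightarrow> real"
  assumes "f differentiable (at y)"
  shows "partial w f y = (\<Sum>i\<in>UNIV. w $ i * partial (axis i 1) f y)"
proof -
  have "partial w f y = partial (\<Sum>i\<in>UNIV. w $ i *\<^sub>R axis i 1) f y"
    using basis_expansion[of w] by (simp add: scalar_mult_eq_scaleR)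
  then show ?thesis
    unfolding linear_sum[OF linear_partial[OF assms]] linear_cmul[OF linear_partial[OF assms]] by simp
qed

lemma partial_eq_gradient: "f differentiable (at y) \<Longrightarrow> partial w f y = gradient f y \<bullet> w"
  by (subst partial_axes) (simp_all add: gradient_def inner_vec_def mult.commute)

lemma norm_gradient_sq: "(norm (gradient u y))\<^sup>2 = (\<Sum>i\<in>UNIV. partial (axis i 1) u y * partial (axis i 1) u y)"
  by (simp add: power2_norm_eq_inner inner_vec_def gradient_def)

lemma partial2_axes:
  fixes f :: "real^'n \<Rightarrow> real"
  assumes S: "open S" "y \<in> S" and f: "diff_upto 2 S f"
  shows "partial w (partial v f) y = v \<bullet> (hessian f y *v w)"
proof -
  have d: "f differentiable (at z)" "partial u f differentiable (at z)" if "z \<in> S" for z u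
    using f that by (auto simp: eval_nat_numeral)
  have "partial w (partial v f) y = partial w (\<lambda>z. \<Sum>i\<in>UNIV. v $ i * partial (axis i 1) f z) y"
    by (rule partial_cong_open[OF S]) (rule partial_axes[OF d(1)])
  also have "\<dots> = (\<Sum>i\<in>UNIV. v $ i * partial w (partial (axis i 1) f) y)"
    using d[OF S(2)] by (simp add: partial_sum partial_mult)
  also have "\<dots> = (\<Sum>i\<in>UNIV. v $ i * (\<Sum>j\<in>UNIV. partial (axis i 1) (partial (axis j 1) f) y * w $ j))"
  proof (intro sum.cong refl arg_cong2[where f="(*)"])
    fix i :: 'n
    have "partial w (partial (axis i 1) f) y = (\<Sum>j\<in>UNIV. w $ j * partial (axis j 1) (partial (axis i 1) f) y)"
      by (rule partial_axes[OF d(2)[OF S(2)]])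
    then show "partial w (partial (axis i 1) f) y = (\<Sum>j\<in>UNIV. partial (axis i 1) (partial (axis j 1) f) y * w $ j)"
      by (simp add: partial_commute[OF S f, of "axis i 1"] mult.commute)
  qed
  finally show ?thesis by (simp add: inner_vec_def matrix_vector_mult_def hessian_def)
qed

lemma partial_gradient_component:
  assumes S: "open S" "y \<in> S" and f: "diff_upto 2 S f"
  shows "partial w (partial (axis i 1) f) y = (hessian f y *v w) $ i"
  by (simp add: partial2_axes[OF assms] inner_axis' inner_commute[of "axis i 1"] inner_axis)

lemma transpose_hessian:
  assumes S: "open S" "y \<in> S" and f: "diff_upto 2 S f"
  shows "transpose (hessian f y) = hessian f y"
  using partial_commute[OF assms] by (simp add: vec_eq_iff transpose_def hessian_def)

lemma slope_factor_derivative: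
  assumes S: "open S" and u: "diff_upto (Suc k) S u" and g: "\<forall>y\<in>S. norm (gradient u y) < 1"
  shows "diff_upto k S (slope_factor u)"
    and "0 < k \<Longrightarrow> y \<in> S \<Longrightarrow> partial w (slope_factor u) y = (slope_factor u y)^3 * (gradient u y \<bullet> (hessian u y *v w))"
proof -
  define f where "f y = 1 - (\<Sum>i\<in>UNIV. partial (axis i 1) u y * partial (axis i 1) u y)" for y
  have tu: "diff_upto k S (partial v u)" for v using u by simp
  have tf: "diff_upto k S f"
    unfolding f_def[abs_def]
    by (intro diff_upto_diff[OF S] diff_upto_sum[OF S] diff_upto_mult[OF S] tu) simp_all
  have f: "0 < f y" if "y \<in> S" for y
    using g that by (simp add: f_def norm_gradient_sq[symmetric] abs_square_less_1)
  have v: "slope_factor u = (\<lambda>y. inverse (sqrt (f y)))"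
    by (simp add: slope_factor_def fun_eq_iff f_def norm_gradient_sq)
  show "diff_upto k S (slope_factor u)"
    unfolding v by (rule diff_upto_inverse_sqrt[OF S f tf])
  assume k: "0 < k" and y: "y \<in> S"
  have u2: "diff_upto 2 S u" by (rule diff_upto_mono[OF u]) (use k in simp)
  have du: "partial v u differentiable (at y)" for v by (rule diff_uptoD[OF tu k y])
  have "partial w f y = - 2 * (gradient u y \<bullet> (hessian u y *v w))"
    unfolding f_def[abs_def]
    by (simp add: partial_diff partial_sum partial_mult differentiable_mult differentiable_sum du
        partial_gradient_component[OF S y u2] inner_vec_def gradient_def sum.distrib sum_distrib_left sum_negf[symmetric] mult.commute)
  then show "partial w (slope_factor u) y = (slope_factor u y)^3 * (gradient u y \<bullet> (hessian u y *v w))"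
    using partial_inverse_sqrt(2)[OF diff_uptoD[OF tf k y] f[OF y], of w] by (simp add: v)
qed

text \<open>With p = Du and U = D^2 u, D(v p) = v U + v^3 p p^T U = v (I + \<nu>\<nu>^T) U. Since
  the shape matrix is thus a Jacobian, its derivatives in constant directions commute.\<close>

lemma normal_derivative:
  assumes S: "open S" and u: "diff_upto (Suc k) S u" and g: "\<forall>y\<in>S. norm (gradient u y) < 1"
  shows "diff_upto k S (\<lambda>y. normal u y $ i)"
    and "0 < k \<Longrightarrow> y \<in> S \<Longrightarrow> partial w (\<lambda>y. normal u y $ i) y = (shape u y *v w) $ i"
proof -
  note v = slope_factor_derivative[OF S u g]
  have tu: "diff_upto k S (partial (axis i 1) u)" using u by simp
  have n: "(\<lambda>y. normal u y $ i) = (\<lambda>y. slope_factor u y * partial (axis i 1) u y)"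
    by (simp add: normal_def gradient_def)
  show "diff_upto k S (\<lambda>y. normal u y $ i)"
    unfolding n by (intro diff_upto_mult[OF S] v(1) tu)
  assume k: "0 < k" and y: "y \<in> S"
  have u2: "diff_upto 2 S u" by (rule diff_upto_mono[OF u]) (use k in simp)
  have "partial w (\<lambda>y. normal u y $ i) y = slope_factor u y * (hessian u y *v w) $ i
      + (slope_factor u y)^3 * (gradient u y \<bullet> (hessian u y *v w)) * gradient u y $ i"
    unfolding n using diff_uptoD[OF v(1) k y] diff_uptoD[OF tu k y]
    by (simp add: partial_mult v(2)[OF k y] partial_gradient_component[OF S y u2]) (simp add: gradient_def)
  then show "partial w (\<lambda>y. normal u y $ i) y = (shape u y *v w) $ i"
    by (simp add: shape_def graph_shape_mult_vec Let_def slope_factor_def[symmetric] power3_eq_cube algebra_simps)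
qed

lemma trace_graph_shape:
  defines "n \<equiv> \<lambda>p::real^'n. inverse (sqrt (1 - (norm p)\<^sup>2)) *\<^sub>R p"
  shows "trace (graph_shape p U) = inverse (sqrt (1 - (norm p)\<^sup>2)) *
    (\<Sum>j\<in>UNIV. \<Sum>l\<in>UNIV. ((if j = l then 1 else 0) + n p $ j * n p $ l) * U $ l $ j)"
  by (simp add: graph_shape_def n_def Let_def trace_def matrix_matrix_mult_def mat_def outer_def sum_distrib_left)

text \<open>The sum of the e_k e_k^T is the inverse metric, so the frame Laplacian is the trace of
  the Hessian with respect to that metric.\<close>

lemma sum_frame_second_partials:
  fixes e :: "'k::finite \<Rightarrow> real^'n"
  assumes S: "open S" "y \<in> S" and f: "diff_upto 2 S f"
    and e: "\<And>x z. (\<Sum>k\<in>UNIV. (e k \<bullet> x) * (e k \<bullet> z)) = x \<bullet> z + (\<nu> \<bullet> x) * (\<nu> \<bullet> z)"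
  shows "(\<Sum>k\<in>UNIV. partial (e k) (partial (e k) f) y)
    = (\<Sum>j\<in>UNIV. \<Sum>l\<in>UNIV. ((if j = l then 1 else 0) + \<nu> $ j * \<nu> $ l) * hessian f y $ l $ j)"
proof -
  have "(\<Sum>k\<in>UNIV. partial (e k) (partial (e k) f) y)
      = (\<Sum>k\<in>UNIV. \<Sum>l\<in>UNIV. \<Sum>j\<in>UNIV. ((e k \<bullet> axis j 1) * (e k \<bullet> axis l 1)) * hessian f y $ l $ j)"
  proof (rule sum.cong[OF refl])
    fix k
    have "e k \<bullet> (hessian f y *v e k) = (\<Sum>l\<in>UNIV. \<Sum>j\<in>UNIV. (e k $ j * e k $ l) * hessian f y $ l $ j)"
      by (simp add: inner_vec_def matrix_vector_mult_def sum_distrib_left mult_ac)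
    then show "partial (e k) (partial (e k) f) y
        = (\<Sum>l\<in>UNIV. \<Sum>j\<in>UNIV. ((e k \<bullet> axis j 1) * (e k \<bullet> axis l 1)) * hessian f y $ l $ j)"
      by (simp add: partial2_axes[OF S f] inner_axis)
  qed
  also have "\<dots> = (\<Sum>l\<in>UNIV. \<Sum>j\<in>UNIV. (\<Sum>k\<in>UNIV. (e k \<bullet> axis j 1) * (e k \<bullet> axis l 1)) * hessian f y $ l $ j)"
    unfolding sum_distrib_right by (subst sum.swap, rule sum.cong[OF refl], rule sum.swap)
  also have "\<dots> = (\<Sum>l\<in>UNIV. \<Sum>j\<in>UNIV. ((if j = l then 1 else 0) + \<nu> $ j * \<nu> $ l) * hessian f y $ l $ j)"
  proof -
    have "axis j (1::real) $ l = (if j = l then 1 else 0)" for j l :: 'n by (simp add: axis_def)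
    then show ?thesis unfolding e by (simp add: inner_axis)
  qed
  also have "\<dots> = (\<Sum>j\<in>UNIV. \<Sum>l\<in>UNIV. ((if j = l then 1 else 0) + \<nu> $ j * \<nu> $ l) * hessian f y $ l $ j)"
    by (rule sum.swap)
  finally show ?thesis .
qed

text \<open>H is v times the trace of D^2 u with respect to the inverse metric. Differentiating this
  product and solving for the term with third derivatives of u expresses it by DH and by products of
  second derivatives.\<close>

lemma frame_laplacian_gradient:
  fixes e :: "'k::finite \<Rightarrow> real^'n" and i :: 'n
  assumes S: "open S" "x \<in> S" and u: "diff_upto 3 S u" and g: "\<forall>y\<in>S. norm (gradient u y) < 1"
    and e: "\<And>y z. (\<Sum>k\<in>UNIV. (e k \<bullet> y) * (e k \<bullet> z)) = y \<bullet> z + (normal u x \<bullet> y) * (normal u x \<bullet> z)"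
  defines "w \<equiv> axis i (1::real)"
  shows "(\<Sum>k\<in>UNIV. partial (e k) (partial (e k) (partial w u)) x) =
     partial w (\<lambda>y. trace (shape u y)) x / slope_factor u x
     - slope_factor u x * (gradient u x \<bullet> (hessian u x *v w)) * trace (shape u x)
     - 2 * ((shape u x *v w) \<bullet> (hessian u x *v normal u x))"
proof -
  have u3: "diff_upto (Suc 2) S u" using u by (simp add: eval_nat_numeral)
  have u2: "diff_upto 2 S u" by (rule diff_upto_mono[OF u]) simp
  have tu: "diff_upto 2 S (partial v u)" for v by (rule diff_upto_partial[OF u3])
  have dU: "partial a (partial b u) differentiable (at x)" for a b
    using diff_uptoD[OF diff_upto_partial, of 1 S _ x] tu[of b] S(2)
    by (simp add: eval_nat_numeral)
  note v = slope_factor_derivative[OF S(1) u3 g]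
  note n = normal_derivative[OF S(1) u3 g]
  have dv: "slope_factor u differentiable (at x)" by (rule diff_uptoD[OF v(1) _ S(2)]) simp
  have dn: "(\<lambda>y. normal u y $ j) differentiable (at x)" for j by (rule diff_uptoD[OF n(1) _ S(2)]) simp
  define V where "V = slope_factor u x"
  define N where "N = normal u x"
  define U where "U = hessian u x"
  define A where "A = shape u x"
  have V0: "0 < V" using g S(2) by (simp add: V_def slope_factor_def abs_square_less_1)
  define Q where "Q y = (\<Sum>j\<in>UNIV. \<Sum>l\<in>UNIV. ((if j = l then 1 else 0) + normal u y $ j * normal u y $ l)
      * partial (axis l 1) (partial (axis j 1) u) y)" for y
  have H: "(\<lambda>y. trace (shape u y)) = (\<lambda>y. slope_factor u y * Q y)"
    by (simp add: fun_eq_iff shape_def trace_graph_shape Q_def normal_def slope_factor_def hessian_def)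
  have swap3: "partial w (partial (axis l 1) (partial (axis j 1) u)) x = hessian (partial w u) x $ l $ j" for j l
  proof -
    have "partial w (partial (axis l 1) (partial (axis j 1) u)) x
        = partial (axis l 1) (partial w (partial (axis j 1) u)) x"
      by (rule partial_commute[OF S tu])
    also have "\<dots> = partial (axis l 1) (partial (axis j 1) (partial w u)) x"
      by (rule partial_cong_open[OF S]) (rule partial_commute[OF S(1) _ u2])
    finally show ?thesis by (simp add: hessian_def)
  qed
  have symU: "U $ l $ j = U $ j $ l" for j l
    using transpose_hessian[OF S u2] by (metis U_def transpose_def vec_lambda_beta)
  have dQ: "Q differentiable (at x)"
    unfolding Q_def[abs_def]
    by (intro differentiable_sum allI ballI impI differentiable_mult differentiable_add differentiable_const dn dU) simp_all
  have pQ: "partial w Q x = (\<Sum>k\<in>UNIV. partial (e k) (partial (e k) (partial w u)) x) + 2 * ((A *v w) \<bullet> (U *v N))"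
  proof -
    have "partial w Q x = (\<Sum>j\<in>UNIV. \<Sum>l\<in>UNIV. ((if j = l then 1 else 0) + N $ j * N $ l) * hessian (partial w u) x $ l $ j
        + (N $ j * (A *v w) $ l + (A *v w) $ j * N $ l) * U $ l $ j)"
      unfolding Q_def[abs_def]
      by (simp add: partial_sum partial_mult partial_add differentiable_mult differentiable_add differentiable_sum
          dn dU n(2)[OF _ S(2)] swap3 N_def A_def U_def hessian_def[of u])
    moreover have "(\<Sum>j\<in>UNIV. \<Sum>l\<in>UNIV. (A *v w) $ j * N $ l * U $ l $ j) = (A *v w) \<bullet> (U *v N)"
      by (simp add: inner_vec_def[of "A *v w"] matrix_vector_mult_def[of U] sum_distrib_left symU mult_ac)
    moreover have "(\<Sum>j\<in>UNIV. \<Sum>l\<in>UNIV. N $ j * (A *v w) $ l * U $ l $ j) = (A *v w) \<bullet> (U *v N)"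
      by (subst sum.swap) (simp add: inner_vec_def[of "A *v w"] matrix_vector_mult_def[of U] sum_distrib_left mult_ac)
    ultimately show ?thesis
      unfolding sum_frame_second_partials[OF S tu e[folded N_def]]
      by (simp add: sum.distrib distrib_right)
  qed
  have "partial w (\<lambda>y. trace (shape u y)) x = V * partial w Q x + V^3 * (gradient u x \<bullet> (U *v w)) * Q x"
    unfolding H by (simp add: partial_mult dv dQ v(2)[OF _ S(2)] V_def U_def)
  moreover have "trace A = V * Q x" using H by (metis A_def V_def)
  ultimately have "partial w (\<lambda>y. trace (shape u y)) x / V = partial w Q x + V * (gradient u x \<bullet> (U *v w)) * trace A"
    using V0 by (simp add: field_simps power3_eq_cube)
  then show ?thesis using pQ by (simp add: V_def U_def A_def N_def)
qed

text \<open>The shape matrix is v g^(-1) U, hence its product with g^(-1) = I + \<nu>\<nu>^T is v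
  g^(-1) U g^(-1), which is symmetric.\<close>

lemma graph_shape_selfadjoint:
  fixes a b p :: "real^'n"
  assumes U: "transpose U = U"
  defines "\<nu> \<equiv> inverse (sqrt (1 - (norm p)\<^sup>2)) *\<^sub>R p"
  shows "a \<bullet> (graph_shape p U *v (b + (\<nu> \<bullet> b) *\<^sub>R \<nu>)) = b \<bullet> (graph_shape p U *v (a + (\<nu> \<bullet> a) *\<^sub>R \<nu>))"
proof -
  define v where "v = inverse (sqrt (1 - (norm p)\<^sup>2))"
  define G where "G y = y + (\<nu> \<bullet> y) *\<^sub>R \<nu>" for y
  have symU: "y \<bullet> (U *v z) = z \<bullet> (U *v y)" for y z
    using dot_lmul_matrix[of z U y] U by (metis inner_commute transpose_matrix_vector)
  have "y \<bullet> (graph_shape p U *v G z) = v * (G y \<bullet> (U *v G z))" for y z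
    unfolding graph_shape_mult_vec Let_def v_def[symmetric] \<nu>_def[folded v_def, symmetric]
    by (simp add: G_def[of y] inner_add_left inner_add_right inner_commute algebra_simps)
  then show ?thesis using symU[of "G a" "G b"] unfolding G_def by simp
qed

lemma dual_frame_expansion:
  fixes e d :: "'k::finite \<Rightarrow> 'a::real_inner"
  assumes "\<And>y z. (\<Sum>k\<in>UNIV. (e k \<bullet> y) * (d k \<bullet> z)) = y \<bullet> z"
  shows "z = (\<Sum>k\<in>UNIV. (d k \<bullet> z) *\<^sub>R e k)"
proof (rule vector_eq_rdot[THEN iffD1, rule_format])
  fix y show "z \<bullet> y = (\<Sum>k\<in>UNIV. (d k \<bullet> z) *\<^sub>R e k) \<bullet> y"
    using assms[of y z] by (simp add: inner_sum_left inner_sum_right inner_commute mult.commute)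
qed

text \<open>Transfers the index computation to the graph: the frame is adapted to x and constant in
  y, and the dual vectors d read off the components of \<nu> in it.\<close>

lemma graph_linearization:
  fixes u :: "real^'n \<Rightarrow> real" and P :: "real^'n \<Rightarrow> real"
  defines "H \<equiv> \<lambda>y. trace (shape u y)"
  assumes S: "open S" "x \<in> S" and u: "diff_upto 4 S u"
    and g: "\<forall>y\<in>S. norm (gradient u y) < 1"
    and P: "\<forall>y\<in>S. 2 * P y = (H y)\<^sup>2 - trace (shape u y ** shape u y)"
  obtains e :: "'n \<Rightarrow> real^'n" and \<kappa> :: "'n \<Rightarrow> real" and d :: "'n \<Rightarrow> real^'n" and c :: "'n \<Rightarrow> 'n \<Rightarrow> 'n \<Rightarrow> real"
  where "\<And>y z. (\<Sum>k\<in>UNIV. (e k \<bullet> y) * (e k \<bullet> z)) = y \<bullet> z + (normal u x \<bullet> y) * (normal u x \<bullet> z)"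
    and "\<And>k. d k = e k - (gradient u x \<bullet> e k) *\<^sub>R gradient u x"
    and "\<And>i j. d i \<bullet> e j = (if i = j then 1 else 0)"
    and "\<And>y z. (\<Sum>k\<in>UNIV. (e k \<bullet> y) * (d k \<bullet> z)) = y \<bullet> z"
    and "\<And>k. shape u x *v e k = \<kappa> k *\<^sub>R e k"
    and "\<And>k. hessian u x *v e k = (\<kappa> k / slope_factor u x) *\<^sub>R d k"
    and "H x = (\<Sum>i\<in>UNIV. \<kappa> i)"
    and "\<And>a b k. c a b k = c a k b" and "\<And>a b k. c a b k = c b a k"
    and "\<And>k. (\<Sum>i\<in>UNIV. c i i k) = partial (e k) H x"
    and "\<And>k. (\<Sum>i\<in>UNIV. (H x - \<kappa> i) * c i i k) = partial (e k) P x"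
    and "(\<Sum>i\<in>UNIV. (H x - \<kappa> i) * partial (e i) (partial (e i) H) x) =
        (\<Sum>k\<in>UNIV. partial (e k) (partial (e k) P) x)
        + (\<Sum>a\<in>UNIV. \<Sum>b\<in>UNIV. \<Sum>k\<in>UNIV. (c a b k)\<^sup>2) - (\<Sum>k\<in>UNIV. (partial (e k) H x)\<^sup>2)
        + H x * (\<Sum>k\<in>UNIV. (d k \<bullet> normal u x) * partial (e k) P x)
        - (\<Sum>i\<in>UNIV. (H x - \<kappa> i) * \<kappa> i) * (\<Sum>k\<in>UNIV. (d k \<bullet> normal u x) * partial (e k) H x)
        + H x * (\<Sum>i\<in>UNIV. (H x - \<kappa> i) * (\<kappa> i)\<^sup>2)
        - (\<Sum>i\<in>UNIV. (H x - \<kappa> i) * \<kappa> i) * (\<Sum>i\<in>UNIV. (\<kappa> i)\<^sup>2)"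
proof -
  have u4: "diff_upto (Suc 3) S u" using u by (simp add: eval_nat_numeral)
  have u2: "diff_upto 2 S u" by (rule diff_upto_mono[OF u]) simp
  have gx: "norm (gradient u x) < 1" using g S(2) by simp
  have Ux: "transpose (hessian u y) = hessian u y" if "y \<in> S" for y by (rule transpose_hessian[OF S(1) that u2])
  obtain e :: "'n \<Rightarrow> real^'n" and \<kappa> :: "'n \<Rightarrow> real" where
    e1: "\<And>y z. (\<Sum>k\<in>UNIV. (e k \<bullet> y) * (e k \<bullet> z)) = y \<bullet> z + (normal u x \<bullet> y) * (normal u x \<bullet> z)"
    and e2: "\<And>k. shape u x *v e k = \<kappa> k *\<^sub>R e k"
    and e3: "\<And>i j. e i \<bullet> e j - (gradient u x \<bullet> e i) * (gradient u x \<bullet> e j) = (if i = j then 1 else 0)"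
    and e4: "\<And>k. hessian u x *v e k = (\<kappa> k / slope_factor u x) *\<^sub>R (e k - (gradient u x \<bullet> e k) *\<^sub>R gradient u x)"
    by (rule graph_frame[OF gx Ux[OF S(2)], folded shape_def slope_factor_def normal_def]) (rule that)
  define d where "d k = e k - (gradient u x \<bullet> e k) *\<^sub>R gradient u x" for k
  have dual: "d i \<bullet> e j = (if i = j then 1 else 0)" for i j
    using e3[of i j] by (simp add: d_def inner_diff_left)
  have dsum: "(\<Sum>k\<in>UNIV. (e k \<bullet> y) * (d k \<bullet> z)) = y \<bullet> z" for y z
    unfolding d_def by (rule dual_frame[OF gx e1[unfolded normal_def slope_factor_def]])
  define m where "m a y = d a \<bullet> normal u y" for a y
  have m: "m a = (\<lambda>y. \<Sum>i\<in>UNIV. d a $ i * normal u y $ i)" for a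
    by (simp add: m_def[abs_def] inner_vec_def)
  note n = normal_derivative[OF S(1) u4 g]
  have tm: "diff_upto 3 S (m a)" for a unfolding m
    by (intro diff_upto_sum[OF S(1)] diff_upto_mult[OF S(1)] n(1) diff_upto_const) simp
  have pm: "partial w (m a) y = d a \<bullet> (shape u y *v w)" if y: "y \<in> S" for a y w
  proof -
    have "(\<lambda>y. normal u y $ i) differentiable (at y)" for i by (rule diff_uptoD[OF n(1) _ y]) simp
    then show ?thesis unfolding m by (simp add: partial_sum partial_mult n(2)[OF _ y] inner_vec_def)
  qed
  have trH: "(\<Sum>a\<in>UNIV. partial (e a) (m a) y) = H y" if "y \<in> S" for y
    unfolding H_def by (simp add: pm[OF that] dual_frame_trace[OF dsum])
  have Hx: "H x = (\<Sum>i\<in>UNIV. \<kappa> i)" using trH[OF S(2)] by (simp add: pm[OF S(2)] e2 dual)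
  show thesis
  \<comment> \<open>The inverse metric I + \<nu>\<nu>^T, evaluated on d_b and d_c, is d_b . d_c plus
    the product of the components of \<nu>; hence this choice of K.\<close>
  proof (rule linearized_mean_curvature_equation[where n=m and e=e and K="\<lambda>b c. d b \<bullet> d c" and \<kappa>=\<kappa> and P=P and S=S and x=x], goal_cases)
    show "open S" "x \<in> S" by (fact S)+
    show "diff_upto 3 S (m a)" for a by (fact tm)
    show "(\<Sum>b\<in>UNIV. partial (e b) (m a) y * (d b \<bullet> d c + m b y * m c y))
        = (\<Sum>b\<in>UNIV. partial (e b) (m c) y * (d b \<bullet> d a + m b y * m a y))" if y: "y \<in> S" for y a c
    proof -
      have *: "(\<Sum>b\<in>UNIV. partial (e b) (m a) y * (d b \<bullet> d c + m b y * m c y))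
        = d a \<bullet> (shape u y *v (d c + (normal u y \<bullet> d c) *\<^sub>R normal u y))" for a c
      proof -
        define z where "z = d c + (normal u y \<bullet> d c) *\<^sub>R normal u y"
        have "(\<Sum>b\<in>UNIV. partial (e b) (m a) y * (d b \<bullet> d c + m b y * m c y))
          = (\<Sum>b\<in>UNIV. (e b \<bullet> (d a v* shape u y)) * (d b \<bullet> z))"
          by (intro sum.cong refl)
            (simp add: pm[OF y] z_def m_def inner_add_right dot_lmul_matrix[symmetric] inner_commute mult_ac)
        then show ?thesis by (simp add: dsum dot_lmul_matrix z_def)
      qed
      show ?thesis unfolding *
        using graph_shape_selfadjoint[OF Ux[OF y], of "d a" "gradient u y" "d c"]
        by (simp add: shape_def normal_def slope_factor_def)
    qed
    show "d b \<bullet> d c + m b x * m c x = (if b = c then 1 else 0)" for b c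
    proof -
      have "d b \<bullet> d c + m b x * m c x = (\<Sum>k\<in>UNIV. (e k \<bullet> d b) * (e k \<bullet> d c))"
        unfolding e1 by (simp add: m_def inner_commute)
      also have "\<dots> = (\<Sum>k\<in>UNIV. (if b = k then 1 else 0) * (if c = k then 1 else 0))"
        by (simp add: dual inner_commute[of "e _"])
      also have "\<dots> = (if b = c then 1 else 0)" by (simp add: if_distrib[where f="\<lambda>u. u * _"] cong: if_cong)
      finally show ?thesis .
    qed
    show "partial (e b) (m a) x = (if a = b then \<kappa> a else 0)" for a b
      by (simp add: pm[OF S(2)] e2 dual)
    show "2 * P y = (\<Sum>a\<in>UNIV. partial (e a) (m a) y)\<^sup>2
        - (\<Sum>a\<in>UNIV. \<Sum>b\<in>UNIV. partial (e b) (m a) y * partial (e a) (m b) y)" if y: "y \<in> S" for y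
      using P y trH[OF y] by (simp add: pm[OF y] dual_frame_trace_square[OF dsum])
  next
    case (8 c)
    have H1: "partial w (\<lambda>y. \<Sum>a\<in>UNIV. partial (e a) (m a) y) x = partial w H x" for w
      by (rule partial_cong_open[OF S trH])
    have H2: "partial w (partial w (\<lambda>y. \<Sum>a\<in>UNIV. partial (e a) (m a) y)) x = partial w (partial w H) x" for w
      by (rule partial2_cong[OF S trH])
    show thesis
      using that[OF e1 d_def dual dsum e2 e4[folded d_def] Hx 8(1,2) 8(3)[unfolded H1]
        8(4)[folded Hx] 8(5)[unfolded H1 H2 m_def, folded Hx]] .
  qed
qed


section \<open>The interior estimate\<close>

text \<open>H is the divergence of \<nu>, which itself has one derivative less than u.\<close>

lemma diff_upto_trace_shape:
  assumes S: "open S" and u: "diff_upto (Suc (Suc k)) S u"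
    and g: "\<forall>y\<in>S. norm (gradient u y) < 1"
  shows "diff_upto k S (\<lambda>y. trace (shape u y))"
proof (rule diff_upto_cong[OF S])
  note n = normal_derivative[OF S u g]
  show "diff_upto k S (\<lambda>y. \<Sum>i\<in>UNIV. partial (axis i 1) (\<lambda>y. normal u y $ i) y)"
    by (intro diff_upto_sum[OF S] diff_upto_partial n(1)) simp
  show "(\<Sum>i\<in>UNIV. partial (axis i 1) (\<lambda>y. normal u y $ i) y) = trace (shape u y)" if "y \<in> S" for y
    by (simp add: n(2)[OF _ that] trace_def matrix_vector_mult_basis column_def)
qed

lemma Basis_triple_cases:
  fixes b :: "(real^'n) \<times> real \<times> (real^'n)"
  assumes "b \<in> Basis"
  obtains i where "b = (axis i 1, 0, 0)" | "b = (0, 1, 0)" | i where "b = (0, 0, axis i 1)"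
  using assms by (auto simp: Basis_prod_def Basis_vec_def zero_prod_def)

lemma norm_frame_mult_le:
  fixes e d f :: "'k::finite \<Rightarrow> 'a::real_inner" and L :: "'a \<Rightarrow> 'a"
  assumes ex: "\<And>y z. (\<Sum>k\<in>UNIV. (e k \<bullet> y) * (d k \<bullet> z)) = y \<bullet> z"
    and L: "linear L" "\<And>k. L (e k) = l k *\<^sub>R f k"
    and b: "\<And>k. norm (d k) \<le> \<delta>" "\<And>k. \<bar>l k\<bar> \<le> \<mu>" "\<And>k. norm (f k) \<le> \<phi>"
  shows "norm (L z) \<le> real CARD('k) * (\<delta> * \<mu> * \<phi>) * norm z"
proof -
  have "norm (L z) = norm (\<Sum>k\<in>UNIV. ((d k \<bullet> z) * l k) *\<^sub>R f k)"
    by (subst dual_frame_expansion[OF ex, of z]) (simp add: linear_sum[OF L(1)] linear_cmul[OF L(1)] L(2))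
  also have "\<dots> \<le> (\<Sum>k\<in>(UNIV::'k set). \<delta> * norm z * \<mu> * \<phi>)"
  proof (rule sum_norm_le)
    fix k
    have "\<bar>d k \<bullet> z\<bar> \<le> \<delta> * norm z"
      using Cauchy_Schwarz_ineq2[of "d k" z] b(1)[of k] mult_right_mono[OF b(1)[of k] norm_ge_zero[of z]] by linarith
    moreover have "0 \<le> \<delta>" "0 \<le> \<mu>" using b(1,2)[of k] norm_ge_zero[of "d k"] by linarith+
    ultimately show "norm (((d k \<bullet> z) * l k) *\<^sub>R f k) \<le> \<delta> * norm z * \<mu> * \<phi>"
      using b(2,3)[of k] by (auto simp: abs_mult intro!: mult_mono)
  qed
  finally show ?thesis by (simp add: mult_ac)
qed

text \<open>The bound is explicit so that the dependence on c is visible: the coefficient of H^2 on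
  the right does not contain c. Here V bounds 1/w, m H bounds DH, M' H bounds the frame derivatives
  of \<psi>(x, u, Du), and C4 H^2 is the part without c in the bound for the frame Laplacian of (x,
  u, Du).\<close>

lemma interior_inequality:
  fixes u :: "real^'n \<Rightarrow> real" and \<psi> :: "(real^'n) \<times> real \<times> (real^'n) \<Rightarrow> real"
  defines "H \<equiv> \<lambda>y. trace (shape u y)" and "n \<equiv> real CARD('n)"
    and "D \<equiv> real DIM((real^'n) \<times> real \<times> (real^'n))"
    and "W \<equiv> \<lambda>y. (y, u y, gradient u y)"
  assumes card: "CARD('n) \<ge> 2" and S: "open S" "x \<in> S" and u: "diff_upto 4 S u"
    and g: "\<forall>y\<in>S. norm (gradient u y) \<le> \<theta>" and \<theta>: "0 \<le> \<theta>" "\<theta> < 1"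
    and \<psi>: "diff_upto 2 (S \<times> UNIV \<times> UNIV) \<psi>"
    and P: "\<forall>y\<in>S. 2 * \<psi> (W y) = (H y)\<^sup>2 - trace (shape u y ** shape u y)"
    and pos: "0 < \<psi> (W x)"
    and M0: "\<psi> (W x) \<le> M"
    and M1: "\<And>b. b \<in> Basis \<Longrightarrow> \<bar>partial b \<psi> (W x)\<bar> \<le> M"
    and M2: "\<And>b d. b \<in> Basis \<Longrightarrow> d \<in> Basis \<Longrightarrow> \<bar>partial d (partial b \<psi>) (W x)\<bar> \<le> M"
    and R: "norm x \<le> R"
    and max: "\<And>y. y \<in> S \<Longrightarrow> H y * exp (c / 2 * (y \<bullet> y)) \<le> H x * exp (c / 2 * (x \<bullet> x))"
    and c: "0 \<le> c"
  defines "V \<equiv> 1 / sqrt (1 - \<theta>\<^sup>2)"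
  defines "m \<equiv> c * R * V" and "M' \<equiv> 2 * D * V * M" and "C4 \<equiv> 4 * n * V^3 + 32 * n\<^sup>2 * V^5 + 1"
  assumes h: "1 \<le> H x" "400 * n\<^sup>2 * m \<le> H x"
  shows "c * (H x)\<^sup>2 \<le> (D * C4 * M + 4 * n * D\<^sup>2 * V\<^sup>2 * M + 128 * n * M'\<^sup>2 + 2 * n * V\<^sup>2 * M' + 2 * M) * (H x)\<^sup>2
      + (D * c * R * M + 8 * m * M' + 4 * M * n * V\<^sup>2 * m) * H x"
proof -
  have g1: "\<forall>y\<in>S. norm (gradient u y) < 1" using g \<theta> by force
  define P' where "P' y = \<psi> (W y)" for y
  have trH: "trace (shape u y) = H y" for y by (simp add: H_def)
  obtain e :: "'n \<Rightarrow> real^'n" and \<kappa> :: "'n \<Rightarrow> real" and d :: "'n \<Rightarrow> real^'n" and C :: "'n \<Rightarrow> 'n \<Rightarrow> 'n \<Rightarrow> real"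
  where e1: "\<And>y z. (\<Sum>k\<in>UNIV. (e k \<bullet> y) * (e k \<bullet> z)) = y \<bullet> z + (normal u x \<bullet> y) * (normal u x \<bullet> z)"
    and dd: "\<And>k. d k = e k - (gradient u x \<bullet> e k) *\<^sub>R gradient u x"
    and dual: "\<And>i j. d i \<bullet> e j = (if i = j then 1 else 0)"
    and dsum: "\<And>y z. (\<Sum>k\<in>UNIV. (e k \<bullet> y) * (d k \<bullet> z)) = y \<bullet> z"
    and e2: "\<And>k. shape u x *v e k = \<kappa> k *\<^sub>R e k"
    and e4: "\<And>k. hessian u x *v e k = (\<kappa> k / slope_factor u x) *\<^sub>R d k"
    and Hx: "H x = (\<Sum>i\<in>UNIV. \<kappa> i)"
    and C1: "\<And>a b k. C a b k = C a k b" and C2: "\<And>a b k. C a b k = C b a k"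
    and C3: "\<And>k. (\<Sum>i\<in>UNIV. C i i k) = partial (e k) H x"
    and C4: "\<And>k. (\<Sum>i\<in>UNIV. (H x - \<kappa> i) * C i i k) = partial (e k) P' x"
    and main: "(\<Sum>i\<in>UNIV. (H x - \<kappa> i) * partial (e i) (partial (e i) H) x) =
        (\<Sum>k\<in>UNIV. partial (e k) (partial (e k) P') x)
        + (\<Sum>a\<in>UNIV. \<Sum>b\<in>UNIV. \<Sum>k\<in>UNIV. (C a b k)\<^sup>2) - (\<Sum>k\<in>UNIV. (partial (e k) H x)\<^sup>2)
        + H x * (\<Sum>k\<in>UNIV. (d k \<bullet> normal u x) * partial (e k) P' x)
        - (\<Sum>i\<in>UNIV. (H x - \<kappa> i) * \<kappa> i) * (\<Sum>k\<in>UNIV. (d k \<bullet> normal u x) * partial (e k) H x)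
        + H x * (\<Sum>i\<in>UNIV. (H x - \<kappa> i) * (\<kappa> i)\<^sup>2)
        - (\<Sum>i\<in>UNIV. (H x - \<kappa> i) * \<kappa> i) * (\<Sum>i\<in>UNIV. (\<kappa> i)\<^sup>2)"
    by (rule graph_linearization[OF S u g1, of P', unfolded trH]) (use P in \<open>simp add: P'_def\<close>, rule that)
  define p where "p = gradient u x"
  define v where "v = slope_factor u x"
  define N where "N = normal u x"
  define h where "h = H x"
  have h1: "1 \<le> h" using h by (simp add: h_def)
  have n1: "2 \<le> n" using card by (simp add: n_def)
  have np: "norm p \<le> \<theta>" using g S(2) by (simp add: p_def)
  have t2: "0 < 1 - \<theta>\<^sup>2" using \<theta> by (simp add: power_less_one_iff)
  have V2: "V\<^sup>2 * (1 - \<theta>\<^sup>2) = 1" using t2 by (simp add: V_def power_divide)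
  have V1: "1 \<le> V" using t2 \<theta> by (simp add: V_def)
  have v: "1 \<le> v" "v \<le> V"
  proof -
    have "(norm p)\<^sup>2 \<le> \<theta>\<^sup>2" using np by (intro power_mono) auto
    then show "v \<le> V" using t2 by (simp add: v_def V_def slope_factor_def p_def[symmetric] inverse_eq_divide divide_left_mono)
    have "0 < 1 - (norm p)\<^sup>2" "1 - (norm p)\<^sup>2 \<le> 1" using t2 \<open>(norm p)\<^sup>2 \<le> \<theta>\<^sup>2\<close> by auto
    then show "1 \<le> v" by (simp add: v_def slope_factor_def p_def[symmetric] one_le_inverse_iff)
  qed
  have w: "(\<Sum>i\<in>UNIV. (\<kappa> i)\<^sup>2) = trace (shape u x ** shape u x)"
    using dual_frame_trace_square[OF dsum, of "shape u x"]
    by (simp add: e2 dual power2_eq_square if_distrib[where f="\<lambda>u. u * _"] if_distrib[where f="\<lambda>u. _ * u"] cong: if_cong)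
  define w where "w = (\<Sum>i\<in>UNIV. (H x - \<kappa> i) * \<kappa> i)"
  \<comment> \<open>w is H^2 - |A|^2, that is, twice the right side of the equation. It is bounded
    by 2 M, which makes all terms containing it lower order.\<close>
  have w2: "w = 2 * \<psi> (W x)"
    using P S(2) by (simp add: w_def w[symmetric] left_diff_distrib sum_subtractf sum_distrib_left[symmetric]
        Hx power2_eq_square)
  have w0: "0 < w" "w \<le> 2 * M" using w2 pos M0 by auto
  have k2: "(\<Sum>i\<in>UNIV. (\<kappa> i)\<^sup>2) < h\<^sup>2" using P[rule_format, OF S(2)] pos by (simp add: w h_def)
  have kh: "\<bar>\<kappa> i\<bar> \<le> h" for i
  proof -
    have "(\<kappa> i)\<^sup>2 \<le> (\<Sum>i\<in>UNIV. (\<kappa> i)\<^sup>2)" by (rule member_le_sum) auto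
    then have "(\<kappa> i)\<^sup>2 \<le> h\<^sup>2" using k2 by simp
    then show ?thesis using h1 by (simp add: power2_le_iff_abs_le)
  qed
  \<comment> \<open>Unit length for the metric I - p p^T means |e_k|^2 = 1 + (p . e_k)^2, so the
    Euclidean length lies between 1 and V. The lower bound keeps the full gain of the weight
    |x|^2.\<close>
  have ne: "1 \<le> norm (e k)" "norm (e k) \<le> V" for k
  proof -
    have ee: "e k \<bullet> e k = 1 + (p \<bullet> e k)\<^sup>2"
      using dual[of k k] by (simp add: dd p_def[symmetric] inner_diff_left power2_eq_square)
    have "\<bar>p \<bullet> e k\<bar> \<le> \<theta> * norm (e k)"
      using Cauchy_Schwarz_ineq2[of p "e k"] mult_right_mono[OF np norm_ge_zero[of "e k"]] by linarith
    then have "(p \<bullet> e k)\<^sup>2 \<le> (\<theta> * norm (e k))\<^sup>2" using \<theta> by (simp add: power2_le_iff_abs_le)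
    then have "(norm (e k))\<^sup>2 * (1 - \<theta>\<^sup>2) \<le> 1"
      using ee by (simp add: power2_norm_eq_inner[symmetric] power_mult_distrib algebra_simps)
    then have "(norm (e k))\<^sup>2 * (1 - \<theta>\<^sup>2) \<le> V\<^sup>2 * (1 - \<theta>\<^sup>2)" unfolding V2 .
    then have "(norm (e k))\<^sup>2 \<le> V\<^sup>2" using t2 by simp
    then show "norm (e k) \<le> V" using V1 by (rule power2_le_imp_le[OF _ order_trans[OF zero_le_one]])
    have "1\<^sup>2 \<le> (norm (e k))\<^sup>2" using ee by (simp add: power2_norm_eq_inner)
    then show "1 \<le> norm (e k)" by (rule power2_le_imp_le) simp
  qed
  have pe: "\<bar>p \<bullet> e k\<bar> \<le> V" for k
  proof -
    have "norm p * norm (e k) \<le> 1 * V" using np \<theta> ne by (intro mult_mono) auto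
    then show ?thesis using Cauchy_Schwarz_ineq2[of p "e k"] by simp
  qed
  have nd: "norm (d k) \<le> 2 * V" for k
  proof -
    have "norm (d k) \<le> norm (e k) + \<bar>p \<bullet> e k\<bar> * norm p"
      unfolding dd p_def[symmetric] using norm_triangle_ineq4[of "e k" "(p \<bullet> e k) *\<^sub>R p"] by simp
    also have "\<bar>p \<bullet> e k\<bar> * norm p \<le> V * 1" using pe[of k] np \<theta> by (intro mult_mono) auto
    finally show ?thesis using ne(2)[of k] by simp
  qed
  have nN: "norm N \<le> V"
  proof -
    have "norm N = v * norm p" using v by (simp add: N_def normal_def v_def[symmetric] p_def[symmetric])
    also have "\<dots> \<le> V * 1" using v np \<theta> by (intro mult_mono) auto
    finally show ?thesis by simp
  qed
  have dN: "\<bar>d k \<bullet> N\<bar> \<le> 2 * V\<^sup>2" for k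
  proof -
    have "norm (d k) * norm N \<le> (2 * V) * V" using nd nN V1 by (intro mult_mono) auto
    then show ?thesis using Cauchy_Schwarz_ineq2[of "d k" N] by (simp add: power2_eq_square)
  qed
  have xe: "\<bar>x \<bullet> e k\<bar> \<le> R * V" for k
  proof -
    have "norm x * norm (e k) \<le> R * V" using R ne by (intro mult_mono) (auto intro: order_trans[OF norm_ge_zero])
    then show ?thesis using Cauchy_Schwarz_ineq2[of x "e k"] by linarith
  qed
  have R0: "0 \<le> R" using R norm_ge_zero order_trans by blast
  have M: "0 \<le> M" using M0 pos by simp
  have D: "0 \<le> D" by (simp add: D_def)
  have tH: "diff_upto 2 S H"
    unfolding H_def by (rule diff_upto_trace_shape[OF S(1) _ g1]) (use u in \<open>simp add: eval_nat_numeral\<close>)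
  have Hpos: "0 < H x" using h by simp
  note wm = weighted_max_derivatives[OF S tH Hpos max]
  have pH: "partial z H x = - c * (x \<bullet> z) * h" for z using wm(1) by (simp add: h_def)
  have kv: "\<bar>\<kappa> k / v\<bar> \<le> h" for k
  proof -
    have "\<bar>\<kappa> k / v\<bar> \<le> \<bar>\<kappa> k\<bar>"
      using v mult_left_mono[of 1 v "\<bar>\<kappa> k\<bar>"] by (simp add: abs_div divide_le_eq)
    then show ?thesis using kh[of k] by linarith
  qed
  define a where "a = 4 * n * V\<^sup>2 * h"
  have a0: "0 \<le> a" using n1 h1 by (simp add: a_def)
  have nU: "norm (hessian u x *v z) \<le> a * norm z" for z
  proof -
    from norm_frame_mult_le[OF dsum matrix_vector_mul_linear e4[folded v_def] nd kv nd]
    show ?thesis by (simp add: a_def n_def power2_eq_square mult_ac)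
  qed
  have nA: "norm (shape u x *v z) \<le> a * norm z" for z
  proof -
    have "norm (shape u x *v z) \<le> n * (2 * V * h * (2 * V)) * norm z"
      unfolding n_def by (rule norm_frame_mult_le[OF dsum matrix_vector_mul_linear e2 nd kh])
        (rule order_trans[OF ne(2)], use V1 in simp)
    then show ?thesis by (simp add: a_def power2_eq_square mult_ac)
  qed
  have u2: "diff_upto 2 S u" by (rule diff_upto_mono[OF u]) simp
  have u3: "diff_upto 3 S u" by (rule diff_upto_mono[OF u]) simp
  have tu: "diff_upto 2 S (partial z u)" for z
    by (rule diff_upto_partial) (use u3 in \<open>simp add: eval_nat_numeral\<close>)
  have du: "u differentiable (at x)" by (rule diff_uptoD[OF u2 _ S(2)]) simp
  have np1: "norm p \<le> 1" using np \<theta> by simp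
  \<comment> \<open>The third derivatives of u enter through DH alone, and the critical point
    equation gives |DH| <= c R h. This puts c at order h, not h^2.\<close>
  have T: "\<bar>\<Sum>k\<in>UNIV. partial (e k) (partial (e k) (partial (axis i 1) u)) x\<bar> \<le> c * R * h + (C4 - 1) * h\<^sup>2" for i
  proof -
    define z where "z = axis i (1::real)"
    have z: "norm z = 1" by (simp add: z_def)
    have eq: "(\<Sum>k\<in>UNIV. partial (e k) (partial (e k) (partial z u)) x) =
       partial z H x / v - v * (p \<bullet> (hessian u x *v z)) * h - 2 * ((shape u x *v z) \<bullet> (hessian u x *v N))"
      unfolding z_def using frame_laplacian_gradient[OF S u3 g1 e1, of i, unfolded trH]
      by (simp add: v_def p_def N_def h_def)
    have "\<bar>partial z H x\<bar> \<le> c * R * h"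
    proof -
      have "\<bar>x \<bullet> z\<bar> \<le> R" using Cauchy_Schwarz_ineq2[of x z] R z by simp
      then have "c * \<bar>x \<bullet> z\<bar> * h \<le> c * R * h" using c h1 by (intro mult_right_mono mult_left_mono) auto
      then show ?thesis using c h1 by (simp add: pH abs_mult)
    qed
    moreover have "\<bar>partial z H x / v\<bar> \<le> \<bar>partial z H x\<bar>"
      using v mult_left_mono[of 1 v "\<bar>partial z H x\<bar>"] by (simp add: abs_div divide_le_eq)
    ultimately have b1: "\<bar>partial z H x / v\<bar> \<le> c * R * h" by linarith
    have "\<bar>p \<bullet> (hessian u x *v z)\<bar> \<le> 1 * a"
      using Cauchy_Schwarz_ineq2[of p "hessian u x *v z"] mult_mono[OF np1, of "norm (hessian u x *v z)" a] nU[of z] a0 z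
      by simp
    then have "v * \<bar>p \<bullet> (hessian u x *v z)\<bar> * h \<le> V * (1 * a) * h"
      using v h1 V1 by (intro mult_right_mono mult_mono) auto
    then have b2: "\<bar>v * (p \<bullet> (hessian u x *v z)) * h\<bar> \<le> V * a * h" using v h1 by (simp add: abs_mult)
    have "norm (shape u x *v z) * norm (hessian u x *v N) \<le> a * (a * V)"
    proof (rule mult_mono)
      show "norm (shape u x *v z) \<le> a" using nA[of z] z by simp
      show "norm (hessian u x *v N) \<le> a * V" using nU[of N] mult_left_mono[OF nN a0] by linarith
    qed (use a0 in auto)
    then have b3: "\<bar>(shape u x *v z) \<bullet> (hessian u x *v N)\<bar> \<le> a * (a * V)"
      using Cauchy_Schwarz_ineq2[of "shape u x *v z" "hessian u x *v N"] by linarith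
    have "V * a * h + 2 * (a * (a * V)) = (C4 - 1) * h\<^sup>2"
      by (simp add: a_def C4_def power2_eq_square power3_eq_cube eval_nat_numeral algebra_simps)
    then show ?thesis using b1 b2 b3 eq unfolding z_def by linarith
  qed
  have W: "(\<lambda>y. W y \<bullet> (axis i 1, 0, 0)) = (\<lambda>y. y \<bullet> axis i 1)" "(\<lambda>y. W y \<bullet> (0, 1, 0)) = u"
    "(\<lambda>y. W y \<bullet> (0, 0, axis i 1)) = partial (axis i 1) u" for i
    by (auto simp: W_def inner_axis gradient_def)
  have tW: "diff_upto 2 S (\<lambda>y. W y \<bullet> b)" if "b \<in> Basis" for b
    using that by (cases b rule: Basis_triple_cases) (simp_all add: W diff_upto_inner u2 tu)
  have Vh: "V \<le> 2 * V * h"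
  proof -
    have "V * 1 \<le> (2 * V) * h" using V1 h1 by (intro mult_mono) auto
    then show ?thesis by simp
  qed
  have \<alpha>: "\<bar>partial (e k) (\<lambda>y. W y \<bullet> b) x\<bar> \<le> 2 * V * h" if "b \<in> Basis" for b k
    using that
  proof (cases b rule: Basis_triple_cases)
    case (1 i)
    have "\<bar>e k \<bullet> axis i 1\<bar> \<le> V" using Cauchy_Schwarz_ineq2[of "e k" "axis i 1"] ne(2)[of k] by simp
    then show ?thesis using Vh by (simp add: 1 W partial_inner)
  next
    case 2
    have "partial (e k) u x = p \<bullet> e k" unfolding p_def by (rule partial_eq_gradient[OF du])
    then show ?thesis using pe[of k] Vh by (simp add: 2 W)
  next
    case (3 i)
    have "partial (e k) (partial (axis i 1) u) x = (\<kappa> k / v) * d k $ i"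
      using partial_gradient_component[OF S u2, of "e k" i] by (simp add: e4 v_def)
    also have "\<bar>\<dots>\<bar> \<le> h * (2 * V)"
    proof -
 have "\<bar>d k $ i\<bar> \<le> 2 * V" using component_le_norm_cart[of "d k" i] nd[of k] by linarith
      then show ?thesis unfolding abs_mult using kv[of k] h1 by (intro mult_mono) auto
    qed
    finally show ?thesis by (simp add: 3 W mult_ac)
  qed
  have C41: "1 \<le> C4" using n1 V1 by (simp add: C4_def)
  have cRh: "0 \<le> c * R * h" using c R0 h1 by simp
  have hh: "h \<le> h\<^sup>2" using h1 by (simp add: power2_eq_square)
  have \<beta>: "\<bar>\<Sum>k\<in>UNIV. partial (e k) (partial (e k) (\<lambda>y. W y \<bullet> b)) x\<bar> \<le> c * R * h + C4 * h\<^sup>2"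
    if "b \<in> Basis" for b
    using that
  proof (cases b rule: Basis_triple_cases)
    case (1 i)
    have "partial z (partial z (\<lambda>y::real^'n. y \<bullet> axis i 1)) x = 0" for z
    proof -
      have "partial z (\<lambda>y::real^'n. y \<bullet> axis i 1) = (\<lambda>y. z \<bullet> axis i 1)"
        by (rule ext) (rule partial_inner)
      then show ?thesis by simp
    qed
    then show ?thesis using cRh C41 by (simp add: 1 W)
  next
    case 2
    have "partial (e k) (partial (e k) u) x = \<kappa> k / v" for k
      using dual[of k k] by (simp add: partial2_axes[OF S u2] e4 v_def[symmetric] inner_commute)
    then have "(\<Sum>k\<in>UNIV. partial (e k) (partial (e k) u) x) = h / v"
      by (simp add: h_def Hx sum_divide_distrib)
    also have "\<bar>\<dots>\<bar> \<le> h" using v h1 mult_left_mono[of 1 v h] by (simp add: divide_le_eq)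
    also have "h \<le> c * R * h + 1 * h\<^sup>2" using cRh hh by simp
    also have "\<dots> \<le> c * R * h + C4 * h\<^sup>2" using C41 by (intro add_left_mono mult_right_mono) auto
    finally show ?thesis by (simp add: 2 W)
  next
    case (3 i)
    have "(C4 - 1) * h\<^sup>2 \<le> C4 * h\<^sup>2" by (intro mult_right_mono) auto
    then show ?thesis using T[of i] by (simp add: 3 W)
  qed
  have WT: "W y \<in> S \<times> UNIV \<times> UNIV" if "y \<in> S" for y using that by (simp add: W_def)
  note cb = compose_derivative_bounds[of S x W "S \<times> UNIV \<times> UNIV" \<psi> M e "2 * V * h" "c * R * h + C4 * h\<^sup>2",
      OF S tW WT \<psi> M1 M2 \<alpha> \<beta>, folded D_def n_def P'_def]
  have P1: "\<bar>partial (e k) P' x\<bar> \<le> M' * h" for k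
    using cb(1)[of k] by (simp add: M'_def P'_def[abs_def] mult_ac)
  have P2: "(\<Sum>k\<in>UNIV. partial (e k) (partial (e k) P') x)
      \<ge> - (D * ((c * R * h + C4 * h\<^sup>2) * M)) - n * D\<^sup>2 * ((2 * V * h)\<^sup>2 * M)"
    using cb(2) by (simp add: P'_def[abs_def])
  have m0: "0 \<le> m" using c R0 V1 by (simp add: m_def)
  have M'0: "0 \<le> M'" using D V1 M by (simp add: M'_def)
  have pHm: "\<bar>partial (e k) H x\<bar> \<le> m * h" for k
  proof -
    have "c * \<bar>x \<bullet> e k\<bar> * h \<le> c * (R * V) * h" using xe[of k] c h1 by (intro mult_right_mono mult_left_mono) auto
    then show ?thesis using c h1 by (simp add: pH abs_mult m_def mult.assoc)
  qed
  have hk: "h = (\<Sum>i\<in>UNIV. \<kappa> i)" by (simp add: h_def Hx)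
  define q where "q = (\<Sum>i\<in>UNIV. (h - \<kappa> i) * (\<kappa> i)\<^sup>2)"
  define fH where "fH = (\<Sum>k\<in>UNIV. (h - \<kappa> k) * (partial (e k) H x)\<^sup>2) / h"
  define CC where "CC = (\<Sum>a\<in>UNIV. \<Sum>b\<in>UNIV. \<Sum>k\<in>UNIV. (C a b k)\<^sup>2)"
  define HH where "HH = (\<Sum>k\<in>UNIV. (partial (e k) H x)\<^sup>2)"
  have third: "CC - HH - fH + h * q \<ge> - (8 * m * M' + 128 * n * M'\<^sup>2) * h"
  proof -
    have "\<bar>\<Sum>i\<in>UNIV. C i i k\<bar> \<le> m * sum \<kappa> UNIV" for k using pHm[of k] by (simp add: C3 hk[symmetric])
    moreover have "\<bar>\<Sum>i\<in>UNIV. (sum \<kappa> UNIV - \<kappa> i) * C i i k\<bar> \<le> M' * (1 + sum \<kappa> UNIV)" for k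
      using P1[of k] M'0 by (simp add: C4 Hx[symmetric] h_def distrib_left)
    ultimately show ?thesis
      using third_order_terms_bound[of C \<kappa> m M', OF C1 C2 _ _ _ m0 M'0] k2 h
      by (simp add: C3 CC_def HH_def fH_def q_def hk[symmetric] n_def h_def)
  qed
  have fpos: "0 \<le> h - \<kappa> i" for i using kh[of i] by linarith
  \<comment> \<open>The second order condition at the maximum is weighted with h - \<kappa>_i >= 0.
    These weights add up to (n - 1) h, of which a single h is kept. The term \<open>fH\<close> is
    the one that the third order estimate removes.\<close>
  have upper: "(\<Sum>i\<in>UNIV. (h - \<kappa> i) * partial (e i) (partial (e i) H) x) \<le> fH - c * h * h"
  proof -
    have "(h - \<kappa> i) * partial (e i) (partial (e i) H) x
        \<le> (h - \<kappa> i) * (partial (e i) H x)\<^sup>2 / h - c * h * (h - \<kappa> i)" for i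
    proof -
      have "1\<^sup>2 \<le> (norm (e i))\<^sup>2" using ne(1)[of i] by (intro power_mono) auto
      then have "c * h * 1 \<le> c * h * (e i \<bullet> e i)"
        using c h1 by (intro mult_left_mono) (auto simp: power2_norm_eq_inner)
      then have "partial (e i) (partial (e i) H) x \<le> (partial (e i) H x)\<^sup>2 / h - c * h"
        using wm(2)[of "e i"] by (simp add: h_def)
      from mult_left_mono[OF this fpos[of i]] show ?thesis by (simp add: right_diff_distrib mult_ac)
    qed
    then have "(\<Sum>i\<in>UNIV. (h - \<kappa> i) * partial (e i) (partial (e i) H) x)
        \<le> (\<Sum>i\<in>UNIV. (h - \<kappa> i) * (partial (e i) H x)\<^sup>2 / h - c * h * (h - \<kappa> i))" by (intro sum_mono)
    also have "\<dots> = fH - c * h * (\<Sum>i\<in>UNIV. h - \<kappa> i)"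
      unfolding fH_def sum_divide_distrib sum_distrib_left
        sum_subtractf[of "\<lambda>i. (h - \<kappa> i) * (partial (e i) H x)\<^sup>2 / h" "\<lambda>i. c * h * (h - \<kappa> i)"] ..
    also have "(\<Sum>i\<in>UNIV. h - \<kappa> i) = (n - 1) * h"
      by (simp add: sum_subtractf hk[symmetric] n_def algebra_simps)
    also have "fH - c * h * ((n - 1) * h) \<le> fH - c * h * (1 * h)"
      using c h1 n1 by (intro diff_left_mono mult_left_mono mult_right_mono) auto
    finally show ?thesis by simp
  qed
  define X1 where "X1 = (\<Sum>k\<in>UNIV. (d k \<bullet> N) * partial (e k) P' x)"
  define X2 where "X2 = (\<Sum>k\<in>UNIV. (d k \<bullet> N) * partial (e k) H x)"
  have X1: "\<bar>X1\<bar> \<le> n * (2 * V\<^sup>2 * (M' * h))"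
    unfolding X1_def n_def by (rule order_trans[OF sum_abs], rule sum_bounded_above)
      (auto simp: abs_mult intro!: mult_mono dN P1)
  have X2: "\<bar>X2\<bar> \<le> n * (2 * V\<^sup>2 * (m * h))"
    unfolding X2_def n_def by (rule order_trans[OF sum_abs], rule sum_bounded_above)
      (auto simp: abs_mult intro!: mult_mono dN pHm)
  have main': "(\<Sum>i\<in>UNIV. (h - \<kappa> i) * partial (e i) (partial (e i) H) x) =
      (\<Sum>k\<in>UNIV. partial (e k) (partial (e k) P') x) + CC - HH + h * X1 - w * X2 + h * q
      - w * (\<Sum>i\<in>UNIV. (\<kappa> i)\<^sup>2)"
    using main by (simp add: CC_def HH_def X1_def X2_def q_def w_def N_def h_def)
  have hX1: "h * \<bar>X1\<bar> \<le> h * (n * (2 * V\<^sup>2 * (M' * h)))" using X1 h1 by (intro mult_left_mono) auto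
  have wX2: "w * \<bar>X2\<bar> \<le> (2 * M) * (n * (2 * V\<^sup>2 * (m * h)))" using X2 w0 by (intro mult_mono) auto
  have wk: "w * (\<Sum>i\<in>UNIV. (\<kappa> i)\<^sup>2) \<le> (2 * M) * h\<^sup>2"
    using k2 w0 by (intro mult_mono) (auto intro: sum_nonneg)
  have "- (h * X1) \<le> h * \<bar>X1\<bar>" using h1 mult_left_mono[of "- X1" "\<bar>X1\<bar>" h] by simp
  moreover have "w * X2 \<le> w * \<bar>X2\<bar>" using w0 by (intro mult_left_mono) auto
  \<comment> \<open>Equating the two expressions for the linearized operator applied to H cancels
    the third order sums up to the error in \<open>third\<close>; h * q has been spent
    there.\<close>
  ultimately have "c * h * h \<le> D * ((c * R * h + C4 * h\<^sup>2) * M) + n * D\<^sup>2 * ((2 * V * h)\<^sup>2 * M)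
      + (8 * m * M' + 128 * n * M'\<^sup>2) * h + h * (n * (2 * V\<^sup>2 * (M' * h)))
      + (2 * M) * (n * (2 * V\<^sup>2 * (m * h))) + (2 * M) * h\<^sup>2"
    using main' upper third P2 hX1 wX2 wk by linarith
  moreover have "128 * n * M'\<^sup>2 * h \<le> 128 * n * M'\<^sup>2 * h\<^sup>2" using hh n1 by (intro mult_left_mono) auto
  ultimately show ?thesis
    unfolding h_def[symmetric] by (simp add: power2_eq_square algebra_simps)
qed


section \<open>The estimate up to the boundary\<close>

text \<open>The weight c and the threshold h0 depend on the dimension, \<theta>, M and R alone; they
  are obtained before the domain, the solution and the right side are named.\<close>

lemma interior_estimate:
  assumes card: "CARD('n) \<ge> 2" and \<theta>: "0 \<le> \<theta>" "\<theta> < 1" and M: "0 \<le> M" and R: "0 \<le> R"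
  obtains c h0 :: real where "0 \<le> c" "1 \<le> h0"
    "\<And>S (u :: real^'n \<Rightarrow> real) \<psi> x.
      \<lbrakk>open S; x \<in> S; diff_upto 4 S u; \<forall>y\<in>S. norm (gradient u y) \<le> \<theta>;
       diff_upto 2 (S \<times> UNIV \<times> UNIV) \<psi>;
       \<forall>y\<in>S. 2 * \<psi> (y, u y, gradient u y) = (trace (shape u y))\<^sup>2 - trace (shape u y ** shape u y);
       0 < \<psi> (x, u x, gradient u x); \<forall>bs\<in>multi_indices 2. \<bar>partials bs \<psi> (x, u x, gradient u x)\<bar> \<le> M;
       norm x \<le> R;
       \<forall>y\<in>S. trace (shape u y) * exp (c / 2 * (y \<bullet> y)) \<le> trace (shape u x) * exp (c / 2 * (x \<bullet> x))\<rbrakk>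
      \<Longrightarrow> trace (shape u x) \<le> h0"
proof -
  define n where "n = real CARD('n)"
  define D where "D = real DIM((real^'n) \<times> real \<times> (real^'n))"
  define V where "V = 1 / sqrt (1 - \<theta>\<^sup>2)"
  define M' where "M' = 2 * D * V * M"
  define C4 where "C4 = 4 * n * V^3 + 32 * n\<^sup>2 * V^5 + 1"
  define K where "K = D * C4 * M + 4 * n * D\<^sup>2 * V\<^sup>2 * M + 128 * n * M'\<^sup>2 + 2 * n * V\<^sup>2 * M' + 2 * M"
  \<comment> \<open>K does not depend on c, so the inequality c h^2 \<le> K h^2 + L h turns into h \<le> L.\<close>
  define c where "c = K + 1"
  define m where "m = c * R * V"
  define L where "L = D * c * R * M + 8 * m * M' + 4 * M * n * V\<^sup>2 * m"
  define h0 where "h0 = max 1 (max (400 * n\<^sup>2 * m) L)"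
  have "0 < 1 - \<theta>\<^sup>2" using \<theta> by (simp add: power_less_one_iff)
  then have V: "0 \<le> V" by (simp add: V_def)
  have nD: "0 \<le> n" "0 \<le> D" by (simp_all add: n_def D_def)
  then have "0 \<le> M'" "0 \<le> C4" using V M by (simp_all add: M'_def C4_def)
  then have K: "0 \<le> K" using nD V M by (simp add: K_def)
  show ?thesis
  proof (rule that[of c h0])
    show "0 \<le> c" using K by (simp add: c_def)
    show "1 \<le> h0" by (simp add: h0_def)
    fix S and u :: "real^'n \<Rightarrow> real" and \<psi> x
    assume S: "open S" "x \<in> S" and u: "diff_upto 4 S u" and g: "\<forall>y\<in>S. norm (gradient u y) \<le> \<theta>"
      and \<psi>: "diff_upto 2 (S \<times> UNIV \<times> UNIV) \<psi>"
      and P: "\<forall>y\<in>S. 2 * \<psi> (y, u y, gradient u y) = (trace (shape u y))\<^sup>2 - trace (shape u y ** shape u y)"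
      and pos: "0 < \<psi> (x, u x, gradient u x)"
      and bd: "\<forall>bs\<in>multi_indices 2. \<bar>partials bs \<psi> (x, u x, gradient u x)\<bar> \<le> M"
      and x: "norm x \<le> R"
      and max: "\<forall>y\<in>S. trace (shape u y) * exp (c / 2 * (y \<bullet> y)) \<le> trace (shape u x) * exp (c / 2 * (x \<bullet> x))"
    show "trace (shape u x) \<le> h0"
    proof (rule ccontr)
      assume "\<not> ?thesis"
      then have h: "1 \<le> trace (shape u x)" "400 * n\<^sup>2 * m \<le> trace (shape u x)" "L < trace (shape u x)"
        by (auto simp: h0_def)
      have M0: "\<psi> (x, u x, gradient u x) \<le> M"
        using bd[rule_format, of "[]"] by (simp add: multi_indices_def)
      have M1: "\<bar>partial b \<psi> (x, u x, gradient u x)\<bar> \<le> M" if "b \<in> Basis" for b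
        using bd[rule_format, of "[b]"] that by (simp add: multi_indices_def)
      have M2: "\<bar>partial d (partial b \<psi>) (x, u x, gradient u x)\<bar> \<le> M" if "b \<in> Basis" "d \<in> Basis" for b d
        using bd[rule_format, of "[d, b]"] that by (simp add: multi_indices_def)
      have "c * (trace (shape u x))\<^sup>2 \<le> K * (trace (shape u x))\<^sup>2 + L * trace (shape u x)"
        unfolding K_def L_def m_def M'_def C4_def V_def n_def D_def
        by (rule interior_inequality[OF card S u g \<theta> \<psi> P pos M0 M1 M2 x max[rule_format]])
          (use h K in \<open>simp_all add: c_def m_def V_def n_def\<close>)
      then have "(trace (shape u x))\<^sup>2 \<le> L * trace (shape u x)" by (simp add: c_def distrib_right)
      then have "trace (shape u x) \<le> L" using h(1) by (simp add: power2_eq_square)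
      then show False using h(3) by simp
    qed
  qed
qed

section \<open>Continuous extensions and curvatures on the closure of the domain\<close>

lemma cont_ext_eq:
  assumes "open S" "x \<in> closure S" "continuous_on (closure S) g" "\<And>y. y \<in> S \<Longrightarrow> g y = f y"
  shows "cont_ext S f x = g x"
proof -
  \<comment> \<open>Every point of the closure of an open set is a limit point of it; this makes the
    filter nontrivial and the value of \<open>Lim\<close> unique.\<close>
  have "x islimpt S"
    using assms(1,2) by (metis Un_iff closure_def interior_limit_point interior_open mem_Collect_eq)
  then have "at x within S \<noteq> bot" by (simp add: trivial_limit_within)
  moreover have "(g \<longlongrightarrow> g x) (at x within S)"
    using assms(2,3) closure_subset[of S] by (meson continuous_on_def tendsto_within_subset)
  then have "(f \<longlongrightarrow> g x) (at x within S)"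
    by (rule Lim_transform_eventually) (simp add: eventually_at_topological assms(4), blast)
  ultimately show ?thesis unfolding cont_ext_def by (rule tendsto_Lim)
qed

lemma cont_ext_interior:
  assumes "open S" "x \<in> S" "continuous_on S f"
  shows "cont_ext S f x = f x"
proof -
  have "at x within S \<noteq> bot" using at_within_open[OF assms(2,1)] by simp
  moreover have "(f \<longlongrightarrow> f x) (at x within S)"
    using assms(2,3) unfolding continuous_on_def by blast
  ultimately show ?thesis unfolding cont_ext_def by (rule tendsto_Lim)
qed

text \<open>The last claim carries identities between derivatives from the interior to the boundary;
  it gives the symmetry of the extended Hessian there.\<close>

lemma cont_ext_partials:
  assumes S: "open S" and u: "Ck_on_closure k S u" and bs: "bs \<in> multi_indices k"
  shows "continuous_on (closure S) (cont_ext S (partials bs u))"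
    and "x \<in> S \<Longrightarrow> cont_ext S (partials bs u) x = partials bs u x"
    and "x \<in> closure S \<Longrightarrow> (\<And>y. y \<in> S \<Longrightarrow> partials bs u y = f y) \<Longrightarrow>
      cont_ext S (partials bs u) x = cont_ext S f x"
proof -
  obtain g where g: "continuous_on (closure S) g" "\<And>y. y \<in> S \<Longrightarrow> g y = partials bs u y"
    using u bs unfolding Ck_on_closure_def by blast
  have eq: "cont_ext S (partials bs u) y = g y" if "y \<in> closure S" for y
    by (rule cont_ext_eq[OF S that g])
  show "continuous_on (closure S) (cont_ext S (partials bs u))"
    using g(1) by (rule continuous_on_eq) (simp add: eq)
  show "cont_ext S (partials bs u) x = partials bs u x" if "x \<in> S"
    using eq[of x] g(2)[OF that] that closure_subset by auto
  show "cont_ext S (partials bs u) x = cont_ext S f x"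
    if "x \<in> closure S" "\<And>y. y \<in> S \<Longrightarrow> partials bs u y = f y"
    using eq[OF that(1)] cont_ext_eq[OF S that(1) g(1), of f] g(2) that(2) by simp
qed

lemma curvature_matrix_eq:
  fixes u :: "real^'n \<Rightarrow> real"
  shows "curvature_matrix S u x = graph_shape (Grad S u x) (Hess S u x)"
proof -
  have "outer (a *\<^sub>R p) (a *\<^sub>R p) = a\<^sup>2 *\<^sub>R outer p p" for a and p :: "real^'n"
    by (simp add: outer_def vec_eq_iff power2_eq_square)
  then show ?thesis
    by (simp add: curvature_matrix_def graph_shape_def Let_def inverse_eq_divide power_divide)
qed

lemma spacelike_graph_closure:
  fixes u :: "real^'n \<Rightarrow> real"
  assumes S: "open S" and u: "Ck_on_closure 2 S u"
  shows "x \<in> S \<Longrightarrow> Grad S u x = gradient u x" "x \<in> S \<Longrightarrow> Hess S u x = hessian u x"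
    "x \<in> closure S \<Longrightarrow> transpose (Hess S u x) = Hess S u x"
    "\<forall>x\<in>closure S. norm (Grad S u x) < 1 \<Longrightarrow> continuous_on (closure S) (\<lambda>x. trace (curvature_matrix S u x))"
proof -
  have m1: "[axis i (1::real)] \<in> multi_indices 2" and m2: "[axis i (1::real), axis j 1] \<in> multi_indices 2"
    for i j :: 'n by (simp_all add: multi_indices_def)
  note e1 = cont_ext_partials[OF S u m1] and e2 = cont_ext_partials[OF S u m2]
  have u2: "diff_upto 2 S u"
    by (rule Ck_on_imp_diff_upto[OF S]) (use u in \<open>simp add: Ck_on_closure_def\<close>)
  show "x \<in> S \<Longrightarrow> Grad S u x = gradient u x" using e1(2)[of x] by (simp add: Grad_def gradient_def)
  show "x \<in> S \<Longrightarrow> Hess S u x = hessian u x" using e2(2)[of x] by (simp add: Hess_def hessian_def)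
  show "transpose (Hess S u x) = Hess S u x" if "x \<in> closure S"
  proof -
    have "cont_ext S (partials [axis i 1, axis j 1] u) x = cont_ext S (partials [axis j 1, axis i 1] u) x" for i j
      by (rule e2(3)[OF that]) (use partial_commute[OF S _ u2] in simp)
    then show ?thesis by (simp add: vec_eq_iff transpose_def Hess_def)
  qed
  assume g: "\<forall>x\<in>closure S. norm (Grad S u x) < 1"
  have cG: "continuous_on (closure S) (Grad S u)"
    unfolding Grad_def[abs_def] by (intro continuous_on_vec_lambda e1(1))
  have cH: "continuous_on (closure S) (\<lambda>x. Hess S u x $ i $ j)" for i j
    unfolding Hess_def[abs_def] using e2(1) by simp
  have "0 < 1 - (norm (Grad S u x))\<^sup>2" if "x \<in> closure S" for x
    using g that by (simp add: abs_square_less_1)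
  then have cv: "continuous_on (closure S) (\<lambda>x. inverse (sqrt (1 - (norm (Grad S u x))\<^sup>2)))"
    by (intro continuous_intros cG) force
  show "continuous_on (closure S) (\<lambda>x. trace (curvature_matrix S u x))"
    unfolding curvature_matrix_eq trace_graph_shape
    by (intro continuous_intros cv cG cH)
qed

lemma curvature_max_bounds:
  fixes u :: "real^'n \<Rightarrow> real"
  assumes S: "open S" and u: "Ck_on_closure 2 S u" and a: "admissible 2 S u"
    and g: "norm (Grad S u x) < 1" and x: "x \<in> closure S"
  defines "H \<equiv> trace (curvature_matrix S u x)"
  shows "0 < H" "curvature_max S u x \<le> H" "H \<le> real CARD('n) * curvature_max S u x"
    "2 * sigma_op 2 S u x = H\<^sup>2 - trace (curvature_matrix S u x ** curvature_matrix S u x)"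
    "0 < sigma_op 2 S u x"
proof -
  note e = graph_shape_eigvals[OF g spacelike_graph_closure(3)[OF S u x], folded curvature_matrix_eq]
  have s: "0 < sigma_op 1 S u x" "0 < sigma_op 2 S u x" using a x by (auto simp: admissible_def)
  show H: "0 < H" using s(1) e(1) unfolding sigma_op_def curvatures_def H_def by linarith
  show "0 < sigma_op 2 S u x" by (fact s)
  show "curvature_max S u x \<le> H" "H \<le> real CARD('n) * curvature_max S u x"
    using e(3) H e(4) s(2) by (simp_all add: curvature_max_def sigma_op_def curvatures_def H_def)
  show "2 * sigma_op 2 S u x = H\<^sup>2 - trace (curvature_matrix S u x ** curvature_matrix S u x)"
    using e(2) by (simp add: sigma_op_def curvatures_def H_def)
qed

text \<open>Packaged so that C stands outside the quantifiers over u and \<psi>. The bound M on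
  \<psi> and its derivatives is imposed only at the points (x, u, Du).\<close>

definition curvature_bound :: "(real^'n) set \<Rightarrow> real \<Rightarrow> real \<Rightarrow> real \<Rightarrow> bool"
  where "curvature_bound \<Omega> \<theta> M C \<longleftrightarrow> (\<forall>u \<psi>.
    diff_upto 2 (\<Omega> \<times> UNIV \<times> UNIV) \<psi> \<longrightarrow> diff_upto 4 \<Omega> u \<longrightarrow> Ck_on_closure 2 \<Omega> u \<longrightarrow>
    admissible 2 \<Omega> u \<longrightarrow> (\<forall>x\<in>closure \<Omega>. norm (Grad \<Omega> u x) \<le> \<theta>) \<longrightarrow>
    (\<forall>x\<in>\<Omega>. sigma_op 2 \<Omega> u x = \<psi> (x, u x, Grad \<Omega> u x)) \<longrightarrow>
    (\<forall>x\<in>\<Omega>. \<forall>bs\<in>multi_indices 2. \<bar>partials bs \<psi> (x, u x, Grad \<Omega> u x)\<bar> \<le> M) \<longrightarrow>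
    (SUP x\<in>\<Omega>. curvature_max \<Omega> u x) \<le> C * (1 + (SUP x\<in>frontier \<Omega>. curvature_max \<Omega> u x)))"

text \<open>The weighted H attains its maximum over the compact closure. At an interior point the
  interior estimate applies; at a boundary point H <= n \<kappa>_max.\<close>

lemma global_curvature_bound:
  fixes \<Omega> :: "(real^'n) set"
  assumes card: "CARD('n) \<ge> 2" and \<Omega>: "open \<Omega>" "bounded \<Omega>" "\<Omega> \<noteq> {}"
    and \<theta>: "0 \<le> \<theta>" "\<theta> < 1" and M: "0 \<le> M"
  obtains C where "0 < C" "curvature_bound \<Omega> \<theta> M C"
proof -
  obtain R where R: "0 \<le> R" "\<And>x. x \<in> closure \<Omega> \<Longrightarrow> norm x \<le> R"
    using bounded_closure[OF \<Omega>(2)] unfolding bounded_iff by (metis norm_ge_zero order_trans closure_eq_empty \<Omega>(3) ex_in_conv)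
  obtain c h0 :: real where c: "0 \<le> c" and h0: "1 \<le> h0" and int:
    "\<And>S (u :: real^'n \<Rightarrow> real) \<psi> x.
      \<lbrakk>open S; x \<in> S; diff_upto 4 S u; \<forall>y\<in>S. norm (gradient u y) \<le> \<theta>;
       diff_upto 2 (S \<times> UNIV \<times> UNIV) \<psi>;
       \<forall>y\<in>S. 2 * \<psi> (y, u y, gradient u y) = (trace (shape u y))\<^sup>2 - trace (shape u y ** shape u y);
       0 < \<psi> (x, u x, gradient u x); \<forall>bs\<in>multi_indices 2. \<bar>partials bs \<psi> (x, u x, gradient u x)\<bar> \<le> M;
       norm x \<le> R;
       \<forall>y\<in>S. trace (shape u y) * exp (c / 2 * (y \<bullet> y)) \<le> trace (shape u x) * exp (c / 2 * (x \<bullet> x))\<rbrakk>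
      \<Longrightarrow> trace (shape u x) \<le> h0"
    by (rule interior_estimate[OF card \<theta> M R(1)]) (rule that)
  \<comment> \<open>An upper bound for the weight, which is at least 1; hence H is at most E times
    its value at the maximum point of the weighted function.\<close>
  define E where "E = exp (c / 2 * R\<^sup>2)"
  define n where "n = real CARD('n)"
  show ?thesis
  proof (rule that[of "E * (h0 + n)"])
    show "0 < E * (h0 + n)" using h0 by (simp add: E_def n_def add_pos_nonneg)
    show "curvature_bound \<Omega> \<theta> M (E * (h0 + n))"
      unfolding curvature_bound_def
    proof (intro allI impI)
    fix u :: "real^'n \<Rightarrow> real" and \<psi>
    assume \<psi>: "diff_upto 2 (\<Omega> \<times> UNIV \<times> UNIV) \<psi>" and u4: "diff_upto 4 \<Omega> u"
      and u: "Ck_on_closure 2 \<Omega> u" and adm: "admissible 2 \<Omega> u"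
      and g: "\<forall>x\<in>closure \<Omega>. norm (Grad \<Omega> u x) \<le> \<theta>"
      and eq: "\<forall>x\<in>\<Omega>. sigma_op 2 \<Omega> u x = \<psi> (x, u x, Grad \<Omega> u x)"
      and bd: "\<forall>x\<in>\<Omega>. \<forall>bs\<in>multi_indices 2. \<bar>partials bs \<psi> (x, u x, Grad \<Omega> u x)\<bar> \<le> M"
    define H where "H x = trace (curvature_matrix \<Omega> u x)" for x
    have cl: "x \<in> closure \<Omega>" if "x \<in> \<Omega>" for x using that closure_subset by blast
    have g1: "\<forall>x\<in>closure \<Omega>. norm (Grad \<Omega> u x) < 1" using g \<theta> by force
    note sg = spacelike_graph_closure[OF \<Omega>(1) u]
    have cb: "0 < H x" "curvature_max \<Omega> u x \<le> H x" "H x \<le> n * curvature_max \<Omega> u x" if "x \<in> closure \<Omega>" for x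
      using curvature_max_bounds[OF \<Omega>(1) u adm g1[rule_format, OF that] that] by (simp_all add: H_def n_def)
    have cH: "continuous_on (closure \<Omega>) H"
      unfolding H_def[abs_def] by (rule sg(4)[OF g1])
    have comp: "compact (closure \<Omega>)" using \<Omega>(2) by (simp add: compact_closure)
    have ne: "closure \<Omega> \<noteq> {}" using \<Omega>(3) by simp
    have "continuous_on (closure \<Omega>) (\<lambda>x. H x * exp (c / 2 * (x \<bullet> x)))"
      by (intro continuous_intros cH)
    then obtain x0 where x0: "x0 \<in> closure \<Omega>"
      and max: "\<And>y. y \<in> closure \<Omega> \<Longrightarrow> H y * exp (c / 2 * (y \<bullet> y)) \<le> H x0 * exp (c / 2 * (x0 \<bullet> x0))"
      using continuous_attains_sup[OF comp ne] by blast
    have HE: "H x \<le> H x0 * E" if "x \<in> closure \<Omega>" for x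
    proof -
      have "H x * 1 \<le> H x * exp (c / 2 * (x \<bullet> x))"
        using c cb(1)[OF that] by (intro mult_left_mono) auto
      also have "\<dots> \<le> H x0 * exp (c / 2 * (x0 \<bullet> x0))" by (rule max[OF that])
      also have "\<dots> \<le> H x0 * E"
      proof -
        have "x0 \<bullet> x0 \<le> R\<^sup>2" using R(2)[OF x0] by (simp add: power2_norm_eq_inner[symmetric] power_mono)
        then show ?thesis using cb(1)[OF x0] c unfolding E_def by (intro mult_left_mono) (auto intro: mult_left_mono)
      qed
      finally show ?thesis by simp
    qed
    \<comment> \<open>A nonempty frontier and the bound on \<kappa>_max along it make the real
      supremum B a genuine one.\<close>
    have fne: "frontier \<Omega> \<noteq> {}"
      using frontier_not_empty[of \<Omega>] \<Omega>(2,3) not_bounded_UNIV by blast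
    have fcl: "x \<in> closure \<Omega>" if "x \<in> frontier \<Omega>" for x using that by (simp add: frontier_def)
    define B where "B = (SUP x\<in>frontier \<Omega>. curvature_max \<Omega> u x)"
    have Bge: "curvature_max \<Omega> u x \<le> B" if "x \<in> frontier \<Omega>" for x
      unfolding B_def
    proof (rule cSUP_upper[OF that])
      show "bdd_above (curvature_max \<Omega> u ` frontier \<Omega>)"
        by (rule bdd_aboveI2[of _ _ "H x0 * E"]) (use cb(2) HE fcl in \<open>blast intro: order_trans\<close>)
    qed
    \<comment> \<open>Positivity of B is what allows h0 and n B to be estimated by the same product
      (h0 + n) (1 + B).\<close>
    have B0: "0 < B"
    proof -
      obtain y where y: "y \<in> frontier \<Omega>" using fne by blast
      have "0 < n * curvature_max \<Omega> u y" using cb(1,3)[OF fcl[OF y]] by linarith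
      then have "0 < curvature_max \<Omega> u y" by (simp add: n_def zero_less_mult_iff)
      then show ?thesis using Bge[OF y] by linarith
    qed
    have Hx0: "H x0 \<le> (h0 + n) * (1 + B)"
    proof (cases "x0 \<in> \<Omega>")
      case True
      have sh: "H x = trace (shape u x)" "curvature_matrix \<Omega> u x = shape u x" "Grad \<Omega> u x = gradient u x" if "x \<in> \<Omega>" for x
        using that by (simp_all add: H_def curvature_matrix_eq sg(1,2) shape_def)
      have "trace (shape u x0) \<le> h0"
      proof (rule int[OF \<Omega>(1) True u4 _ \<psi>])
        show "\<forall>y\<in>\<Omega>. norm (gradient u y) \<le> \<theta>" using g cl sh(3) by metis
        show "\<forall>y\<in>\<Omega>. 2 * \<psi> (y, u y, gradient u y) = (trace (shape u y))\<^sup>2 - trace (shape u y ** shape u y)"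
        proof
          fix y assume y: "y \<in> \<Omega>"
          show "2 * \<psi> (y, u y, gradient u y) = (trace (shape u y))\<^sup>2 - trace (shape u y ** shape u y)"
            using curvature_max_bounds(4)[OF \<Omega>(1) u adm g1[rule_format, OF cl[OF y]] cl[OF y]] eq y
            by (simp add: sh[OF y])
        qed
        show "0 < \<psi> (x0, u x0, gradient u x0)"
          using curvature_max_bounds(5)[OF \<Omega>(1) u adm g1[rule_format, OF x0] x0] eq True by (simp add: sh[OF True])
        show "\<forall>bs\<in>multi_indices 2. \<bar>partials bs \<psi> (x0, u x0, gradient u x0)\<bar> \<le> M"
          using bspec[OF bd True] unfolding sh(3)[OF True] .
        show "norm x0 \<le> R" by (rule R(2)[OF x0])
        show "\<forall>y\<in>\<Omega>. trace (shape u y) * exp (c / 2 * (y \<bullet> y)) \<le> trace (shape u x0) * exp (c / 2 * (x0 \<bullet> x0))"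
          using max cl sh(1) True by metis
      qed
      then have "H x0 \<le> h0 * 1" using sh(1)[OF True] by simp
      also have "\<dots> \<le> (h0 + n) * (1 + B)" using h0 B0 by (intro mult_mono) (auto simp: n_def)
      finally show ?thesis .
    next
      case False
      then have x0f: "x0 \<in> frontier \<Omega>" using x0 \<Omega>(1) by (simp add: frontier_def interior_open)
      have "H x0 \<le> n * curvature_max \<Omega> u x0" by (rule cb(3)[OF x0])
      also have "\<dots> \<le> n * B" using Bge[OF x0f] by (intro mult_left_mono) (auto simp: n_def)
      also have "\<dots> \<le> (h0 + n) * (1 + B)" using h0 B0 by (intro mult_mono) (auto simp: n_def)
      finally show ?thesis .
    qed
    show "(SUP x\<in>\<Omega>. curvature_max \<Omega> u x) \<le> E * (h0 + n) * (1 + (SUP x\<in>frontier \<Omega>. curvature_max \<Omega> u x))"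
    proof (rule cSUP_least[OF \<Omega>(3)])
      fix x assume x: "x \<in> \<Omega>"
      have "curvature_max \<Omega> u x \<le> H x0 * E" using cb(2)[OF cl[OF x]] HE[OF cl[OF x]] by linarith
      also have "\<dots> \<le> ((h0 + n) * (1 + B)) * E" using Hx0 by (intro mult_right_mono) (auto simp: E_def)
      finally show "curvature_max \<Omega> u x \<le> E * (h0 + n) * (1 + (SUP x\<in>frontier \<Omega>. curvature_max \<Omega> u x))"
        by (simp add: B_def mult_ac)
    qed
    qed
  qed
qed

lemma partials_le_Ck_norm:
  assumes S: "open S" and f: "Ck_on k S f" and x: "x \<in> S" "x \<in> A"
    and fin: "Ck_norm k S A f < \<infinity>" and bs: "bs \<in> multi_indices k"
  shows "\<bar>partials bs f x\<bar> \<le> enn2real (Ck_norm k S A f)"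
proof -
  let ?s = "\<lambda>bs. SUP x\<in>A. ennreal \<bar>cont_ext S (partials bs f) x\<bar>"
  have "cont_ext S (partials bs f) x = partials bs f x"
    using f bs by (intro cont_ext_interior[OF S x(1)]) (simp add: Ck_on_def)
  then have "ennreal \<bar>partials bs f x\<bar> \<le> ?s bs" using SUP_upper[OF x(2), of "\<lambda>x. ennreal \<bar>cont_ext S (partials bs f) x\<bar>"] by simp
  also have "\<dots> \<le> Ck_norm k S A f"
  proof -
    have "finite (multi_indices k :: 'a list set)"
      unfolding multi_indices_def by (intro finite_lists_length_le) simp
    then show ?thesis unfolding Ck_norm_def using bs by (intro member_le_sum) auto
  qed
  finally show ?thesis using enn2real_mono[of "ennreal \<bar>partials bs f x\<bar>" "Ck_norm k S A f"] fin by simp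
qed

theorem theorem4p5:
  fixes \<Omega> :: "(real^'n) set"
  assumes "CARD('n) \<ge> 3"
    and "smooth_bounded_domain \<Omega>"
    and "convex_domain \<Omega>"
    and "admissible_domain 1 \<Omega>"
  shows "\<exists>C :: ennreal \<times> ennreal \<Rightarrow> ennreal \<Rightarrow> ennreal \<Rightarrow> real.
    (\<forall>a b c. C a b c > 0) \<and>
    (\<forall>(\<psi> :: (real^'n) \<times> real \<times> (real^'n) \<Rightarrow> real) (\<phi> :: real^'n \<Rightarrow> real) (u :: real^'n \<Rightarrow> real).
      let \<D> = closure \<Omega> \<times> {(INF x\<in>\<Omega>. u x)..(SUP x\<in>\<Omega>. u x)} \<times> UNIV;
          norm_\<psi> = Ck_norm 2 (\<Omega> \<times> UNIV \<times> UNIV) \<D> \<psi>;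
          norm_\<phi> = Ck_norm 1 \<Omega> (closure \<Omega>) \<phi>
      in Ck_on_closure 2 (\<Omega> \<times> UNIV \<times> UNIV) \<psi> \<longrightarrow>
         (\<forall>x\<in>closure \<Omega>. \<forall>z p. \<psi> (x, z, p) > 0) \<longrightarrow>
         norm_\<psi> < \<infinity> \<longrightarrow>
         Ck_on_closure 2 \<Omega> \<phi> \<longrightarrow>
         spacelike \<Omega> \<phi> \<longrightarrow>
         Ck_on 4 \<Omega> u \<longrightarrow>
         Ck_on_closure 2 \<Omega> u \<longrightarrow>
         admissible 2 \<Omega> u \<longrightarrow>
         (\<forall>x\<in>\<Omega>. sigma_op 2 \<Omega> u x = \<psi> (x, u x, Grad \<Omega> u x)) \<longrightarrow>
         (\<forall>x\<in>frontier \<Omega>. u x = \<phi> x) \<longrightarrow>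
         (SUP x\<in>\<Omega>. curvature_max \<Omega> u x)
           \<le> C (C1_size \<Omega> u) norm_\<psi> norm_\<phi> *
              (1 + (SUP x\<in>frontier \<Omega>. curvature_max \<Omega> u x)))"
proof -
  have card: "CARD('n) \<ge> 2" using assms(1) by simp
  have \<Omega>: "open \<Omega>" "bounded \<Omega>" "\<Omega> \<noteq> {}" using assms(2) by (simp_all add: smooth_bounded_domain_def)
  \<comment> \<open>The constant is selected for each pair (\<theta>, M) at once, with the default 1
    where the pair is out of range, so that it becomes a positive function of real
    arguments.\<close>
  have "\<exists>C>0. 0 \<le> fst t \<longrightarrow> fst t < 1 \<longrightarrow> 0 \<le> snd t \<longrightarrow> curvature_bound \<Omega> (fst t) (snd t) C" for t :: "real \<times> real"
  proof (cases "0 \<le> fst t \<and> fst t < 1 \<and> 0 \<le> snd t")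
    case True
    then show ?thesis using global_curvature_bound[OF card \<Omega>, of "fst t" "snd t"] by metis
  qed (auto intro: exI[of _ 1])
  then obtain C0 where C0: "\<And>t. 0 < C0 t" "\<And>t. 0 \<le> fst t \<Longrightarrow> fst t < 1 \<Longrightarrow> 0 \<le> snd t \<Longrightarrow>
      curvature_bound \<Omega> (fst t) (snd t) (C0 t)"
    by metis
  show ?thesis
    unfolding Let_def
  proof (intro exI[of _ "\<lambda>a b c. C0 (enn2real (snd a), enn2real b)"] conjI allI impI)
    fix a b c show "0 < C0 (enn2real (snd a), enn2real b)" by (rule C0)
  next
    fix \<psi> :: "(real^'n) \<times> real \<times> (real^'n) \<Rightarrow> real" and \<phi> u :: "real^'n \<Rightarrow> real"
    let ?T = "\<Omega> \<times> UNIV \<times> UNIV :: ((real^'n) \<times> real \<times> (real^'n)) set"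
    let ?D = "closure \<Omega> \<times> {(INF x\<in>\<Omega>. u x)..(SUP x\<in>\<Omega>. u x)} \<times> UNIV :: ((real^'n) \<times> real \<times> (real^'n)) set"
    let ?N = "Ck_norm 2 ?T ?D \<psi>"
    assume \<psi>: "Ck_on_closure 2 ?T \<psi>" and fin: "?N < \<infinity>"
      and u: "Ck_on 4 \<Omega> u" "Ck_on_closure 2 \<Omega> u" "admissible 2 \<Omega> u"
      and eq: "\<forall>x\<in>\<Omega>. sigma_op 2 \<Omega> u x = \<psi> (x, u x, Grad \<Omega> u x)"
    have T: "open ?T" using \<Omega>(1) by (intro open_Times) auto
    have \<psi>C: "Ck_on 2 ?T \<psi>" using \<psi> by (simp add: Ck_on_closure_def)
    \<comment> \<open>G = sup |Du| takes the role of \<theta>; that the definition of spacelike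
      bounds the supremum, and not just each value, strictly by 1 is what makes it admissible
      there.\<close>
    define G where "G = snd (C1_size \<Omega> u)"
    have G: "G < 1" using u(3) by (simp add: G_def C1_size_def admissible_def spacelike_def)
    have Gfin: "G < \<infinity>" using G by (metis ennreal_one_less_top order_less_trans infinity_ennreal_def)
    have "ennreal (enn2real G) < ennreal 1" using G Gfin by simp
    then have \<theta>: "enn2real G < 1" using ennreal_less_iff[of "enn2real G" 1] by simp
    have grad: "norm (Grad \<Omega> u x) \<le> enn2real G" if "x \<in> closure \<Omega>" for x
    proof -
      have "ennreal (norm (Grad \<Omega> u x)) \<le> G"
        unfolding G_def C1_size_def snd_conv by (rule SUP_upper[OF that])
      from enn2real_mono[OF this] show ?thesis using Gfin by simp
    qed
    have "bounded (u ` closure \<Omega>)"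
      using \<Omega>(2) u(2) by (intro compact_imp_bounded compact_continuous_image)
        (simp_all add: Ck_on_closure_def compact_closure)
    then have bu: "bounded (u ` \<Omega>)" by (rule bounded_subset) (use closure_subset in blast)
    \<comment> \<open>The arguments at which \<psi> is evaluated lie in the set over which its norm
      is taken. Boundedness of u makes the infimum and supremum that delimit this set true
      bounds.\<close>
    have D: "(x, u x, Grad \<Omega> u x) \<in> ?D" if "x \<in> \<Omega>" for x
      using that closure_subset[of \<Omega>] bounded_imp_bdd_below[OF bu] bounded_imp_bdd_above[OF bu]
      by (auto intro: cINF_lower cSUP_upper)
    have "curvature_bound \<Omega> (enn2real G) (enn2real ?N) (C0 (enn2real G, enn2real ?N))"
      using C0(2)[of "(enn2real G, enn2real ?N)"] by (simp add: \<theta>)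
    moreover have "diff_upto 2 ?T \<psi>" by (rule Ck_on_imp_diff_upto[OF T \<psi>C])
    moreover have "diff_upto 4 \<Omega> u" by (rule Ck_on_imp_diff_upto[OF \<Omega>(1) u(1)])
    moreover have "\<forall>x\<in>closure \<Omega>. norm (Grad \<Omega> u x) \<le> enn2real G" using grad by blast
    moreover have "\<forall>x\<in>\<Omega>. \<forall>bs\<in>multi_indices 2. \<bar>partials bs \<psi> (x, u x, Grad \<Omega> u x)\<bar> \<le> enn2real ?N"
      using partials_le_Ck_norm[OF T \<psi>C _ D fin] by simp
    ultimately show "(SUP x\<in>\<Omega>. curvature_max \<Omega> u x) \<le> C0 (enn2real (snd (C1_size \<Omega> u)), enn2real ?N)
        * (1 + (SUP x\<in>frontier \<Omega>. curvature_max \<Omega> u x))"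
      using u(2,3) eq unfolding curvature_bound_def G_def by blast
  qed
qed

end
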